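(* Let $n\in\mathbb{N}$, let $K\subset\mathbb{R}^n$ be a convex body, let $\beta\subset\mathbb{R}^n$ be a Borel set, and let $i,k,r,s\in\mathbb{N}_0$ with $k<n$. If $s=0$, then $$\int_{A(n,k)} Q(E)^i\,\phi_{k,E}^{r,s,0}(K\cap E,\beta\cap E)\,\mu_k(\mathrm{d}E)=\frac{\Gamma(\frac n2)\,\Gamma(\frac k2+i)}{\Gamma(\frac n2+i)\,\Gamma(\frac k2)}\,Q^i\,\phi_n^{r,0,0}(K,\beta),$$ where the coefficient on the right-hand side is interpreted as $0$ if $k=0$ and $i\neq 0$, and as $1$ if $k=i=0$. If $s\neq 0$, the integral on the left-hand side is zero.
   Context: A convex body is a non-empty compact convex subset of $\mathbb{R}^n$. $\mathcal{H}^m$ is $m$-dimensional Hausdorff measure. $G(n,k)$ is the Grassmannian of $k$-dimensional linear subspaces of $\mathbb{R}^n$ with rotation invariant Haar probability measure $\nu_k$. $A(n,k)$ is the set of affine $k$-flats in $\mathbb{R}^n$ with the motion invariant measure $\mu_k=\int_{G(n,k)}\int_{L^\perp}\mathbf{1}\{L+t\in\cdot\}\,\mathcal{H}^{n-k}(\mathrm{d}t)\,\nu_k(\mathrm{d}L)$. Symmetric tensors of rank $p$ over $\mathbb{R}^n$ are identified with symmetric $p$-linear forms on $\mathbb{R}^n$ via the scalar product; $ab$ denotes the symmetric tensor product (symmetrized tensor product), and powers are with respect to this product, so that $x^p(y_1,\dots,y_p)=\prod_i x\cdot y_i$ for $x\in\mathbb{R}^n$; zeroth powers equal $1$. Tensor-valued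 integrals are understood componentwise. The metric tensor is $Q(x,y)=x\cdot y$. For $E\in A(n,k)$ with direction space $L(E)\in G(n,k)$, $Q(E)(x,y)=p_{L(E)}(x)\cdot p_{L(E)}(y)$, where $p_L$ is orthogonal projection onto $L$. For Borel sets $\beta$ define $\phi_n^{r,0,0}(K,\beta)=\int_{K\cap\beta}x^r\,\mathcal{H}^n(\mathrm{d}x)$; for a convex body $K\subset E\in A(n,k)$ define $\phi_{k,E}^{r,0,0}(K,\beta)=\int_{K\cap\beta}x^r\,\mathcal{H}^k(\mathrm{d}x)$, and, by convention, $\phi_{k,E}^{r,s,0}:=0$ if $s\neq 0$. These functionals are $0$ for the empty set. *)

theory Defs
  imports "HOL-Probability.Probability"
begin

text \<open>
  A covering set S contributes \<open>unit_ball_vol m * (diam S / 2)^m\<close>, so that the m-dimensional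
  measure is normalized to agree with Lebesgue measure on m-dimensional Euclidean space. For
  \<open>m = 0\<close> a non-empty set contributes 1 and the empty set 0 (counting measure). The library's
  \<open>diameter\<close> is only meaningful for bounded sets, hence the boundedness condition below.
\<close>

definition hausdorff_content :: "nat \<Rightarrow> 'a::metric_space set \<Rightarrow> ennreal" where
  "hausdorff_content m S =
     (if S = {} then 0 else ennreal (unit_ball_vol (real m) * (diameter S / 2) ^ m))"

definition hausdorff_outer :: "nat \<Rightarrow> 'a::metric_space set \<Rightarrow> ennreal" where
  "hausdorff_outer m A =
     (SUP \<delta>\<in>{0<..}.
        INF S\<in>{S :: nat \<Rightarrow> 'a set. A \<subseteq> (\<Union>i. S i) \<and> (\<forall>i. bounded (S i) \<and> diameter (S i) \<le> \<delta>)}.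
          (\<Sum>i. hausdorff_content m (S i)))"

definition hausdorff_measure :: "nat \<Rightarrow> 'a::metric_space measure" where
  "hausdorff_measure m = measure_of UNIV (sets borel) (hausdorff_outer m)"


definition orth_proj :: "'a::euclidean_space set \<Rightarrow> 'a \<Rightarrow> 'a" where
  "orth_proj L x = (THE y. y \<in> L \<and> x - y \<in> L\<^sup>\<bottom>)"

definition direction :: "'a::euclidean_space set \<Rightarrow> 'a set" where
  "direction E = {x - y | x y. x \<in> E \<and> y \<in> E}"

definition grassmannian :: "nat \<Rightarrow> (real^'n) set set" where
  "grassmannian k = {L. subspace L \<and> dim L = k}"

definition affine_flats :: "nat \<Rightarrow> (real^'n) set set" where
  "affine_flats k = {E. affine E \<and> aff_dim E = int k}"

text \<open>
  The usual topology of the Grassmannian is the one induced by the injection that maps a subspace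
  to the matrix of its orthogonal projection. That of the space of flats is induced by the injection
  mapping E to the projection matrix of its direction space together with the point of E
  closest to the origin. The two measurable spaces below carry the corresponding Borel
  sigma-algebras.
\<close>

definition grassmann_space :: "nat \<Rightarrow> (real^'n) set measure" where
  "grassmann_space k = vimage_algebra (grassmannian k) (\<lambda>L. matrix (orth_proj L)) borel"

definition flat_space :: "nat \<Rightarrow> (real^'n) set measure" where
  "flat_space k =
     vimage_algebra (affine_flats k)
       (\<lambda>E. (matrix (orth_proj (direction E)), closest_point E 0)) borel"

text \<open>
  This property characterizes the Haar probability measure uniquely, since the
  rotation group is compact and acts transitively on the Grassmannian.
\<close>

definition grassmann_haar :: "nat \<Rightarrow> (real^'n) set measure \<Rightarrow> bool" where
  "grassmann_haar k \<nu> \<longleftrightarrow>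
     prob_space \<nu> \<and> space \<nu> = grassmannian k \<and> sets \<nu> = sets (grassmann_space k) \<and>
     (\<forall>R. rotation_matrix R \<longrightarrow>
        (\<forall>A\<in>sets \<nu>. emeasure \<nu> ((\<lambda>L. (*v) R ` L) ` A) = emeasure \<nu> A))"

definition flat_measure :: "nat \<Rightarrow> (real^'n) set measure \<Rightarrow> (real^'n) set measure" where
  "flat_measure k \<nu> =
     measure_of (affine_flats k) (sets (flat_space k))
       (\<lambda>B. \<integral>\<^sup>+L. (\<integral>\<^sup>+t\<in>L\<^sup>\<bottom>. indicator B ((\<lambda>x. x + t) ` L)
                    \<partial>hausdorff_measure (CARD('n) - k)) \<partial>\<nu>)"


text \<open>
  A tensor of rank p is represented by its p-linear form, as a function of a sequence of vectors
  that depends only on the entries with index \<open>0, \<dots>, p - 1\<close>. The ranks of the factors are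
  explicit arguments of the symmetric product.
\<close>

type_synonym 'n tensor = "(nat \<Rightarrow> real^'n) \<Rightarrow> real"

definition symm_prod :: "nat \<Rightarrow> nat \<Rightarrow> 'n tensor \<Rightarrow> 'n tensor \<Rightarrow> 'n tensor" where
  "symm_prod p q a b =
     (\<lambda>y. (\<Sum>\<sigma> | \<sigma> permutes {..<p + q}. a (\<lambda>j. y (\<sigma> j)) * b (\<lambda>j. y (\<sigma> (p + j)))) / fact (p + q))"

text \<open>\<open>symm_pow p a i\<close> is the i-th power of a tensor a of rank p; it has rank \<open>p * i\<close>.\<close>

primrec symm_pow :: "nat \<Rightarrow> 'n tensor \<Rightarrow> nat \<Rightarrow> 'n tensor" where
  "symm_pow p a 0 = (\<lambda>y. 1)"
| "symm_pow p a (Suc i) = symm_prod p (p * i) a (symm_pow p a i)"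

definition vec_tensor :: "real^'n \<Rightarrow> 'n tensor" where
  "vec_tensor x = (\<lambda>y. x \<bullet> y 0)"

definition metric_tensor :: "('n::finite) tensor" where
  "metric_tensor = (\<lambda>y. y 0 \<bullet> y 1)"

definition flat_metric_tensor :: "(real^'n) set \<Rightarrow> 'n tensor" where
  "flat_metric_tensor E =
     (\<lambda>y. orth_proj (direction E) (y 0) \<bullet> orth_proj (direction E) (y 1))"

lemma symm_pow_vec_tensor: "symm_pow 1 (vec_tensor x) p y = (\<Prod>j<p. x \<bullet> y j)"
proof (induction p arbitrary: y)
  case 0
  show ?case by simp
next
  case (Suc p)
  have "(x \<bullet> y (\<sigma> 0)) * (\<Prod>j<p. x \<bullet> y (\<sigma> (Suc j))) = (\<Prod>j<Suc p. x \<bullet> y j)"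
    if "\<sigma> permutes {..<Suc p}" for \<sigma>
  proof -
    have "(x \<bullet> y (\<sigma> 0)) * (\<Prod>j<p. x \<bullet> y (\<sigma> (Suc j))) = (\<Prod>j<Suc p. x \<bullet> y (\<sigma> j))"
      by (simp only: prod.lessThan_Suc_shift)
    also have "\<dots> = (\<Prod>j<Suc p. x \<bullet> y j)"
      using prod.permute[OF that, of "\<lambda>j. x \<bullet> y j"] by (simp only: o_def)
    finally show ?thesis .
  qed
  moreover have "card {\<sigma>. \<sigma> permutes {..<Suc p}} = fact (Suc p)"
    by (rule card_permutations) auto
  ultimately have "(\<Sum>\<sigma> | \<sigma> permutes {..<Suc p}.
      (x \<bullet> y (\<sigma> 0)) * (\<Prod>j<p. x \<bullet> y (\<sigma> (Suc j)))) = fact (Suc p) * (\<Prod>j<Suc p. x \<bullet> y j)"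
    by (simp del: prod.lessThan_Suc fact_Suc)
  then show ?case
    using Suc.IH by (simp add: symm_prod_def vec_tensor_def del: prod.lessThan_Suc fact_Suc)
qed


definition tensor_integrable :: "'b measure \<Rightarrow> ('b \<Rightarrow> 'n tensor) \<Rightarrow> bool" where
  "tensor_integrable M T \<longleftrightarrow> (\<forall>y. integrable M (\<lambda>x. T x y))"

definition tensor_integral :: "'b measure \<Rightarrow> ('b \<Rightarrow> 'n tensor) \<Rightarrow> 'n tensor" where
  "tensor_integral M T = (\<lambda>y. \<integral>x. T x y \<partial>M)"

definition tensor_set_integral :: "'b measure \<Rightarrow> 'b set \<Rightarrow> ('b \<Rightarrow> 'n tensor) \<Rightarrow> 'n tensor" where
  "tensor_set_integral M A T = (\<lambda>y. LINT x:A|M. T x y)"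

definition phi_full :: "nat \<Rightarrow> (real^'n) set \<Rightarrow> (real^'n) set \<Rightarrow> 'n tensor" where
  "phi_full r K \<beta> =
     tensor_set_integral (hausdorff_measure CARD('n)) (K \<inter> \<beta>)
       (\<lambda>x. symm_pow 1 (vec_tensor x) r)"

text \<open>
  The functional for a convex body K contained in a k-flat E; it is a tensor of rank \<open>r + s\<close>. The
  flat enters only through its dimension and the condition that K is contained in E.
\<close>

definition phi_flat ::
  "nat \<Rightarrow> (real^'n) set \<Rightarrow> nat \<Rightarrow> nat \<Rightarrow> (real^'n) set \<Rightarrow> (real^'n) set \<Rightarrow> 'n tensor" where
  "phi_flat k E r s K \<beta> =
     (if s = 0
      then tensor_set_integral (hausdorff_measure k) (K \<inter> \<beta>) (\<lambda>x. symm_pow 1 (vec_tensor x) r)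
      else (\<lambda>y. 0))"

definition crofton_coeff :: "nat \<Rightarrow> nat \<Rightarrow> nat \<Rightarrow> real" where
  "crofton_coeff n k i =
     (if k = 0 then (if i = 0 then 1 else 0)
      else Gamma (real n / 2) * Gamma (real k / 2 + real i) /
           (Gamma (real n / 2 + real i) * Gamma (real k / 2)))"

end

theory Submission
  imports Defs
begin

text \<open>
  A flat has the form \<open>E = L + t\<close> with a linear subspace L and t orthogonal to L. Let g be the monomial
  \<open>x \<mapsto> (x \<bullet> y 0) * (x \<bullet> y 1) * \<dots>\<close> restricted to \<open>K \<inter> \<beta>\<close>, so that the integral of g over E is an entry
  of the moment tensor of \<open>K \<inter> \<beta> \<inter> E\<close>. For fixed L, integrating over t as well gives the integral of g over
  the whole space, by Fubini's theorem, and this does not depend on L (\<open>crofton_function\<close>). Hence the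
  integral over the flats factorizes into the moment tensor of \<open>K \<inter> \<beta>\<close> and the mean of \<open>Q(L)\<^sup>i\<close> over the
  Grassmannian.

  That mean is a symmetric tensor, hence determined by its values on the diagonal
  (\<open>symmetric_form_eq_0\<close>). These are the moments of the length of the projection of a fixed vector v
  to a random subspace. By rotation invariance they are a multiple of a power of the norm of v, and
  the factor is found by integrating over v with a Gaussian weight, which splits into independent
  parts along L and its complement (\<open>projection_moment\<close>).

  The use of Fubini's theorem rests on two facts. First, the m-dimensional Hausdorff measure, which
  is defined by coverings, is Lebesgue measure on each m-dimensional subspace
  (\<open>hausdorff_measure_on_span\<close>). For any other factor, depending on the dimension, the product of
  the measures on L and its complement need not be the measure on the whole space. Coverings cannot be
  too cheap because of the isodiametric inequality, which is derived from the Prekopa-Leindler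
  inequality; that they are cheap enough follows from the scaling behaviour of the cube. Second, the
  integrals over L and its complement must depend measurably on L. To see this, they are written as
  integrals over tubes in the ambient space (\<open>hausdorff_measure_orthogonal_comp\<close>), so that the
  measure on the flats becomes an image of a measure on pairs of a subspace and a point
  (\<open>flat_measure_eq_flat_image\<close>).
\<close>

section \<open>Hausdorff measures on Borel sets\<close>

definition delta_cover :: "real \<Rightarrow> 'a::metric_space set \<Rightarrow> (nat \<Rightarrow> 'a set) \<Rightarrow> bool" where
  "delta_cover \<delta> A S \<longleftrightarrow> A \<subseteq> (\<Union>i. S i) \<and> (\<forall>i. bounded (S i) \<and> diameter (S i) \<le> \<delta>)"

text \<open>
  The supremum over \<open>\<delta>\<close> is split off from the outer measure, because the values for a single bound
  \<open>\<delta>\<close> on the diameters are needed below for the unit cube.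
\<close>

definition hausdorff_pre :: "nat \<Rightarrow> real \<Rightarrow> 'a::metric_space set \<Rightarrow> ennreal" where
  "hausdorff_pre m \<delta> A = (INF S\<in>Collect (delta_cover \<delta> A). \<Sum>i. hausdorff_content m (S i))"

lemma delta_coverD:
  assumes "delta_cover \<delta> A S"
  shows "A \<subseteq> (\<Union>i. S i)" "bounded (S i)" "diameter (S i) \<le> \<delta>"
  using assms by (simp_all add: delta_cover_def)

lemma hausdorff_outer_eq_SUP: "hausdorff_outer m A = (SUP \<delta>\<in>{0<..}. hausdorff_pre m \<delta> A)"
  unfolding hausdorff_outer_def hausdorff_pre_def delta_cover_def by simp

lemma hausdorff_content_empty [simp]: "hausdorff_content m {} = 0"
  by (simp add: hausdorff_content_def)

lemma hausdorff_pre_le: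
  "delta_cover \<delta> A S \<Longrightarrow> hausdorff_pre m \<delta> A \<le> (\<Sum>i. hausdorff_content m (S i))"
  unfolding hausdorff_pre_def by (rule INF_lower) simp

lemma hausdorff_pre_greatest:
  "(\<And>S. delta_cover \<delta> A S \<Longrightarrow> c \<le> (\<Sum>i. hausdorff_content m (S i))) \<Longrightarrow> c \<le> hausdorff_pre m \<delta> A"
  unfolding hausdorff_pre_def by (rule INF_greatest) simp

lemma hausdorff_pre_le_content:
  assumes "bounded A" "diameter A \<le> \<delta>" "0 \<le> \<delta>"
  shows "hausdorff_pre m \<delta> A \<le> hausdorff_content m A"
proof -
  let ?S = "\<lambda>i::nat. if i = 0 then A else {}"
  have "delta_cover \<delta> A ?S"
    using assms by (auto simp: delta_cover_def intro: exI[of _ "0::nat"])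
  then have "hausdorff_pre m \<delta> A \<le> (\<Sum>i. hausdorff_content m (?S i))"
    by (rule hausdorff_pre_le)
  also have "\<dots> = (\<Sum>i\<in>{0}. hausdorff_content m (?S i))"
    by (rule suminf_finite) auto
  finally show ?thesis by simp
qed

lemma hausdorff_pre_mono: "A \<subseteq> B \<Longrightarrow> hausdorff_pre m \<delta> A \<le> hausdorff_pre m \<delta> B"
  by (rule hausdorff_pre_greatest, rule hausdorff_pre_le) (simp add: delta_cover_def subset_trans)

lemma hausdorff_pre_antimono: "\<delta> \<le> \<epsilon> \<Longrightarrow> hausdorff_pre m \<epsilon> A \<le> hausdorff_pre m \<delta> A"
  by (rule hausdorff_pre_greatest, rule hausdorff_pre_le)
     (simp add: delta_cover_def, meson order_trans)

lemma hausdorff_pre_le_outer: "0 < \<delta> \<Longrightarrow> hausdorff_pre m \<delta> A \<le> hausdorff_outer m A"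
  unfolding hausdorff_outer_eq_SUP by (rule SUP_upper) simp

lemma hausdorff_outer_least:
  "(\<And>\<delta>. 0 < \<delta> \<Longrightarrow> hausdorff_pre m \<delta> A \<le> c) \<Longrightarrow> hausdorff_outer m A \<le> c"
  unfolding hausdorff_outer_eq_SUP by (rule SUP_least) simp

lemma hausdorff_outer_mono: "A \<subseteq> B \<Longrightarrow> hausdorff_outer m A \<le> hausdorff_outer m B"
  unfolding hausdorff_outer_eq_SUP by (rule SUP_mono') (rule hausdorff_pre_mono)

lemma hausdorff_pre_countably_subadditive:
  assumes "0 \<le> \<delta>"
  shows "hausdorff_pre m \<delta> (\<Union>n. A n) \<le> (\<Sum>n::nat. hausdorff_pre m \<delta> (A n))"
proof (rule ennreal_le_epsilon)
  fix e :: real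
  assume fin: "(\<Sum>n. hausdorff_pre m \<delta> (A n)) < top" and e: "0 < e"
  have "\<exists>S. delta_cover \<delta> (A n) S \<and>
      (\<Sum>i. hausdorff_content m (S i)) \<le> hausdorff_pre m \<delta> (A n) + ennreal (e * (1/2) ^ Suc n)" for n
  proof -
    have "hausdorff_pre m \<delta> (A n) < top"
      using fin by (metis ennreal_suminf_lessD)
    moreover have "0 < ennreal (e * (1/2) ^ Suc n)"
      using e by (simp del: power_Suc)
    ultimately have "hausdorff_pre m \<delta> (A n) < hausdorff_pre m \<delta> (A n) + ennreal (e * (1/2) ^ Suc n)"
      using ennreal_add_left_cancel_less[of "hausdorff_pre m \<delta> (A n)" 0] by simp
    then show ?thesis
      by (auto simp: hausdorff_pre_def INF_less_iff intro: less_imp_le)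
  qed
  then obtain S where S: "\<And>n. delta_cover \<delta> (A n) (S n)"
    and le: "\<And>n. (\<Sum>i. hausdorff_content m (S n i))
                 \<le> hausdorff_pre m \<delta> (A n) + ennreal (e * (1/2) ^ Suc n)"
    by metis
  define T where "T j = S (fst (prod_decode j)) (snd (prod_decode j))" for j
  have T: "bounded (T j)" "diameter (T j) \<le> \<delta>" for j
    by (simp_all add: T_def delta_coverD(2,3)[OF S])
  have "(\<Union>n. A n) \<subseteq> (\<Union>j. T j)"
  proof
    fix x assume "x \<in> (\<Union>n. A n)"
    then obtain n where "x \<in> A n" by blast
    then obtain i where "x \<in> S n i"
      using delta_coverD(1)[OF S[of n]] by blast
    then have "x \<in> T (prod_encode (n, i))" by (simp add: T_def)
    then show "x \<in> (\<Union>j. T j)" by blast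
  qed
  then have "delta_cover \<delta> (\<Union>n. A n) T"
    unfolding delta_cover_def by (intro conjI allI T)
  then have "hausdorff_pre m \<delta> (\<Union>n. A n) \<le> (\<Sum>j. hausdorff_content m (T j))"
    by (rule hausdorff_pre_le)
  also have "\<dots> = (\<Sum>j. (\<lambda>(n, i). hausdorff_content m (S n i)) (prod_decode j))"
    by (simp add: T_def split_beta)
  also have "\<dots> = (\<Sum>n. \<Sum>i. hausdorff_content m (S n i))"
    by (rule suminf_ennreal_2dimen) simp
  also have "\<dots> \<le> (\<Sum>n. hausdorff_pre m \<delta> (A n) + ennreal (e * (1/2) ^ Suc n))"
    by (intro suminf_le allI le) auto
  also have "\<dots> = (\<Sum>n. hausdorff_pre m \<delta> (A n)) + (\<Sum>n. ennreal (e * (1/2) ^ Suc n))"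
    by (rule suminf_add[symmetric]) auto
  also have "(\<Sum>n. ennreal (e * (1/2) ^ Suc n)) = ennreal (e * 1)"
    using e by (intro suminf_ennreal_eq sums_mult power_half_series) auto
  finally show "hausdorff_pre m \<delta> (\<Union>n. A n) \<le> (\<Sum>n. hausdorff_pre m \<delta> (A n)) + ennreal e"
    by simp
qed

lemma hausdorff_pre_empty [simp]: "0 \<le> \<delta> \<Longrightarrow> hausdorff_pre m \<delta> {} = 0"
  using hausdorff_pre_le_content[of "{}" \<delta> m] by simp

lemma hausdorff_pre_UN_le:
  assumes "0 \<le> \<delta>" "finite I"
  shows "hausdorff_pre m \<delta> (\<Union>i\<in>I. A i) \<le> (\<Sum>i\<in>I. hausdorff_pre m \<delta> (A i))"
  using assms(2)
proof induction
  case empty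
  then show ?case using assms by simp
next
  case (insert j I)
  let ?B = "\<lambda>n::nat. if n = 0 then A j else if n = 1 then (\<Union>i\<in>I. A i) else {}"
  have "(\<Union>i\<in>insert j I. A i) \<subseteq> (\<Union>n. ?B n)"
  proof
    fix x assume "x \<in> (\<Union>i\<in>insert j I. A i)"
    then have "x \<in> ?B 0 \<or> x \<in> ?B 1" by auto
    then show "x \<in> (\<Union>n. ?B n)" by blast
  qed
  then have "hausdorff_pre m \<delta> (\<Union>i\<in>insert j I. A i) \<le> hausdorff_pre m \<delta> (\<Union>n. ?B n)"
    by (rule hausdorff_pre_mono)
  also have "\<dots> \<le> (\<Sum>n. hausdorff_pre m \<delta> (?B n))"
    by (rule hausdorff_pre_countably_subadditive) fact
  also have "\<dots> = (\<Sum>n\<in>{0,1}. hausdorff_pre m \<delta> (?B n))"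
    using assms(1) by (intro suminf_finite) auto
  also have "\<dots> = hausdorff_pre m \<delta> (A j) + hausdorff_pre m \<delta> (\<Union>i\<in>I. A i)"
    by simp
  also have "\<dots> \<le> (\<Sum>i\<in>insert j I. hausdorff_pre m \<delta> (A i))"
    using insert by (simp add: add_left_mono)
  finally show ?case .
qed

lemma hausdorff_outer_countably_subadditive:
  "hausdorff_outer m (\<Union>n. A n) \<le> (\<Sum>n::nat. hausdorff_outer m (A n))"
proof (rule hausdorff_outer_least)
  fix \<delta> :: real assume \<delta>: "0 < \<delta>"
  then have "hausdorff_pre m \<delta> (\<Union>n. A n) \<le> (\<Sum>n. hausdorff_pre m \<delta> (A n))"
    by (intro hausdorff_pre_countably_subadditive) simp
  also have "\<dots> \<le> (\<Sum>n. hausdorff_outer m (A n))"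
    using \<delta> by (intro suminf_le hausdorff_pre_le_outer) auto
  finally show "hausdorff_pre m \<delta> (\<Union>n. A n) \<le> \<dots>" .
qed

lemma hausdorff_outer_empty [simp]: "hausdorff_outer m {} = 0"
proof -
  have "hausdorff_outer m ({} :: 'a set) \<le> 0"
    by (rule hausdorff_outer_least) simp
  then show ?thesis by simp
qed

lemma hausdorff_outer_Un_le: "hausdorff_outer m (A \<union> B) \<le> hausdorff_outer m A + hausdorff_outer m B"
proof (rule hausdorff_outer_least)
  fix \<delta> :: real assume \<delta>: "0 < \<delta>"
  have "hausdorff_pre m \<delta> (\<Union>i\<in>{True, False}. if i then A else B)
      \<le> (\<Sum>i\<in>{True, False}. hausdorff_pre m \<delta> (if i then A else B))"
    using \<delta> by (intro hausdorff_pre_UN_le) auto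
  also have "\<dots> \<le> hausdorff_outer m A + hausdorff_outer m B"
    using \<delta> by (simp add: add_mono hausdorff_pre_le_outer)
  finally show "hausdorff_pre m \<delta> (A \<union> B) \<le> hausdorff_outer m A + hausdorff_outer m B"
    by (simp add: Un_commute)
qed

text \<open>
  A covering set whose diameter is smaller than the distance of A and B meets at most one of
  them, so that a fine cover of the union splits into a cover of A and a cover of B.
\<close>

lemma hausdorff_outer_separated:
  assumes d: "0 < d" and sep: "\<And>x y. x \<in> A \<Longrightarrow> y \<in> B \<Longrightarrow> d \<le> dist x y"
  shows "hausdorff_outer m A + hausdorff_outer m B \<le> hausdorff_outer m (A \<union> B)"
proof -
  have *: "hausdorff_pre m \<delta> A + hausdorff_pre m \<delta> B \<le> hausdorff_pre m \<delta> (A \<union> B)"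
    if \<delta>: "0 < \<delta>" "\<delta> < d" for \<delta>
  proof (rule hausdorff_pre_greatest)
    fix S assume S: "delta_cover \<delta> (A \<union> B) S"
    let ?S1 = "\<lambda>i. if S i \<inter> A \<noteq> {} then S i else {}"
    let ?S2 = "\<lambda>i. if S i \<inter> A = {} then S i else {}"
    have disj: "S i \<inter> B = {}" if ne: "S i \<inter> A \<noteq> {}" for i
    proof (rule ccontr)
      assume "S i \<inter> B \<noteq> {}"
      then obtain x y where xy: "x \<in> S i" "x \<in> A" "y \<in> S i" "y \<in> B" using ne by blast
      have "dist x y \<le> diameter (S i)"
        using S xy by (intro diameter_bounded_bound) (auto simp: delta_cover_def)
      also have "\<dots> \<le> \<delta>" using S by (simp add: delta_cover_def)
      finally show False using sep[OF xy(2,4)] \<delta> by simp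
    qed
    have "delta_cover \<delta> A ?S1" "delta_cover \<delta> B ?S2"
    proof -
      have 1: "A \<subseteq> (\<Union>i. ?S1 i)"
      proof
        fix x assume x: "x \<in> A"
        then obtain i where "x \<in> S i" using S by (auto simp: delta_cover_def)
        then have "x \<in> ?S1 i" using x by auto
        then show "x \<in> (\<Union>i. ?S1 i)" by blast
      qed
      have 2: "B \<subseteq> (\<Union>i. ?S2 i)"
      proof
        fix x assume x: "x \<in> B"
        then obtain i where "x \<in> S i" using S by (auto simp: delta_cover_def)
        then have "x \<in> ?S2 i" using x disj[of i] by auto
        then show "x \<in> (\<Union>i. ?S2 i)" by blast
      qed
      have "bounded (S i)" "diameter (S i) \<le> \<delta>" for i
        using S by (auto simp: delta_cover_def)
      then show "delta_cover \<delta> A ?S1" "delta_cover \<delta> B ?S2"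
        using 1 2 \<delta> by (simp_all add: delta_cover_def)
    qed
    then have "hausdorff_pre m \<delta> A + hausdorff_pre m \<delta> B
        \<le> (\<Sum>i. hausdorff_content m (?S1 i)) + (\<Sum>i. hausdorff_content m (?S2 i))"
      by (intro add_mono hausdorff_pre_le)
    also have "\<dots> = (\<Sum>i. hausdorff_content m (?S1 i) + hausdorff_content m (?S2 i))"
      by (rule suminf_add) auto
    also have "\<dots> = (\<Sum>i. hausdorff_content m (S i))"
      by (intro suminf_cong) simp
    finally show "hausdorff_pre m \<delta> A + hausdorff_pre m \<delta> B \<le> \<dots>" .
  qed
  have "hausdorff_pre m \<delta> A + hausdorff_pre m \<epsilon> B \<le> hausdorff_outer m (A \<union> B)"
    if "0 < \<delta>" "0 < \<epsilon>" for \<delta> \<epsilon>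
  proof -
    define \<eta> where "\<eta> = min (min \<delta> \<epsilon>) (d / 2)"
    have \<eta>: "0 < \<eta>" "\<eta> < d" "\<eta> \<le> \<delta>" "\<eta> \<le> \<epsilon>"
      using that d by (auto simp: \<eta>_def min_def)
    have "hausdorff_pre m \<delta> A + hausdorff_pre m \<epsilon> B \<le> hausdorff_pre m \<eta> A + hausdorff_pre m \<eta> B"
      using \<eta> by (intro add_mono hausdorff_pre_antimono)
    also have "\<dots> \<le> hausdorff_outer m (A \<union> B)"
      using *[OF \<eta>(1,2)] hausdorff_pre_le_outer[OF \<eta>(1)] by (rule order_trans)
    finally show ?thesis .
  qed
  then have "hausdorff_pre m \<delta> A + hausdorff_outer m B \<le> hausdorff_outer m (A \<union> B)"
    if "0 < \<delta>" for \<delta>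
    unfolding hausdorff_outer_eq_SUP[of m B]
    using that by (subst ennreal_SUP_add_right) (auto intro!: SUP_least)
  then show ?thesis
    unfolding hausdorff_outer_eq_SUP[of m A]
    by (subst ennreal_SUP_add_left[symmetric]) (auto intro!: SUP_least)
qed

text \<open>
  Caratheodory's criterion. The difficulty is to recover the measure of \<open>A - F\<close> from the parts
  of A at a positive distance from F: those exhaust \<open>A - F\<close>, and the layers between them have
  summable measures, because every second layer is separated from the earlier ones.
\<close>

lemma hausdorff_outer_closed_split:
  assumes F: "closed F"
  shows "hausdorff_outer m (A \<inter> F) + hausdorff_outer m (A - F) \<le> hausdorff_outer m A"
proof (cases "F = {} \<or> hausdorff_outer m A = top")
  case True
  then show ?thesis by auto
next
  case False
  then have ne: "F \<noteq> {}" and fin: "hausdorff_outer m A < top"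
    by (auto simp: less_top)
  let ?H = "hausdorff_outer m"
  define C where "C n = {x \<in> A. 1 / real (Suc n) \<le> infdist x F}" for n
  define E where "E n = C (Suc n) - C n" for n
  have inE: "1 / real (n + 2) \<le> infdist x F" "infdist x F < 1 / real (n + 1)" "x \<in> A"
    if "x \<in> E n" for x n
    using that by (auto simp: E_def C_def)
  have every_second: "(\<Sum>k<N. ?H (E (2 * k + p))) \<le> ?H (\<Union>k<N. E (2 * k + p))" for N p
  proof (induction N)
    case (Suc N)
    have "(\<Sum>k<Suc N. ?H (E (2 * k + p))) \<le> ?H (\<Union>k<N. E (2 * k + p)) + ?H (E (2 * N + p))"
      using Suc by (simp add: add_right_mono)
    also have "\<dots> \<le> ?H ((\<Union>k<N. E (2 * k + p)) \<union> E (2 * N + p))"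
    proof (rule hausdorff_outer_separated)
      \<comment> \<open>The layer in between separates the new layer from all earlier ones; for \<open>N = 0\<close> there are
        none, and any positive number serves as the distance.\<close>
      show "0 < (if N = 0 then 1 else 1 / real (2 * N + p) - 1 / real (2 * N + p + 1))"
        by (auto simp: divide_strict_left_mono)
    next
      fix x y assume x: "x \<in> (\<Union>k<N. E (2 * k + p))" and y: "y \<in> E (2 * N + p)"
      then obtain k where k: "k < N" "x \<in> E (2 * k + p)" by auto
      have "1 / real (2 * N + p) \<le> 1 / real (2 * k + p + 2)"
        using k by (intro divide_left_mono) auto
      also have "\<dots> \<le> infdist x F" using inE(1)[OF k(2)] .
      also have "\<dots> \<le> infdist y F + dist x y" by (rule infdist_triangle)
      also have "infdist y F \<le> 1 / real (2 * N + p + 1)"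
        using inE(2)[OF y] by simp
      finally show "(if N = 0 then 1 else 1 / real (2 * N + p) - 1 / real (2 * N + p + 1)) \<le> dist x y"
        using k by simp
    qed
    also have "(\<Union>k<N. E (2 * k + p)) \<union> E (2 * N + p) = (\<Union>k<Suc N. E (2 * k + p))"
      by (auto simp: lessThan_Suc)
    finally show ?case .
  qed simp
  have half: "(\<Sum>k<N. ?H (E (2 * k + p))) \<le> ?H A" for N p
    using every_second by (rule order_trans) (auto intro!: hausdorff_outer_mono dest: inE(3))
  have "(\<Sum>j<2 * N. ?H (E j)) = (\<Sum>k<N. ?H (E (2 * k + 0))) + (\<Sum>k<N. ?H (E (2 * k + 1)))" for N
    by (induction N) (auto simp: algebra_simps)
  then have "(\<Sum>j<2 * N. ?H (E j)) \<le> ?H A + ?H A" for N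
    using half[of 0 N] half[of 1 N] by (metis add_mono)
  then have "(\<Sum>j<N. ?H (E j)) \<le> ?H A + ?H A" for N
    by (rule order_trans[rotated, of "\<Sum>j<2 * N. ?H (E j)"]) (auto intro!: sum_mono2)
  then have "(\<Sum>j. ?H (E j)) \<le> ?H A + ?H A"
    by (intro suminf_le_const) auto
  then have T: "(\<Sum>j. ?H (E j)) < top"
    using fin by (auto simp: less_top[symmetric] top_unique)
  have cover: "A - F \<subseteq> C n \<union> (\<Union>j. E (j + n))" for n
  proof
    fix x assume x: "x \<in> A - F"
    then have "0 < infdist x F"
      using F ne in_closed_iff_infdist_zero[of F x] infdist_nonneg[of x F] by (auto simp: less_le)
    then obtain q where q: "1 / real (Suc q) < infdist x F"
      using nat_approx_posE by blast
    show "x \<in> C n \<union> (\<Union>j. E (j + n))"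
    proof (cases "x \<in> C n")
      case False
      have "x \<in> C (n + (q + 1))"
      proof -
        have "1 / real (Suc (n + (q + 1))) \<le> 1 / real (Suc q)"
          by (intro divide_left_mono) auto
        then show ?thesis using q x by (simp add: C_def)
      qed
      then obtain l where l: "x \<in> C (n + l)" "\<And>l'. l' < l \<Longrightarrow> x \<notin> C (n + l')"
        using exists_least_iff[of "\<lambda>l. x \<in> C (n + l)"] by blast
      then have "l \<noteq> 0" using False by (cases l) auto
      then have "x \<in> E ((l - 1) + n)"
        using l(1) l(2)[of "l - 1"] by (cases l) (auto simp: E_def add.commute)
      then show ?thesis by blast
    qed simp
  qed
  \<comment> \<open>The initial part of the sum of the layers is added on both sides, so that the remainder of the
    sum completes it; in the limit the whole sum, which is finite, cancels.\<close>
  have "?H (A \<inter> F) + ?H (A - F) + (\<Sum>j<n. ?H (E j)) \<le> ?H A + (\<Sum>j. ?H (E j))" for n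
  proof -
    have "?H (A - F) \<le> ?H (C n \<union> (\<Union>j. E (j + n)))"
      using cover by (rule hausdorff_outer_mono)
    also have "\<dots> \<le> ?H (C n) + ?H (\<Union>j. E (j + n))" by (rule hausdorff_outer_Un_le)
    also have "\<dots> \<le> ?H (C n) + (\<Sum>j. ?H (E (j + n)))"
      by (intro add_left_mono hausdorff_outer_countably_subadditive)
    finally have 1: "?H (A - F) \<le> ?H (C n) + (\<Sum>j. ?H (E (j + n)))" .
    have "?H (A \<inter> F) + ?H (C n) \<le> ?H ((A \<inter> F) \<union> C n)"
    proof (rule hausdorff_outer_separated)
      show "0 < 1 / real (Suc n)" by simp
      fix x y assume "x \<in> A \<inter> F" "y \<in> C n"
      then show "1 / real (Suc n) \<le> dist x y"
        using infdist_le[of x F y] by (auto simp: C_def dist_commute)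
    qed
    also have "\<dots> \<le> ?H A" by (rule hausdorff_outer_mono) (auto simp: C_def)
    finally have 2: "?H (A \<inter> F) + ?H (C n) \<le> ?H A" .
    have "?H (A \<inter> F) + ?H (A - F) + (\<Sum>j<n. ?H (E j))
        \<le> ?H (A \<inter> F) + (?H (C n) + (\<Sum>j. ?H (E (j + n)))) + (\<Sum>j<n. ?H (E j))"
      by (intro add_left_mono add_right_mono 1)
    also have "\<dots> = (?H (A \<inter> F) + ?H (C n)) + ((\<Sum>j. ?H (E (j + n))) + (\<Sum>j<n. ?H (E j)))"
      by (simp add: algebra_simps)
    also have "(\<Sum>j. ?H (E (j + n))) + (\<Sum>j<n. ?H (E j)) = (\<Sum>j. ?H (E j))"
      by (rule suminf_offset[symmetric]) auto
    finally show ?thesis using 2 by (meson add_right_mono order_trans)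
  qed
  moreover have "(\<lambda>n. ?H (A \<inter> F) + ?H (A - F) + (\<Sum>j<n. ?H (E j)))
      \<longlonglongrightarrow> ?H (A \<inter> F) + ?H (A - F) + (\<Sum>j. ?H (E j))"
    by (intro tendsto_intros summable_LIMSEQ) auto
  ultimately have "?H (A \<inter> F) + ?H (A - F) + (\<Sum>j. ?H (E j)) \<le> ?H A + (\<Sum>j. ?H (E j))"
    by (intro LIMSEQ_le_const2) auto
  then show ?thesis using T by (auto simp: ennreal_add_left_cancel_le add.commute)
qed

lemma hausdorff_measure_space: "measure_space UNIV (sets borel) (hausdorff_outer m)"
proof -
  interpret sigma_algebra UNIV "UNIV :: 'a set set" by (rule sigma_algebra_Pow[of UNIV, simplified])
  have "outer_measure_space UNIV (hausdorff_outer m :: 'a set \<Rightarrow> _)"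
    unfolding outer_measure_space_def
    by (auto simp: positive_def increasing_def countably_subadditive_def hausdorff_outer_mono
             intro: hausdorff_outer_countably_subadditive)
  then have ms: "measure_space UNIV (lambda_system UNIV UNIV (hausdorff_outer m :: 'a set \<Rightarrow> _))
      (hausdorff_outer m)"
    by (rule caratheodory_lemma)
  have "F \<in> lambda_system UNIV UNIV (hausdorff_outer m)" if "closed F" for F :: "'a set"
  proof -
    have "hausdorff_outer m A \<le> hausdorff_outer m (A \<inter> F) + hausdorff_outer m (A - F)" for A
      using hausdorff_outer_Un_le[of m "A \<inter> F" "A - F"] by (simp add: Int_Diff_Un)
    then show ?thesis
      using hausdorff_outer_closed_split[OF that]
      unfolding lambda_system_eq by (auto intro: antisym)
  qed
  then have "sigma_sets UNIV (Collect closed) \<subseteq> lambda_system UNIV UNIV (hausdorff_outer m :: 'a set \<Rightarrow> _)"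
    using ms by (intro sigma_algebra.sigma_sets_subset) (auto simp: measure_space_def)
  then have "sets (borel :: 'a measure) \<subseteq> lambda_system UNIV UNIV (hausdorff_outer m)"
    by (simp add: borel_eq_closed)
  then show ?thesis
    using ms sets.sigma_algebra_axioms[of "borel :: 'a measure"] measure_down by fastforce
qed

lemma sets_hausdorff_measure [simp, measurable_cong]: "sets (hausdorff_measure m) = sets borel"
  unfolding hausdorff_measure_def using sets.sigma_sets_eq[of borel] by simp

lemma space_hausdorff_measure [simp]: "space (hausdorff_measure m) = UNIV"
  by (simp add: hausdorff_measure_def)

lemma emeasure_hausdorff_measure:
  "A \<in> sets borel \<Longrightarrow> emeasure (hausdorff_measure m) A = hausdorff_outer m A"
  using hausdorff_measure_space[of m]
  by (intro emeasure_measure_of[OF hausdorff_measure_def]) (auto simp: measure_space_def)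

section \<open>The Prekopa-Leindler and isodiametric inequalities\<close>

lemma emeasure_lborel_affine_image:
  fixes A :: "real set"
  assumes "A \<in> sets borel" "c \<noteq> 0"
  shows "(\<lambda>x. c * x + t) ` A \<in> sets borel"
    and "emeasure lborel ((\<lambda>x. c * x + t) ` A) = ennreal \<bar>c\<bar> * emeasure lborel A"
proof -
  have eq: "(\<lambda>x. c * x + t) ` A = (\<lambda>y. (y - t) / c) -` A \<inter> space borel"
    using assms(2) by (auto simp: image_iff field_simps intro!: bexI[of _ "(_ - t) / c"])
  show meas: "(\<lambda>x. c * x + t) ` A \<in> sets borel"
    unfolding eq using assms(1) by measurable
  show "emeasure lborel ((\<lambda>x. c * x + t) ` A) = ennreal \<bar>c\<bar> * emeasure lborel A"
    using emeasure_lebesgue_affine[of c t A] assms meas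
    by (simp add: emeasure_completion main_part_sets add.commute mult.commute)
qed

text \<open>
  Translates of A by (nearly) the least point of B and of B by (nearly) the greatest point of A
  lie side by side inside \<open>A + B\<close>, up to a small overlap; and C contains \<open>A + B\<close> scaled by one half.
\<close>

lemma brunn_minkowski_real_bounded:
  fixes A B C :: "real set"
  assumes meas [measurable]: "A \<in> sets borel" "B \<in> sets borel" "C \<in> sets borel"
    and ne: "A \<noteq> {}" "B \<noteq> {}" and bdd: "bounded A" "bounded B"
    and mid: "\<And>x y. x \<in> A \<Longrightarrow> y \<in> B \<Longrightarrow> (x + y) / 2 \<in> C"
  shows "emeasure lborel A + emeasure lborel B \<le> 2 * emeasure lborel C"
proof (rule ennreal_le_epsilon)
  fix e :: real assume e: "0 < e"
  have bA: "bdd_above A" and bB: "bdd_below B"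
    using bdd bounded_imp_bdd_above bounded_imp_bdd_below by auto
  obtain a where a: "a \<in> A" "Sup A - e / 2 < a"
    using less_cSup_iff[OF ne(1) bA, of "Sup A - e / 2"] e by auto
  obtain b where b: "b \<in> B" "b < Inf B + e / 2"
    using cInf_less_iff[OF ne(2) bB, of "Inf B + e / 2"] e by auto
  let ?X = "(\<lambda>x. 1/2 * x + b/2) ` A" and ?Y = "(\<lambda>y. 1/2 * y + a/2) ` B"
  have X: "?X \<in> sets borel" "emeasure lborel ?X = ennreal (1/2) * emeasure lborel A"
    using emeasure_lborel_affine_image[OF meas(1), of "1/2" "b/2"] by auto
  have Y: "?Y \<in> sets borel" "emeasure lborel ?Y = ennreal (1/2) * emeasure lborel B"
    using emeasure_lborel_affine_image[OF meas(2), of "1/2" "a/2"] by auto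
  have sub: "?X \<union> ?Y \<subseteq> C"
  proof safe
    fix x assume "x \<in> A" then show "1/2 * x + b/2 \<in> C"
      using mid[OF _ b(1)] by (simp add: add_divide_distrib)
  next
    fix y assume "y \<in> B" then show "1/2 * y + a/2 \<in> C"
      using mid[OF a(1), of y] by (simp add: add_divide_distrib add.commute)
  qed
  have int: "?X \<inter> ?Y \<subseteq> {(a + b) / 2 - e / 4 .. (a + b) / 2 + e / 4}"
  proof
    fix z assume "z \<in> ?X \<inter> ?Y"
    then obtain x y where xy: "x \<in> A" "y \<in> B" "z = 1/2 * x + b/2" "z = 1/2 * y + a/2" by auto
    have "x \<le> a + e / 2" "b - e / 2 \<le> y"
      using cSup_upper[OF xy(1) bA] cInf_lower[OF xy(2) bB] a b by auto
    then show "z \<in> {(a + b) / 2 - e / 4 .. (a + b) / 2 + e / 4}"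
      using xy(3,4) by (auto simp: field_simps)
  qed
  have "emeasure lborel ?X + emeasure lborel ?Y
      = emeasure lborel (?X \<union> ?Y) + emeasure lborel (?X \<inter> ?Y)"
    using X(1) Y(1) by (intro emeasure_Un_Int) auto
  also have "\<dots> \<le> emeasure lborel C + emeasure lborel {(a + b) / 2 - e / 4 .. (a + b) / 2 + e / 4}"
    using sub int by (intro add_mono emeasure_mono) auto
  also have "\<dots> = emeasure lborel C + ennreal (e / 2)"
    using e by simp
  finally have "2 * (emeasure lborel ?X + emeasure lborel ?Y) \<le> 2 * (emeasure lborel C + ennreal (e / 2))"
    by (rule mult_left_mono) simp
  moreover have "2 * (ennreal (1/2) * z) = z" for z
    using ennreal_mult'[of 2 "1/2"] by (simp add: mult.assoc[symmetric])
  moreover have "2 * ennreal (e / 2) = ennreal e"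
    using ennreal_mult'[of 2 "e/2"] by simp
  ultimately show "emeasure lborel A + emeasure lborel B \<le> 2 * emeasure lborel C + ennreal e"
    by (simp only: X Y distrib_left)
qed

lemma brunn_minkowski_real:
  fixes A B C :: "real set"
  assumes meas [measurable]: "A \<in> sets borel" "B \<in> sets borel" "C \<in> sets borel"
    and ne: "A \<noteq> {}" "B \<noteq> {}"
    and mid: "\<And>x y. x \<in> A \<Longrightarrow> y \<in> B \<Longrightarrow> (x + y) / 2 \<in> C"
  shows "emeasure lborel A + emeasure lborel B \<le> 2 * emeasure lborel C"
proof -
  obtain a b where ab: "a \<in> A" "b \<in> B" using ne by blast
  \<comment> \<open>Every window contains a and b, so that neither of the truncated sets is empty.\<close>
  define S where "S n = {- (\<bar>a\<bar> + \<bar>b\<bar> + real n) .. \<bar>a\<bar> + \<bar>b\<bar> + real n}" for n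
  have S: "(\<Union>n. S n) = UNIV"
  proof (intro set_eqI iffI UNIV_I)
    fix x :: real
    obtain n where "\<bar>x\<bar> \<le> real n" using real_arch_simple by blast
    then show "x \<in> (\<Union>n. S n)" by (intro UN_I[of n]) (auto simp: S_def)
  qed
  have inc: "incseq S" by (auto simp: incseq_def S_def)
  have lim: "(\<lambda>n. emeasure lborel (D \<inter> S n)) \<longlonglongrightarrow> emeasure lborel D"
    if [measurable]: "D \<in> sets borel" for D
  proof -
    have "(\<lambda>n. emeasure lborel (D \<inter> S n)) \<longlonglongrightarrow> emeasure lborel (\<Union>n. D \<inter> S n)"
      using inc by (intro Lim_emeasure_incseq) (auto simp: S_def incseq_def)
    also have "(\<Union>n. D \<inter> S n) = D" using S by auto
    finally show ?thesis .
  qed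
  have "emeasure lborel (A \<inter> S n) + emeasure lborel (B \<inter> S n) \<le> 2 * emeasure lborel C" for n
  proof (rule brunn_minkowski_real_bounded)
    show "A \<inter> S n \<in> sets borel" "B \<inter> S n \<in> sets borel" by (auto simp: S_def)
    have "a \<in> S n" "b \<in> S n" by (auto simp: S_def)
    then show "A \<inter> S n \<noteq> {}" "B \<inter> S n \<noteq> {}" using ab by blast+
    show "bounded (A \<inter> S n)" "bounded (B \<inter> S n)" by (auto simp: S_def)
  qed (use mid in auto)
  then show ?thesis
    by (intro LIMSEQ_le_const2[OF tendsto_add[OF lim lim]]) auto
qed

lemma emeasure_below_ennreal:
  "emeasure lborel {s. 0 < s \<and> s < 1 \<and> ennreal s < r} = min 1 r"
proof (cases r)
  case (real q)
  have "{s. 0 < s \<and> s < 1 \<and> ennreal s < r} = {0 <..< min 1 q}"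
    using real by (auto simp: ennreal_less_iff)
  then show ?thesis
    using real by (auto simp: min_def ennreal_le_iff2 simp flip: ennreal_1)
next
  case top
  have "{s. 0 < s \<and> s < 1 \<and> ennreal s < r} = {0 <..< 1 :: real}"
    using top by auto
  then show ?thesis using top by simp
qed

text \<open>
  The layer cake formula, for the levels between 0 and 1 only.
\<close>

lemma nn_integral_layers:
  fixes w :: "real \<Rightarrow> ennreal"
  assumes [measurable]: "w \<in> borel_measurable borel"
  shows "(\<integral>\<^sup>+s\<in>{0<..<1}. emeasure lborel {x. ennreal s < w x} \<partial>lborel) = (\<integral>\<^sup>+x. min 1 (w x) \<partial>lborel)"
proof -
  have "(\<integral>\<^sup>+x. min 1 (w x) \<partial>lborel) = (\<integral>\<^sup>+x. emeasure lborel {s. 0 < s \<and> s < 1 \<and> ennreal s < w x} \<partial>lborel)"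
    by (simp add: emeasure_below_ennreal)
  also have "\<dots> = (\<integral>\<^sup>+x. \<integral>\<^sup>+s. indicator {s. 0 < s \<and> s < 1 \<and> ennreal s < w x} s \<partial>lborel \<partial>lborel)"
    by (intro nn_integral_cong) simp
  also have "\<dots> = (\<integral>\<^sup>+x. \<integral>\<^sup>+s. indicator {p. 0 < snd p \<and> snd p < 1 \<and> ennreal (snd p) < w (fst p)} (x, s) \<partial>lborel \<partial>lborel)"
    by (simp add: indicator_def)
  also have "\<dots> = (\<integral>\<^sup>+s. \<integral>\<^sup>+x. indicator {p. 0 < snd p \<and> snd p < 1 \<and> ennreal (snd p) < w (fst p)} (x, s) \<partial>lborel \<partial>lborel)"
    by (rule lborel_pair.Fubini') measurable
  also have "\<dots> = (\<integral>\<^sup>+s. \<integral>\<^sup>+x. indicator {x. ennreal s < w x} x * indicator {0<..<1} s \<partial>lborel \<partial>lborel)"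
    by (intro nn_integral_cong) (auto simp: indicator_def)
  also have "\<dots> = (\<integral>\<^sup>+s\<in>{0<..<1}. emeasure lborel {x. ennreal s < w x} \<partial>lborel)"
    by (intro nn_integral_cong) (simp add: nn_integral_multc)
  finally show ?thesis by simp
qed

text \<open>
  If \<open>s < u x\<close> and \<open>s < v y\<close>, then \<open>s < w ((x + y) / 2)\<close>; so the Brunn-Minkowski inequality applies to
  the superlevel sets for each level s in the unit interval. It needs them to be non-empty, which is
  why u and v are normalized to have the same supremum 1. Integrate over s.
\<close>

lemma prekopa_leindler_real_normalized:
  fixes u v w :: "real \<Rightarrow> ennreal"
  assumes [measurable]: "u \<in> borel_measurable borel" "v \<in> borel_measurable borel"
      "w \<in> borel_measurable borel"
    and u: "\<And>x. u x \<le> 1" "\<And>s. s < 1 \<Longrightarrow> \<exists>x. s < u x"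
    and v: "\<And>x. v x \<le> 1" "\<And>s. s < 1 \<Longrightarrow> \<exists>x. s < v x"
    and mid: "\<And>x y. u x * v y \<le> (w ((x + y) / 2))\<^sup>2"
  shows "integral\<^sup>N lborel u + integral\<^sup>N lborel v \<le> 2 * integral\<^sup>N lborel w"
proof -
  have *: "emeasure lborel {x. ennreal s < u x} + emeasure lborel {x. ennreal s < v x}
      \<le> 2 * emeasure lborel {x. ennreal s < w x}" if "0 < s" "s < 1" for s
  proof (rule brunn_minkowski_real)
    show "{x. ennreal s < u x} \<noteq> {}" "{x. ennreal s < v x} \<noteq> {}"
      using u(2)[of "ennreal s"] v(2)[of "ennreal s"] that by auto
    fix x y assume "x \<in> {x. ennreal s < u x}" "y \<in> {x. ennreal s < v x}"
    then have "ennreal s * ennreal s < u x * ennreal s" "u x * ennreal s \<le> u x * v y"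
      using that le_less_trans[OF u(1)[of x], of top]
      by (auto intro: ennreal_mult_strict_right_mono mult_left_mono less_imp_le)
    then have "ennreal s * ennreal s < u x * v y" by (rule less_le_trans)
    also have "\<dots> \<le> (w ((x + y) / 2))\<^sup>2" by (rule mid)
    finally have "\<not> w ((x + y) / 2) \<le> ennreal s"
      using mult_mono[of "w ((x + y) / 2)" "ennreal s" "w ((x + y) / 2)" "ennreal s"]
      by (auto simp: power2_eq_square)
    then show "(x + y) / 2 \<in> {x. ennreal s < w x}" by simp
  qed measurable
  have "integral\<^sup>N lborel u + integral\<^sup>N lborel v
      = (\<integral>\<^sup>+x. min 1 (u x) \<partial>lborel) + (\<integral>\<^sup>+x. min 1 (v x) \<partial>lborel)"
    using u(1) v(1) by (simp add: min_absorb2)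
  also have "\<dots> = (\<integral>\<^sup>+s. emeasure lborel {x. ennreal s < u x} * indicator {0<..<1} s
      + emeasure lborel {x. ennreal s < v x} * indicator {0<..<1} s \<partial>lborel)"
    unfolding nn_integral_layers[symmetric, OF \<open>u \<in> _\<close>] nn_integral_layers[symmetric, OF \<open>v \<in> _\<close>]
    by (rule nn_integral_add[symmetric]) measurable
  also have "\<dots> \<le> (\<integral>\<^sup>+s. 2 * (emeasure lborel {x. ennreal s < w x} * indicator {0<..<1} s) \<partial>lborel)"
    using * by (intro nn_integral_mono) (auto simp: indicator_def)
  also have "\<dots> = 2 * (\<integral>\<^sup>+x. min 1 (w x) \<partial>lborel)"
    unfolding nn_integral_layers[symmetric, OF \<open>w \<in> _\<close>] by (rule nn_integral_cmult) measurable
  also have "\<dots> \<le> 2 * integral\<^sup>N lborel w"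
    by (intro mult_left_mono nn_integral_mono) auto
  finally show ?thesis .
qed

lemma ennreal_power2_le_imp_le:
  fixes x y :: ennreal
  assumes "x\<^sup>2 \<le> y\<^sup>2"
  shows "x \<le> y"
proof (rule ccontr)
  assume "\<not> x \<le> y"
  then have less: "y < x" by simp
  have "y * y < x * x"
  proof (cases "y = 0")
    case True
    then show ?thesis using less by (simp add: ennreal_zero_less_mult_iff)
  next
    case False
    then have "y * y < x * y"
      using less less_le_trans[OF less top_greatest]
      by (intro ennreal_mult_strict_right_mono) (auto simp: zero_less_iff_neq_zero)
    also have "\<dots> \<le> x * x" using less by (intro mult_left_mono) auto
    finally show ?thesis .
  qed
  then show False using assms by (simp add: power2_eq_square)
qed

lemma ennreal_am_gm: "4 * (x * y) \<le> ((x + y)\<^sup>2 :: ennreal)"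
proof (cases x; cases y)
  fix a b :: real assume ab: "0 \<le> a" "x = ennreal a" "0 \<le> b" "y = ennreal b"
  have "4 * (a * b) \<le> (a + b)\<^sup>2"
    using zero_le_power2[of "a - b"] by (simp add: power2_eq_square algebra_simps)
  then have "ennreal (4 * (a * b)) \<le> ennreal ((a + b)\<^sup>2)" by (rule ennreal_leI)
  moreover have "ennreal (4 * (a * b)) = 4 * (x * y)"
    using ab ennreal_mult'[of 4 "a * b"] by (simp add: ennreal_mult)
  moreover have "ennreal ((a + b)\<^sup>2) = (x + y)\<^sup>2"
    using ab by (simp add: ennreal_power[symmetric] ennreal_plus)
  ultimately show ?thesis by simp
qed (auto simp: power2_eq_square ennreal_mult_top ennreal_top_mult)

text \<open>
  Divide f and g by their suprema and h by the geometric mean of these. The normalized inequality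
  bounds the arithmetic mean of the integrals, hence also their geometric mean.
\<close>

lemma prekopa_leindler_real_bounded:
  fixes f g h :: "real \<Rightarrow> ennreal"
  assumes [measurable]: "f \<in> borel_measurable borel" "g \<in> borel_measurable borel"
      "h \<in> borel_measurable borel"
    and bdd: "\<And>x. f x \<le> ennreal M" "\<And>x. g x \<le> ennreal M"
    and mid: "\<And>x y. f x * g y \<le> (h ((x + y) / 2))\<^sup>2"
  shows "integral\<^sup>N lborel f * integral\<^sup>N lborel g \<le> (integral\<^sup>N lborel h)\<^sup>2"
proof (cases "(SUP x. f x) = 0 \<or> (SUP x. g x) = 0")
  case True
  then have "(\<forall>x. f x = 0) \<or> (\<forall>x. g x = 0)" by (auto simp: SUP_eq_iff bot_ennreal[symmetric])
  then have "integral\<^sup>N lborel f = 0 \<or> integral\<^sup>N lborel g = 0"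
    by (auto simp: nn_integral_0_iff_AE)
  then show ?thesis by (elim disjE) (simp_all only: mult_zero_left mult_zero_right zero_le)
next
  case False
  have "(SUP x. f x) \<le> ennreal M" "(SUP x. g x) \<le> ennreal M"
    using bdd by (auto intro: SUP_least)
  then have "(SUP x. f x) < top" "(SUP x. g x) < top"
    using ennreal_less_top le_less_trans by blast+
  with False obtain a b where ab: "(SUP x. f x) = ennreal a" "(SUP x. g x) = ennreal b" "0 < a" "0 < b"
    by (metis ennreal_0 ennreal_cases less_eq_real_def less_irrefl)
  define c where "c = sqrt (a * b)"
  have c: "0 < c" "c * c = a * b" using ab by (auto simp: c_def)
  have split_ab: "ennreal (1/a * (1/b)) = ennreal (1/a) * ennreal (1/b)"
    and split_c: "ennreal (1/c * (1/c)) = ennreal (1/c) * ennreal (1/c)"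
    using ab(3,4) c(1) by (intro ennreal_mult; simp)+
  let ?u = "\<lambda>x. ennreal (1/a) * f x" and ?v = "\<lambda>x. ennreal (1/b) * g x"
    and ?w = "\<lambda>x. ennreal (1/c) * h x"
  have scale: "s < ennreal (1/q) * z" if "ennreal q * s < z" "0 < q" "s < 1" for s z q
  proof -
    have "ennreal (1/q) * (ennreal q * s) < ennreal (1/q) * z"
      using that by (intro ennreal_mult_strict_left_mono) auto
    moreover have "ennreal (1/q) * (ennreal q * s) = s"
      using that by (simp add: mult.assoc[symmetric] ennreal_mult''[symmetric])
    ultimately show ?thesis by simp
  qed
  have less1: "ennreal q * s < ennreal q" if "0 < q" "s < 1" for s q
    using ennreal_mult_strict_left_mono[of s 1 "ennreal q"] that by simp
  have "integral\<^sup>N lborel ?u + integral\<^sup>N lborel ?v \<le> 2 * integral\<^sup>N lborel ?w"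
  proof (rule prekopa_leindler_real_normalized)
    fix x y
    have "f x \<le> ennreal a" "g x \<le> ennreal b" using ab(1,2) by (metis SUP_upper UNIV_I)+
    then have "ennreal (1/a) * f x \<le> ennreal (1/a) * ennreal a"
      "ennreal (1/b) * g x \<le> ennreal (1/b) * ennreal b"
      by (auto intro: mult_left_mono)
    then show "?u x \<le> 1" "?v x \<le> 1" using ab(3,4) by (simp_all add: ennreal_mult''[symmetric])
    have "?u x * ?v y = ennreal (1/a * (1/b)) * (f x * g y)"
      by (simp only: split_ab mult_ac)
    also have "1/a * (1/b) = 1/c * (1/c)" using c by simp
    also have "ennreal (1/c * (1/c)) * (f x * g y) \<le> ennreal (1/c * (1/c)) * (h ((x + y) / 2))\<^sup>2"
      by (intro mult_left_mono mid) simp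
    also have "\<dots> = (?w ((x + y) / 2))\<^sup>2"
      by (simp only: split_c power2_eq_square mult_ac)
    finally show "?u x * ?v y \<le> (?w ((x + y) / 2))\<^sup>2" .
  next
    fix s :: ennreal assume s: "s < 1"
    show "\<exists>x. s < ?u x"
      using less1[OF ab(3) s] scale[OF _ ab(3) s] unfolding ab(1)[symmetric] less_SUP_iff
      by (auto simp: ab(1))
    show "\<exists>x. s < ?v x"
      using less1[OF ab(4) s] scale[OF _ ab(4) s] unfolding ab(2)[symmetric] less_SUP_iff
      by (auto simp: ab(2))
  qed measurable
  then have "(integral\<^sup>N lborel ?u + integral\<^sup>N lborel ?v)\<^sup>2 \<le> (2 * integral\<^sup>N lborel ?w)\<^sup>2"
    by (intro power_mono) auto
  with ennreal_am_gm have "4 * (integral\<^sup>N lborel ?u * integral\<^sup>N lborel ?v) \<le> (2 * integral\<^sup>N lborel ?w)\<^sup>2"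
    by (rule order_trans)
  moreover have ints: "integral\<^sup>N lborel ?u = ennreal (1/a) * integral\<^sup>N lborel f"
      "integral\<^sup>N lborel ?v = ennreal (1/b) * integral\<^sup>N lborel g"
      "integral\<^sup>N lborel ?w = ennreal (1/c) * integral\<^sup>N lborel h"
    by (simp_all add: nn_integral_cmult)
  moreover have four: "(2 * 2 :: ennreal) = 4" by simp
  ultimately have "4 * (ennreal (1/a * (1/b)) * (integral\<^sup>N lborel f * integral\<^sup>N lborel g))
      \<le> 4 * (ennreal (1/c * (1/c)) * (integral\<^sup>N lborel h)\<^sup>2)"
    unfolding ints split_ab split_c four[symmetric] power2_eq_square by (simp only: mult_ac)
  also have "1/c * (1/c) = 1/a * (1/b)" using c by simp
  finally have "ennreal (4 * (1/a * (1/b))) * (integral\<^sup>N lborel f * integral\<^sup>N lborel g)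
      \<le> ennreal (4 * (1/a * (1/b))) * (integral\<^sup>N lborel h)\<^sup>2"
    using ab ennreal_mult'[of 4 "1/a * (1/b)"] by (simp add: mult.assoc)
  then show ?thesis
    using ab by (subst (asm) ennreal_mult_le_mult_iff) auto
qed

lemma prekopa_leindler_real:
  fixes f g h :: "real \<Rightarrow> ennreal"
  assumes [measurable]: "f \<in> borel_measurable borel" "g \<in> borel_measurable borel"
      "h \<in> borel_measurable borel"
    and mid: "\<And>x y. f x * g y \<le> (h ((x + y) / 2))\<^sup>2"
  shows "integral\<^sup>N lborel f * integral\<^sup>N lborel g \<le> (integral\<^sup>N lborel h)\<^sup>2"
proof -
  have lim: "integral\<^sup>N lborel q = (SUP n. \<integral>\<^sup>+x. min (ennreal (real n)) (q x) \<partial>lborel)"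
    if [measurable]: "q \<in> borel_measurable borel" for q :: "real \<Rightarrow> ennreal"
  proof -
    have inc: "incseq (\<lambda>n. min (ennreal (real n)) r)" for r
      by (intro incseq_SucI min.mono ennreal_leI) auto
    have "(\<lambda>n. min (ennreal (real n)) r) \<longlonglongrightarrow> min top r" for r
      by (intro tendsto_min tendsto_const)
         (auto simp: ennreal_of_nat_eq_real_of_nat[symmetric] intro: of_nat_tendsto_top_ennreal)
    then have "(SUP n. min (ennreal (real n)) r) = r" for r
      using LIMSEQ_unique[OF LIMSEQ_SUP[OF inc[of r]]] by (metis min_top)
    then have "integral\<^sup>N lborel q = (\<integral>\<^sup>+x. (SUP n. min (ennreal (real n)) (q x)) \<partial>lborel)"
      by simp
    also have "\<dots> = (SUP n. \<integral>\<^sup>+x. min (ennreal (real n)) (q x) \<partial>lborel)"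
      using inc by (intro nn_integral_monotone_convergence_SUP) (auto simp: incseq_def le_fun_def)
    finally show ?thesis .
  qed
  have "(\<integral>\<^sup>+x. min (ennreal (real n)) (f x) \<partial>lborel) * (\<integral>\<^sup>+x. min (ennreal (real k)) (g x) \<partial>lborel)
      \<le> (integral\<^sup>N lborel h)\<^sup>2" for n k
  proof (rule prekopa_leindler_real_bounded[of _ _ _ "real (max n k)"])
    fix x y
    have "min (ennreal (real n)) (f x) * min (ennreal (real k)) (g y) \<le> f x * g y"
      by (intro mult_mono) auto
    then show "min (ennreal (real n)) (f x) * min (ennreal (real k)) (g y) \<le> (h ((x + y) / 2))\<^sup>2"
      using mid order_trans by blast
    show "min (ennreal (real n)) (f x) \<le> ennreal (real (max n k))"
      "min (ennreal (real k)) (g x) \<le> ennreal (real (max n k))"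
      by (auto intro!: min.coboundedI1 ennreal_leI)
  qed auto
  then show ?thesis
    unfolding lim[OF \<open>f \<in> _\<close>] lim[OF \<open>g \<in> _\<close>]
    by (simp add: SUP_mult_left_ennreal SUP_mult_right_ennreal SUP_le_iff)
qed

abbreviation lborel_on :: "'i set \<Rightarrow> ('i \<Rightarrow> real) measure" where
  "lborel_on I \<equiv> PiM I (\<lambda>_. lborel)"

interpretation lborel_PiM: product_sigma_finite "\<lambda>_. lborel :: real measure" ..

text \<open>
  Integrating out one coordinate preserves the hypothesis, by the one-dimensional inequality on
  the fibres; that is why the inequality is stated for functions instead of sets.
\<close>

lemma prekopa_leindler_PiM:
  fixes f g h :: "('i \<Rightarrow> real) \<Rightarrow> ennreal"
  assumes "finite I"
    and "f \<in> borel_measurable (lborel_on I)" "g \<in> borel_measurable (lborel_on I)"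
      "h \<in> borel_measurable (lborel_on I)"
    and "\<And>x y. x \<in> space (lborel_on I) \<Longrightarrow> y \<in> space (lborel_on I) \<Longrightarrow>
      f x * g y \<le> (h (\<lambda>i\<in>I. (x i + y i) / 2))\<^sup>2"
  shows "integral\<^sup>N (lborel_on I) f * integral\<^sup>N (lborel_on I) g
    \<le> (integral\<^sup>N (lborel_on I) h)\<^sup>2"
  using assms
proof (induction I arbitrary: f g h rule: finite_induct)
  case empty
  then show ?case by (simp add: lborel_PiM.nn_integral_empty space_PiM restrict_def)
next
  case (insert j I)
  note [measurable] = insert.prems(1-3)
  let ?P = "lborel_on I"
  let ?int = "\<lambda>q x. \<integral>\<^sup>+s. q (x(j := s)) \<partial>(lborel :: real measure)"
  have upd [measurable]: "(\<lambda>(x, s). x(j := s)) \<in> ?P \<Otimes>\<^sub>M lborel \<rightarrow>\<^sub>M lborel_on (insert j I)"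
    by (rule measurable_add_dim)
  have upd1: "(\<lambda>s. x(j := s)) \<in> borel \<rightarrow>\<^sub>M lborel_on (insert j I)" if "x \<in> space ?P" for x
    using measurable_compose[OF measurable_Pair1'[OF that, of lborel] upd] by simp
  have "integral\<^sup>N ?P (?int f) * integral\<^sup>N ?P (?int g) \<le> (integral\<^sup>N ?P (?int h))\<^sup>2"
  proof (rule insert.IH)
    have "?int q \<in> borel_measurable ?P"
      if [measurable]: "q \<in> borel_measurable (lborel_on (insert j I))" for q
    proof -
      have "(\<lambda>p. q ((\<lambda>(x, s). x(j := s)) p)) \<in> borel_measurable (?P \<Otimes>\<^sub>M lborel)" by measurable
      then show ?thesis
        by (intro sigma_finite_measure.borel_measurable_nn_integral) (auto simp: split_beta' lborel.sigma_finite_measure_axioms)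
    qed
    then show "?int f \<in> borel_measurable ?P" "?int g \<in> borel_measurable ?P" "?int h \<in> borel_measurable ?P"
      using insert.prems(1-3) by blast+
    fix x y assume x: "x \<in> space ?P" and y: "y \<in> space ?P"
    define z where "z = (\<lambda>i\<in>I. (x i + y i) / 2)"
    have z: "z \<in> space ?P" by (auto simp: z_def space_PiM)
    show "?int f x * ?int g y \<le> (?int h z)\<^sup>2"
    proof (rule prekopa_leindler_real)
      show "(\<lambda>s. f (x(j := s))) \<in> borel_measurable borel" "(\<lambda>s. g (y(j := s))) \<in> borel_measurable borel"
        "(\<lambda>s. h (z(j := s))) \<in> borel_measurable borel"
        by (rule measurable_compose[OF upd1]; use x y z insert.prems in simp)+
      fix s t
      have "(\<lambda>i\<in>insert j I. ((x(j := s)) i + (y(j := t)) i) / 2) = z(j := (s + t) / 2)"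
        using insert.hyps by (auto simp: z_def restrict_def fun_eq_iff)
      moreover have "x(j := s) \<in> space (lborel_on (insert j I))"
        "y(j := t) \<in> space (lborel_on (insert j I))"
        using x y by (auto simp: space_PiM PiE_def extensional_def)
      ultimately show "f (x(j := s)) * g (y(j := t)) \<le> (h (z(j := (s + t) / 2)))\<^sup>2"
        using insert.prems(4) by metis
    qed
  qed
  then show ?case
    using insert.hyps by (simp add: lborel_PiM.product_nn_integral_insert)
qed

lemma distr_PiM_lborel_componentwise:
  fixes T :: "'i \<Rightarrow> real \<Rightarrow> real"
  assumes "finite I"
    and T: "\<And>i. i \<in> I \<Longrightarrow> T i \<in> borel \<rightarrow>\<^sub>M borel" "\<And>i. i \<in> I \<Longrightarrow> distr lborel borel (T i) = lborel"
  shows "distr (lborel_on I) (lborel_on I) (\<lambda>x. \<lambda>i\<in>I. T i (x i)) = lborel_on I"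
proof (rule lborel_PiM.PiM_eqI)
  let ?P = "lborel_on I"
  have meas: "(\<lambda>x. \<lambda>i\<in>I. T i (x i)) \<in> ?P \<rightarrow>\<^sub>M ?P"
    using T(1) by (intro measurable_restrict measurable_compose[OF measurable_component_singleton]) auto
  fix A :: "'i \<Rightarrow> real set" assume A: "\<And>i. i \<in> I \<Longrightarrow> A i \<in> sets lborel"
  have "emeasure (distr ?P ?P (\<lambda>x. \<lambda>i\<in>I. T i (x i))) (PiE I A)
      = emeasure ?P ((\<lambda>x. \<lambda>i\<in>I. T i (x i)) -` PiE I A \<inter> space ?P)"
    using A meas by (intro emeasure_distr sets_PiM_I_finite) (auto simp: assms)
  also have "(\<lambda>x. \<lambda>i\<in>I. T i (x i)) -` PiE I A \<inter> space ?P = PiE I (\<lambda>i. T i -` A i)"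
    by (auto simp: space_PiM PiE_def Pi_def)
  also have "emeasure ?P \<dots> = (\<Prod>i\<in>I. emeasure lborel (T i -` A i))"
    using A T(1) assms(1) measurable_sets[OF T(1)] by (intro lborel_PiM.emeasure_PiM) auto
  also have "\<dots> = (\<Prod>i\<in>I. emeasure lborel (A i))"
  proof (rule prod.cong)
    fix i assume i: "i \<in> I"
    have "emeasure lborel (T i -` A i) = emeasure (distr lborel borel (T i)) (A i)"
      using T(1)[OF i] A[OF i] by (simp add: emeasure_distr)
    then show "emeasure lborel (T i -` A i) = emeasure lborel (A i)" using T(2)[OF i] by simp
  qed simp
  finally show "emeasure (distr ?P ?P (\<lambda>x. \<lambda>i\<in>I. T i (x i))) (PiE I A) = (\<Prod>i\<in>I. emeasure lborel (A i))" .
qed (use assms in auto)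

text \<open>
  The midpoints between points of A and points of \<open>- A\<close> lie in the ball of diameter d about the origin,
  and \<open>- A\<close> has the same volume as A.
\<close>

lemma isodiametric_PiM:
  assumes I: "finite I" and A [measurable]: "A \<in> sets (lborel_on I)"
    and diam: "\<And>x y. x \<in> A \<Longrightarrow> y \<in> A \<Longrightarrow> sqrt (\<Sum>i\<in>I. (x i - y i)\<^sup>2) \<le> d" and "0 \<le> d"
  shows "emeasure (lborel_on I) A \<le> ennreal (unit_ball_vol (real (card I)) * (d / 2) ^ card I)"
proof -
  let ?P = "lborel_on I"
  let ?neg = "\<lambda>x. \<lambda>i\<in>I. - x i :: real"
  \<comment> \<open>The diameter may be 0, whereas the volume formula for balls is for positive radii.\<close>
  have le: "emeasure ?P A \<le> ennreal (unit_ball_vol (real (card I)) * r ^ card I)" if "d / 2 < r" for r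
  proof -
    have "0 < r" using that \<open>0 \<le> d\<close> by simp
    let ?C = "{z. sqrt (\<Sum>i\<in>I. (z i)\<^sup>2) \<le> r} \<inter> space ?P"
    have C [measurable]: "?C \<in> sets ?P"
    proof -
      have "{z \<in> space ?P. sqrt (\<Sum>i\<in>I. (z i)\<^sup>2) \<le> r} \<in> sets ?P" by measurable
      then show ?thesis by (simp add: Int_def conj_commute)
    qed
    have neg [measurable]: "?neg \<in> ?P \<rightarrow>\<^sub>M ?P" by measurable
    have refl: "distr ?P ?P ?neg = ?P"
      using I by (intro distr_PiM_lborel_componentwise) (auto simp: lborel_distr_uminus)
    have "(\<integral>\<^sup>+x. indicator A x \<partial>?P) * (\<integral>\<^sup>+x. indicator A (?neg x) \<partial>?P) \<le> (\<integral>\<^sup>+x. indicator ?C x \<partial>?P)\<^sup>2"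
    proof (rule prekopa_leindler_PiM[OF I])
      fix x y assume xy: "x \<in> space ?P" "y \<in> space ?P"
      let ?z = "\<lambda>i\<in>I. (x i + y i) / 2"
      have "?z \<in> ?C" if "x \<in> A" "?neg y \<in> A"
      proof -
        have "(\<Sum>i\<in>I. (?z i)\<^sup>2) = (\<Sum>i\<in>I. (1/2)\<^sup>2 * (x i - ?neg y i)\<^sup>2)"
          by (intro sum.cong) (auto simp: power_divide)
        also have "sqrt \<dots> = sqrt (\<Sum>i\<in>I. (x i - ?neg y i)\<^sup>2) / 2"
          by (subst sum_distrib_left[symmetric]) (simp add: real_sqrt_mult real_sqrt_divide)
        also have "\<dots> \<le> r" using diam[OF that] \<open>d / 2 < r\<close> by simp
        finally show ?thesis by (simp add: space_PiM)
      qed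
      then show "indicator A x * indicator A (?neg y) \<le> (indicator ?C ?z :: ennreal)\<^sup>2"
        by (auto simp: indicator_def)
    qed measurable
    also have "(\<integral>\<^sup>+x. indicator A (?neg x) \<partial>?P) = (\<integral>\<^sup>+x. indicator A x \<partial>distr ?P ?P ?neg)"
      by (rule nn_integral_distr[symmetric]) measurable
    finally have "(emeasure ?P A)\<^sup>2 \<le> (emeasure ?P ?C)\<^sup>2"
      by (simp add: refl power2_eq_square)
    also have "emeasure ?P ?C = ennreal (unit_ball_vol (real (card I)) * r ^ card I)"
      using I \<open>0 < r\<close> by (rule emeasure_cball_aux)
    finally show ?thesis by (rule ennreal_power2_le_imp_le)
  qed
  have "((\<lambda>r. ennreal (unit_ball_vol (real (card I)) * r ^ card I))
      \<longlongrightarrow> ennreal (unit_ball_vol (real (card I)) * (d / 2) ^ card I)) (at_right (d / 2))"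
    by (intro tendsto_intros)
  moreover have "eventually (\<lambda>r. emeasure ?P A \<le> ennreal (unit_ball_vol (real (card I)) * r ^ card I))
      (at_right (d / 2))"
    using le by (auto simp: eventually_at_filter)
  ultimately show ?thesis
    by (intro tendsto_lowerbound) auto
qed

section \<open>Hausdorff measure on a linear subspace\<close>

definition orthonormal :: "'a::euclidean_space set \<Rightarrow> bool" where
  "orthonormal B \<longleftrightarrow> finite B \<and> pairwise orthogonal B \<and> (\<forall>b\<in>B. norm b = 1)"

definition lin_comb :: "'a::euclidean_space set \<Rightarrow> ('a \<Rightarrow> real) \<Rightarrow> 'a" where
  "lin_comb B f = (\<Sum>b\<in>B. f b *\<^sub>R b)"

text \<open>
  Lebesgue measure of the span of an orthonormal system, as a measure on the ambient space. For
  the standard basis this is \<open>lborel\<close>.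
\<close>

definition span_measure :: "'a::euclidean_space set \<Rightarrow> 'a measure" where
  "span_measure B = distr (lborel_on B) borel (lin_comb B)"

lemma orthonormal_finite: "orthonormal B \<Longrightarrow> finite B"
  by (simp add: orthonormal_def)

lemma orthonormal_inner:
  assumes "orthonormal B" "b \<in> B" "c \<in> B"
  shows "b \<bullet> c = (if b = c then 1 else 0)"
  using assms by (auto simp: orthonormal_def pairwise_def orthogonal_def norm_eq_1)

lemma orthonormal_Basis: "orthonormal Basis"
  by (auto simp: orthonormal_def pairwise_def orthogonal_def inner_Basis)

lemma lin_comb_inner:
  assumes "orthonormal B" "b \<in> B"
  shows "lin_comb B f \<bullet> b = f b"
proof -
  have "lin_comb B f \<bullet> b = (\<Sum>c\<in>B. if c = b then f b else 0)"
    unfolding lin_comb_def inner_sum_left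
    by (intro sum.cong refl) (simp add: orthonormal_inner[OF assms(1) _ assms(2)])
  then show ?thesis using assms orthonormal_finite[OF assms(1)] by simp
qed

lemma lin_comb_coefficients:
  assumes "orthonormal B" "x \<in> span B"
  shows "lin_comb B (\<lambda>b. x \<bullet> b) = x"
  using assms unfolding lin_comb_def orthonormal_def by (intro orthonormal_basis_expand) auto

lemma lin_comb_in_span: "lin_comb B f \<in> span B"
  unfolding lin_comb_def by (intro span_sum span_scale span_base)

lemma lin_comb_cong: "(\<And>b. b \<in> B \<Longrightarrow> f b = g b) \<Longrightarrow> lin_comb B f = lin_comb B g"
  unfolding lin_comb_def by (rule sum.cong) auto

lemma lin_comb_add: "lin_comb B (\<lambda>b. f b + g b) = lin_comb B f + lin_comb B g"
  by (simp add: lin_comb_def scaleR_add_left sum.distrib)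

lemma lin_comb_diff: "lin_comb B (\<lambda>b. f b - g b) = lin_comb B f - lin_comb B g"
  by (simp add: lin_comb_def scaleR_diff_left sum_subtractf)

lemma lin_comb_scale: "lin_comb B (\<lambda>b. c * f b) = c *\<^sub>R lin_comb B f"
  by (simp add: lin_comb_def scaleR_sum_right)

lemma norm_lin_comb:
  assumes "orthonormal B"
  shows "norm (lin_comb B f) = sqrt (\<Sum>b\<in>B. (f b)\<^sup>2)"
proof -
  have "lin_comb B f \<bullet> lin_comb B f = (\<Sum>b\<in>B. f b * (lin_comb B f \<bullet> b))"
    by (simp add: lin_comb_def inner_sum_right)
  also have "\<dots> = (\<Sum>b\<in>B. (f b)\<^sup>2)"
    by (intro sum.cong) (auto simp: lin_comb_inner[OF assms] power2_eq_square)
  finally show ?thesis by (simp add: norm_eq_sqrt_inner)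
qed

lemma measurable_lin_comb [measurable]: "lin_comb B \<in> lborel_on B \<rightarrow>\<^sub>M borel"
  unfolding lin_comb_def by measurable

lemma sets_span_measure [simp, measurable_cong]: "sets (span_measure B) = sets borel"
  by (simp add: span_measure_def)

lemma space_span_measure [simp]: "space (span_measure B) = UNIV"
  by (simp add: span_measure_def)

lemma span_measure_Basis: "span_measure Basis = lborel"
  unfolding span_measure_def lin_comb_def by (rule lborel_eq[symmetric])

lemma nn_integral_span_measure:
  assumes [measurable]: "f \<in> borel_measurable borel"
  shows "integral\<^sup>N (span_measure B) f = (\<integral>\<^sup>+g. f (lin_comb B g) \<partial>lborel_on B)"
  unfolding span_measure_def by (rule nn_integral_distr) measurable

lemma span_borel [measurable]: "span B \<in> sets (borel :: 'a::euclidean_space measure)"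
  by (intro borel_closed closed_span)

lemma AE_span_measure: "AE x in span_measure B. x \<in> span B"
  unfolding span_measure_def
  using span_borel[of B] by (simp add: AE_distr_iff[OF measurable_lin_comb] lin_comb_in_span)

lemma emeasure_span_measure:
  assumes [measurable]: "A \<in> sets borel"
  shows "emeasure (span_measure B) A
    = emeasure (lborel_on B) (lin_comb B -` A \<inter> space (lborel_on B))"
  unfolding span_measure_def by (rule emeasure_distr) measurable

lemma span_measure_translate:
  assumes B: "orthonormal B" and v: "v \<in> span B"
  shows "distr (span_measure B) borel ((+) v) = span_measure B"
proof -
  let ?P = "lborel_on B"
  let ?T = "\<lambda>x. \<lambda>b\<in>B. v \<bullet> b + x b"
  have T: "?T \<in> ?P \<rightarrow>\<^sub>M ?P" by measurable
  have "distr ?P ?P ?T = ?P"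
    using orthonormal_finite[OF B] by (intro distr_PiM_lborel_componentwise) (auto simp: lborel_distr_plus)
  then have "span_measure B = distr (distr ?P ?P ?T) borel (lin_comb B)"
    by (simp add: span_measure_def)
  also have "\<dots> = distr ?P borel (lin_comb B \<circ> ?T)"
    using T by (intro distr_distr) measurable
  also have "lin_comb B \<circ> ?T = (\<lambda>x. v + lin_comb B x)"
  proof
    fix x
    have "lin_comb B (?T x) = lin_comb B (\<lambda>b. v \<bullet> b + x b)" by (rule lin_comb_cong) simp
    then show "(lin_comb B \<circ> ?T) x = v + lin_comb B x"
      by (simp add: lin_comb_add lin_comb_coefficients[OF B v])
  qed
  also have "distr ?P borel (\<lambda>x. v + lin_comb B x) = distr (span_measure B) borel ((+) v)"
    unfolding span_measure_def by (subst distr_distr) (auto simp: o_def)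
  finally show ?thesis by simp
qed

definition span_cube :: "'a::euclidean_space set \<Rightarrow> 'a set" where
  "span_cube B = {x \<in> span B. \<forall>b\<in>B. 0 \<le> x \<bullet> b \<and> x \<bullet> b \<le> 1}"

lemma closed_span_cube: "closed (span_cube B)"
proof -
  have "closed (span B \<inter> (\<Inter>b\<in>B. {x. 0 \<le> x \<bullet> b \<and> x \<bullet> b \<le> 1}))"
    by (intro closed_Int closed_span closed_INT ballI closed_Collect_conj closed_Collect_le continuous_intros)
  also have "span B \<inter> (\<Inter>b\<in>B. {x. 0 \<le> x \<bullet> b \<and> x \<bullet> b \<le> 1}) = span_cube B"
    by (auto simp: span_cube_def)
  finally show ?thesis .
qed

lemma span_cube_borel [measurable]: "span_cube B \<in> sets borel"
  by (rule borel_closed[OF closed_span_cube])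

lemma emeasure_span_cube:
  assumes B: "orthonormal B"
  shows "emeasure (span_measure B) (span_cube B) = 1"
proof -
  have "lin_comb B -` span_cube B \<inter> space (lborel_on B) = PiE B (\<lambda>_. {0..1})"
    by (auto simp: span_cube_def lin_comb_in_span lin_comb_inner[OF B] space_PiM PiE_def Pi_def)
  then show ?thesis
    using orthonormal_finite[OF B] by (simp add: emeasure_span_measure lborel_PiM.emeasure_PiM)
qed

lemma emeasure_span_ball:
  assumes B: "orthonormal B" and c: "c \<in> span B" and r: "0 < r"
  shows "emeasure (span_measure B) (cball c r) = ennreal (unit_ball_vol (real (card B)) * r ^ card B)"
proof -
  have "emeasure (span_measure B) (cball c r) = emeasure (distr (span_measure B) borel ((+) c)) (cball c r)"
    by (simp add: span_measure_translate[OF B c])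
  also have "\<dots> = emeasure (span_measure B) ((+) c -` cball c r)"
    by (subst emeasure_distr) auto
  also have "(+) c -` cball c r = cball 0 r" by (auto simp: dist_norm)
  also have "lin_comb B -` cball 0 r \<inter> space (lborel_on B)
      = {f. sqrt (\<Sum>i\<in>B. (f i)\<^sup>2) \<le> r} \<inter> space (lborel_on B)"
    by (auto simp: norm_lin_comb[OF B])
  then have "emeasure (span_measure B) (cball 0 r) = ennreal (unit_ball_vol (real (card B)) * r ^ card B)"
    using emeasure_cball_aux[OF orthonormal_finite[OF B] r] by (simp add: emeasure_span_measure)
  finally show ?thesis .
qed

lemma span_measure_le_content:
  assumes B: "orthonormal B" and S: "S \<in> sets borel" "bounded S"
  shows "emeasure (span_measure B) S \<le> hausdorff_content (card B) S"
proof (cases "S = {}")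
  case False
  have "emeasure (lborel_on B) (lin_comb B -` S \<inter> space (lborel_on B))
      \<le> ennreal (unit_ball_vol (real (card B)) * (diameter S / 2) ^ card B)"
  proof (rule isodiametric_PiM)
    fix x y assume "x \<in> lin_comb B -` S \<inter> space (lborel_on B)"
      "y \<in> lin_comb B -` S \<inter> space (lborel_on B)"
    then have "dist (lin_comb B x) (lin_comb B y) \<le> diameter S"
      using S by (intro diameter_bounded_bound) auto
    then show "sqrt (\<Sum>i\<in>B. (x i - y i)\<^sup>2) \<le> diameter S"
      by (simp add: dist_norm lin_comb_diff[symmetric] norm_lin_comb[OF B])
  qed (use S in \<open>auto simp: orthonormal_finite[OF B] diameter_ge_0 intro: measurable_sets[OF measurable_lin_comb]\<close>)
  then show ?thesis
    using False S by (simp add: hausdorff_content_def emeasure_span_measure)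
qed simp

lemma hausdorff_content_closure:
  assumes "bounded (S :: 'a::euclidean_space set)"
  shows "hausdorff_content m (closure S) = hausdorff_content m S"
  using assms by (simp add: hausdorff_content_def diameter_closure)

text \<open>
  Closures have the same diameter as the covering sets but are measurable, and the isodiametric
  inequality bounds their measure.
\<close>

lemma span_measure_le_hausdorff_outer:
  assumes B: "orthonormal B" and A: "A \<in> sets borel"
  shows "emeasure (span_measure B) A \<le> hausdorff_outer (card B) A"
proof -
  have "emeasure (span_measure B) A \<le> hausdorff_pre (card B) 1 A"
  proof (rule hausdorff_pre_greatest)
    fix S assume S: "delta_cover 1 A S"
    have "A \<subseteq> (\<Union>i. closure (S i))"
      using delta_coverD(1)[OF S] by (rule order_trans) (intro UN_mono closure_subset subset_refl)
    then have "emeasure (span_measure B) A \<le> emeasure (span_measure B) (\<Union>i. closure (S i))"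
      by (intro emeasure_mono) auto
    also have "\<dots> \<le> (\<Sum>i. emeasure (span_measure B) (closure (S i)))"
      by (intro emeasure_subadditive_countably) auto
    also have "\<dots> \<le> (\<Sum>i. hausdorff_content (card B) (closure (S i)))"
      using delta_coverD(2)[OF S] by (intro suminf_le span_measure_le_content[OF B]) auto
    also have "\<dots> = (\<Sum>i. hausdorff_content (card B) (S i))"
      using delta_coverD(2)[OF S] by (simp add: hausdorff_content_closure)
    finally show "emeasure (span_measure B) A \<le> \<dots>" .
  qed
  also have "\<dots> \<le> hausdorff_outer (card B) A" by (rule hausdorff_pre_le_outer) simp
  finally show ?thesis .
qed

lemma diameter_scale_translate:
  fixes S :: "'a::real_normed_vector set"
  assumes "bounded S" "0 \<le> r"
  shows "diameter ((\<lambda>x. r *\<^sub>R x + v) ` S) \<le> r * diameter S"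
proof (cases "S = {}")
  case False
  show ?thesis
  proof (rule diameter_le)
    fix x y assume "x \<in> (\<lambda>x. r *\<^sub>R x + v) ` S" "y \<in> (\<lambda>x. r *\<^sub>R x + v) ` S"
    then obtain a b where ab: "a \<in> S" "b \<in> S" "x = r *\<^sub>R a + v" "y = r *\<^sub>R b + v" by auto
    have "norm (x - y) = r * dist a b"
      using assms by (simp add: ab dist_norm scaleR_diff_right[symmetric])
    also have "\<dots> \<le> r * diameter S"
      using assms ab by (intro mult_left_mono diameter_bounded_bound)
    finally show "norm (x - y) \<le> r * diameter S" .
  qed (use False in simp)
qed simp

lemma hausdorff_pre_scale_translate:
  fixes A :: "'a::real_normed_vector set"
  assumes r: "0 < r" and "0 \<le> \<delta>"
  shows "hausdorff_pre m (r * \<delta>) ((\<lambda>x. r *\<^sub>R x + v) ` A) \<le> ennreal (r ^ m) * hausdorff_pre m \<delta> A"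
proof -
  let ?T = "\<lambda>x. r *\<^sub>R x + v"
  have "ennreal (1 / r ^ m) * hausdorff_pre m (r * \<delta>) (?T ` A) \<le> hausdorff_pre m \<delta> A"
  proof (rule hausdorff_pre_greatest)
    fix S assume S: "delta_cover \<delta> A S"
    have "bounded (?T ` S i)" for i
      using bounded_translation[OF bounded_scaling[OF delta_coverD(2)[OF S, of i], of r], of v]
      by (simp add: image_image add.commute)
    moreover have "diameter (?T ` S i) \<le> r * \<delta>" for i
      using diameter_scale_translate[OF delta_coverD(2)[OF S, of i], of r v] delta_coverD(3)[OF S, of i] r
      by (meson less_imp_le mult_left_mono order_trans)
    moreover have "?T ` A \<subseteq> (\<Union>i. ?T ` S i)"
      using delta_coverD(1)[OF S] by blast
    ultimately have "delta_cover (r * \<delta>) (?T ` A) (\<lambda>i. ?T ` S i)"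
      by (simp add: delta_cover_def)
    then have "hausdorff_pre m (r * \<delta>) (?T ` A) \<le> (\<Sum>i. hausdorff_content m (?T ` S i))"
      by (rule hausdorff_pre_le)
    also have "\<dots> \<le> (\<Sum>i. ennreal (r ^ m) * hausdorff_content m (S i))"
    proof (intro suminf_le allI)
      fix i
      have "(diameter (?T ` S i) / 2) ^ m \<le> r ^ m * (diameter (S i) / 2) ^ m"
        unfolding power_mult_distrib[symmetric]
        using diameter_scale_translate[OF delta_coverD(2)[OF S, of i], of r v] r
          diameter_ge_0[OF \<open>bounded (?T ` S i)\<close>]
        by (intro power_mono) auto
      then have "unit_ball_vol (real m) * (diameter (?T ` S i) / 2) ^ m
          \<le> r ^ m * (unit_ball_vol (real m) * (diameter (S i) / 2) ^ m)"
        using mult_left_mono[of _ _ "unit_ball_vol (real m)"] by (simp add: mult_ac)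
      then have "ennreal (unit_ball_vol (real m) * (diameter (?T ` S i) / 2) ^ m)
          \<le> ennreal (r ^ m) * ennreal (unit_ball_vol (real m) * (diameter (S i) / 2) ^ m)"
        using r by (subst ennreal_mult'[symmetric]) (auto intro: ennreal_leI)
      then show "hausdorff_content m (?T ` S i) \<le> ennreal (r ^ m) * hausdorff_content m (S i)"
        by (simp add: hausdorff_content_def)
    qed auto
    also have "\<dots> = ennreal (r ^ m) * (\<Sum>i. hausdorff_content m (S i))" by simp
    finally have "ennreal (1 / r ^ m) * hausdorff_pre m (r * \<delta>) (?T ` A)
        \<le> ennreal (1 / r ^ m) * (ennreal (r ^ m) * (\<Sum>i. hausdorff_content m (S i)))"
      by (rule mult_left_mono) simp
    also have "\<dots> = (\<Sum>i. hausdorff_content m (S i))"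
      using r by (simp add: mult.assoc[symmetric] ennreal_mult''[symmetric])
    finally show "ennreal (1 / r ^ m) * hausdorff_pre m (r * \<delta>) (?T ` A) \<le> \<dots>" .
  qed
  then have "ennreal (r ^ m) * (ennreal (1 / r ^ m) * hausdorff_pre m (r * \<delta>) (?T ` A))
      \<le> ennreal (r ^ m) * hausdorff_pre m \<delta> A"
    by (rule mult_left_mono) simp
  then show ?thesis
    using r by (simp add: mult.assoc[symmetric] ennreal_mult''[symmetric])
qed

lemma hausdorff_outer_translate:
  fixes A :: "'a::real_normed_vector set"
  shows "hausdorff_outer m ((+) v ` A) = hausdorff_outer m A"
proof -
  have le: "hausdorff_outer m ((+) v ` A) \<le> hausdorff_outer m A" for v and A :: "'a set"
  proof (rule hausdorff_outer_least)
    fix \<delta> :: real assume \<delta>: "0 < \<delta>"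
    have "hausdorff_pre m \<delta> ((+) v ` A) \<le> hausdorff_pre m \<delta> A"
      using hausdorff_pre_scale_translate[of 1 \<delta> m v A] \<delta> by (simp add: add.commute[of _ v])
    also have "\<dots> \<le> hausdorff_outer m A" using \<delta> by (rule hausdorff_pre_le_outer)
    finally show "hausdorff_pre m \<delta> ((+) v ` A) \<le> hausdorff_outer m A" .
  qed
  show ?thesis
    using le[of v A] le[of "- v" "(+) v ` A"] by (simp add: image_image)
qed

lemma hausdorff_measure_translate:
  "distr (hausdorff_measure m) borel ((+) v) = (hausdorff_measure m :: 'a::euclidean_space measure)"
proof (rule measure_eqI)
  fix A :: "'a set" assume "A \<in> sets (distr (hausdorff_measure m) borel ((+) v))"
  then have A: "A \<in> sets borel" by simp
  have "(+) v -` A \<in> sets borel"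
    using measurable_sets[of "(+) v" borel borel A] A by simp
  moreover have "(+) v -` A = (+) (- v) ` A"
  proof (intro set_eqI iffI)
    fix x assume "x \<in> (+) v -` A"
    then show "x \<in> (+) (- v) ` A" by (intro image_eqI[of _ _ "v + x"]) auto
  qed auto
  ultimately show "emeasure (distr (hausdorff_measure m) borel ((+) v)) A = emeasure (hausdorff_measure m) A"
    using A hausdorff_outer_translate[of m "- v" A]
    by (simp add: emeasure_distr emeasure_hausdorff_measure)
qed simp

text \<open>
  The cube is covered by \<open>N^k\<close> copies of itself, scaled by \<open>1 / N\<close>. So the bound on the diameters of
  the covering sets has no influence on the value for the cube.
\<close>

lemma hausdorff_outer_span_cube_le:
  assumes B: "orthonormal B" and D: "0 < D"
  shows "hausdorff_outer (card B) (span_cube B) \<le> hausdorff_pre (card B) D (span_cube B)"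
proof (rule hausdorff_outer_least)
  fix \<delta> :: real assume \<delta>: "0 < \<delta>"
  let ?Q = "span_cube B" and ?k = "card B"
  obtain N :: nat where N: "0 < N" "D / \<delta> \<le> real N"
    using real_arch_simple[of "max 1 (D / \<delta>)"] by (metis max.bounded_iff not_gr0 of_nat_0 not_one_le_zero)
  then have N\<delta>: "1 / real N * D \<le> \<delta>" using \<delta> by (simp add: field_simps)
  let ?G = "PiE B (\<lambda>_. {..<N})"
  let ?v = "\<lambda>g. lin_comb B (\<lambda>b. real (g b) / real N)"
  let ?piece = "\<lambda>g. (\<lambda>x. (1 / real N) *\<^sub>R x + ?v g) ` ?Q"
  have finG: "finite ?G" and cardG: "card ?G = N ^ ?k"
    using orthonormal_finite[OF B] by (auto intro: finite_PiE simp: card_PiE)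
  have cover: "?Q \<subseteq> (\<Union>g\<in>?G. ?piece g)"
  proof
    fix x assume x: "x \<in> ?Q"
    then have xs: "x \<in> span B" and x01: "\<And>b. b \<in> B \<Longrightarrow> 0 \<le> x \<bullet> b \<and> x \<bullet> b \<le> 1"
      by (auto simp: span_cube_def)
    \<comment> \<open>The minimum takes care of the coordinate 1, which belongs to the last piece.\<close>
    define g where "g = (\<lambda>b\<in>B. min (N - 1) (nat \<lfloor>real N * (x \<bullet> b)\<rfloor>))"
    have gG: "g \<in> ?G" using N by (auto simp: g_def)
    have g01: "0 \<le> real N * (x \<bullet> b) - real (g b) \<and> real N * (x \<bullet> b) - real (g b) \<le> 1" if b: "b \<in> B" for b
    proof -
      have nn: "0 \<le> real N * (x \<bullet> b)" and le: "real N * (x \<bullet> b) \<le> real N"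
        using x01[OF b] N by (auto simp: mult_le_cancel_left1)
      have "real (nat \<lfloor>real N * (x \<bullet> b)\<rfloor>) \<le> real N * (x \<bullet> b)"
        "real N * (x \<bullet> b) < real (nat \<lfloor>real N * (x \<bullet> b)\<rfloor>) + 1"
        using nn by linarith+
      moreover have "real (g b) = min (real N - 1) (real (nat \<lfloor>real N * (x \<bullet> b)\<rfloor>))"
        using b N by (auto simp: g_def min_def of_nat_diff)
      ultimately show ?thesis using le by linarith
    qed
    define z where "z = lin_comb B (\<lambda>b. real N * (x \<bullet> b) - real (g b))"
    have "z \<in> ?Q"
      using g01 by (auto simp: span_cube_def z_def lin_comb_in_span lin_comb_inner[OF B])
    moreover have "x = (1 / real N) *\<^sub>R z + ?v g"
    proof -
      have "(1 / real N) *\<^sub>R z + ?v g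
          = lin_comb B (\<lambda>b. 1 / real N * (real N * (x \<bullet> b) - real (g b)) + real (g b) / real N)"
        by (simp only: z_def lin_comb_add lin_comb_scale)
      also have "\<dots> = lin_comb B (\<lambda>b. x \<bullet> b)"
        using N by (intro lin_comb_cong) (simp add: field_simps)
      finally show ?thesis using lin_comb_coefficients[OF B xs] by simp
    qed
    ultimately show "x \<in> (\<Union>g\<in>?G. ?piece g)"
      using gG by blast
  qed
  have "hausdorff_pre ?k \<delta> ?Q \<le> hausdorff_pre ?k (1 / real N * D) ?Q"
    using N\<delta> by (rule hausdorff_pre_antimono)
  also have "\<dots> \<le> hausdorff_pre ?k (1 / real N * D) (\<Union>g\<in>?G. ?piece g)"
    using cover by (rule hausdorff_pre_mono)
  also have "\<dots> \<le> (\<Sum>g\<in>?G. hausdorff_pre ?k (1 / real N * D) (?piece g))"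
    using D finG by (intro hausdorff_pre_UN_le) auto
  also have "\<dots> \<le> (\<Sum>g\<in>?G. ennreal ((1 / real N) ^ ?k) * hausdorff_pre ?k D ?Q)"
    using N D by (intro sum_mono hausdorff_pre_scale_translate) auto
  also have "\<dots> = ennreal (real N ^ ?k) * (ennreal ((1 / real N) ^ ?k) * hausdorff_pre ?k D ?Q)"
    by (simp add: cardG ennreal_of_nat_eq_real_of_nat)
  also have "\<dots> = hausdorff_pre ?k D ?Q"
    using N by (simp add: mult.assoc[symmetric] ennreal_mult''[symmetric] power_mult_distrib[symmetric])
  finally show "hausdorff_pre ?k \<delta> ?Q \<le> hausdorff_pre ?k D ?Q" .
qed

lemma bounded_span_cube:
  assumes B: "orthonormal B"
  shows "bounded (span_cube B)"
proof (rule boundedI)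
  fix x assume x: "x \<in> span_cube B"
  then have "norm x = norm (\<Sum>b\<in>B. (x \<bullet> b) *\<^sub>R b)"
    using lin_comb_coefficients[OF B] by (simp add: span_cube_def lin_comb_def)
  also have "\<dots> \<le> (\<Sum>b\<in>B. norm ((x \<bullet> b) *\<^sub>R b))" by (rule norm_sum)
  also have "\<dots> \<le> (\<Sum>b\<in>B. 1)"
    using x B by (intro sum_mono) (auto simp: span_cube_def orthonormal_def)
  finally show "norm x \<le> real (card B)" by simp
qed

lemma hausdorff_outer_span_cube_finite:
  assumes B: "orthonormal B"
  shows "hausdorff_outer (card B) (span_cube B) < top"
proof -
  let ?Q = "span_cube B"
  have 0: "0 \<le> diameter ?Q" by (rule diameter_ge_0[OF bounded_span_cube[OF B]])
  have "hausdorff_outer (card B) ?Q \<le> hausdorff_pre (card B) (diameter ?Q + 1) ?Q"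
    using 0 by (intro hausdorff_outer_span_cube_le[OF B]) auto
  also have "\<dots> \<le> hausdorff_content (card B) ?Q"
    using 0 bounded_span_cube[OF B] by (intro hausdorff_pre_le_content) auto
  also have "\<dots> < top" by (simp add: hausdorff_content_def)
  finally show ?thesis .
qed

text \<open>
  Integrate \<open>indicator A x * indicator Q (y - x)\<close> against both measures: translating y by x gives the
  left-hand side, translating x by y and then y by x the right-hand side.
\<close>

lemma translation_invariant_measures_proportional:
  fixes \<mu> \<kappa> :: "'a::euclidean_space measure"
  assumes "sigma_finite_measure \<mu>" "sigma_finite_measure \<kappa>"
    and sets [measurable_cong]: "sets \<mu> = sets borel" "sets \<kappa> = sets borel"
    and V: "\<And>v. v \<in> V \<Longrightarrow> - v \<in> V"
    and AE: "AE x in \<mu>. x \<in> V" "AE x in \<kappa>. x \<in> V"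
    and trans: "\<And>v. v \<in> V \<Longrightarrow> distr \<mu> borel ((+) v) = \<mu>" "\<And>v. v \<in> V \<Longrightarrow> distr \<kappa> borel ((+) v) = \<kappa>"
    and A [measurable]: "A \<in> sets borel" and Q [measurable]: "Q \<in> sets borel"
  shows "emeasure \<mu> A * emeasure \<kappa> Q = emeasure \<kappa> A * emeasure \<mu> (uminus -` Q)"
proof -
  interpret \<mu>: sigma_finite_measure \<mu> by fact
  interpret \<kappa>: sigma_finite_measure \<kappa> by fact
  interpret pair_sigma_finite \<mu> \<kappa> ..
  have nn: "integral\<^sup>N M f = (\<integral>\<^sup>+x. f (v + x) \<partial>M)"
    if "distr M borel ((+) v) = M" "sets M = sets borel" and [measurable]: "f \<in> borel_measurable borel"
    for M :: "'a measure" and f v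
  proof -
    have [measurable]: "(+) v \<in> M \<rightarrow>\<^sub>M borel"
      using that(2) by (simp add: measurable_cong_sets[OF that(2) refl])
    have "integral\<^sup>N M f = integral\<^sup>N (distr M borel ((+) v)) f" using that(1) by simp
    also have "\<dots> = (\<integral>\<^sup>+x. f (v + x) \<partial>M)" by (rule nn_integral_distr) measurable
    finally show ?thesis .
  qed
  have [measurable]: "uminus -` Q \<in> sets borel"
    using measurable_sets[of uminus borel borel Q] by simp
  have "emeasure \<mu> A * emeasure \<kappa> Q = (\<integral>\<^sup>+x. indicator A x * emeasure \<kappa> Q \<partial>\<mu>)"
    by (subst nn_integral_multc) auto
  also have "\<dots> = (\<integral>\<^sup>+x. (\<integral>\<^sup>+y. indicator A x * indicator Q (y - x) \<partial>\<kappa>) \<partial>\<mu>)"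
  proof (rule nn_integral_cong_AE, use AE(1) in eventually_elim)
    fix x assume x: "x \<in> V"
    have "emeasure \<kappa> Q = (\<integral>\<^sup>+y. indicator Q y \<partial>\<kappa>)" by simp
    also have "\<dots> = (\<integral>\<^sup>+y. indicator Q (- x + y) \<partial>\<kappa>)"
      using trans(2)[OF V[OF x]] sets by (intro nn) auto
    finally show "indicator A x * emeasure \<kappa> Q = (\<integral>\<^sup>+y. indicator A x * indicator Q (y - x) \<partial>\<kappa>)"
      by (subst nn_integral_cmult) auto
  qed
  also have "\<dots> = (\<integral>\<^sup>+y. (\<integral>\<^sup>+x. indicator A x * indicator Q (y - x) \<partial>\<mu>) \<partial>\<kappa>)"
    by (rule Fubini'[symmetric]) measurable
  also have "\<dots> = (\<integral>\<^sup>+y. (\<integral>\<^sup>+x. indicator A (y + x) * indicator Q (- x) \<partial>\<mu>) \<partial>\<kappa>)"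
  proof (rule nn_integral_cong_AE, use AE(2) in eventually_elim)
    fix y assume y: "y \<in> V"
    have "(\<integral>\<^sup>+x. indicator A x * indicator Q (y - x) \<partial>\<mu>)
        = (\<integral>\<^sup>+x. indicator A (y + x) * indicator Q (y - (y + x)) \<partial>\<mu>)"
      using trans(1)[OF y] sets by (intro nn) auto
    then show "(\<integral>\<^sup>+x. indicator A x * indicator Q (y - x) \<partial>\<mu>)
        = (\<integral>\<^sup>+x. indicator A (y + x) * indicator Q (- x) \<partial>\<mu>)" by simp
  qed
  also have "\<dots> = (\<integral>\<^sup>+x. (\<integral>\<^sup>+y. indicator A (y + x) * indicator Q (- x) \<partial>\<kappa>) \<partial>\<mu>)"
    by (rule Fubini') measurable
  also have "\<dots> = (\<integral>\<^sup>+x. emeasure \<kappa> A * indicator (uminus -` Q) x \<partial>\<mu>)"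
  proof (rule nn_integral_cong_AE, use AE(1) in eventually_elim)
    fix x assume x: "x \<in> V"
    have "emeasure \<kappa> A = (\<integral>\<^sup>+y. indicator A y \<partial>\<kappa>)" by simp
    also have "\<dots> = (\<integral>\<^sup>+y. indicator A (x + y) \<partial>\<kappa>)"
      using trans(2)[OF x] sets by (intro nn) auto
    finally show "(\<integral>\<^sup>+y. indicator A (y + x) * indicator Q (- x) \<partial>\<kappa>) = emeasure \<kappa> A * indicator (uminus -` Q) x"
      by (subst nn_integral_multc) (auto simp: add.commute indicator_def)
  qed
  also have "\<dots> = emeasure \<kappa> A * emeasure \<mu> (uminus -` Q)"
    by (subst nn_integral_cmult) auto
  finally show ?thesis .
qed

lemma sigma_finite_span_measure: "sigma_finite_measure (span_measure B)" if B: "orthonormal B"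
proof
  let ?C = "range (\<lambda>n::nat. cball (0::'a) (real n + 1))"
  have "(\<Union>n. cball (0::'a) (real n + 1)) = UNIV"
  proof (intro set_eqI iffI UNIV_I)
    fix x :: 'a
    obtain n where "norm x \<le> real n" using real_arch_simple by blast
    then show "x \<in> (\<Union>n. cball 0 (real n + 1))" by (intro UN_I[of n]) auto
  qed
  moreover have "emeasure (span_measure B) (cball 0 (real n + 1)) \<noteq> \<infinity>" for n
    by (subst emeasure_span_ball[OF B]) (auto simp: span_0)
  ultimately show "\<exists>C. countable C \<and> C \<subseteq> sets (span_measure B) \<and> \<Union> C = space (span_measure B)
      \<and> (\<forall>a\<in>C. emeasure (span_measure B) a \<noteq> \<infinity>)"
    by (intro exI[of _ ?C]) auto
qed

text \<open>
  Integer translates of the unit cube cover the span, and each has the finite measure of the cube.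
\<close>

lemma sigma_finite_hausdorff_span:
  assumes B: "orthonormal B"
  shows "sigma_finite_measure (density (hausdorff_measure (card B)) (indicator (span B)))"
    (is "sigma_finite_measure ?\<mu>")
proof
  let ?v = "\<lambda>g. lin_comb B (\<lambda>b. real_of_int (g b))"
  let ?C = "insert (- span B) ((\<lambda>g. (+) (?v g) ` span_cube B) ` (PiE B (\<lambda>_. UNIV)))"
  have em: "emeasure ?\<mu> A = emeasure (hausdorff_measure (card B)) (span B \<inter> A)" if "A \<in> sets borel" for A
    using that by (simp add: emeasure_density indicator_inter_arith[symmetric])
  have closed: "closed ((+) v ` span_cube B)" for v
    by (rule closed_translation[OF closed_span_cube])
  have fin: "emeasure ?\<mu> ((+) v ` span_cube B) < top" for v
  proof -
    have "emeasure ?\<mu> ((+) v ` span_cube B) \<le> emeasure (hausdorff_measure (card B)) ((+) v ` span_cube B)"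
      using borel_closed[OF closed[of v]] by (subst em) (auto intro!: emeasure_mono)
    also have "\<dots> = hausdorff_outer (card B) (span_cube B)"
      using borel_closed[OF closed[of v]] by (simp add: emeasure_hausdorff_measure hausdorff_outer_translate)
    finally show ?thesis using hausdorff_outer_span_cube_finite[OF B] by simp
  qed
  have "countable ?C"
    using orthonormal_finite[OF B] by (intro countable_insert countable_image countable_PiE) auto
  moreover have "?C \<subseteq> sets ?\<mu>"
    using borel_closed[OF closed] by auto
  moreover have "\<Union> ?C = space ?\<mu>"
  proof -
    have "x \<in> (\<Union>g\<in>PiE B (\<lambda>_. UNIV). (+) (?v g) ` span_cube B)" if x: "x \<in> span B" for x
    proof -
      define g where "g = (\<lambda>b\<in>B. \<lfloor>x \<bullet> b\<rfloor>)"
      define z where "z = lin_comb B (\<lambda>b. x \<bullet> b - real_of_int (g b))"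
      have "z \<in> span_cube B"
        by (auto simp: span_cube_def z_def lin_comb_in_span lin_comb_inner[OF B] g_def) linarith
      moreover have "x = ?v g + z"
        by (simp add: z_def lin_comb_diff lin_comb_coefficients[OF B x])
      moreover have "g \<in> PiE B (\<lambda>_. UNIV)" by (simp add: g_def)
      ultimately show ?thesis by blast
    qed
    then show ?thesis by auto
  qed
  moreover have "emeasure ?\<mu> A \<noteq> \<infinity>" if "A \<in> ?C" for A
    using that fin by (auto simp: em less_top[symmetric])
  ultimately show "\<exists>C. countable C \<and> C \<subseteq> sets ?\<mu> \<and> \<Union> C = space ?\<mu> \<and> (\<forall>a\<in>C. emeasure ?\<mu> a \<noteq> \<infinity>)"
    by (intro exI[of _ ?C]) blast
qed

text \<open>
  By translation invariance the two measures differ by a factor c, the Hausdorff measure of the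
  unit cube; it is at least 1 by the isodiametric inequality. Conversely, cover the cube by its
  inscribed ball, of volume \<open>\<theta>\<close> and diameter 1, and a fine cover of the rest. As the diameters do
  not matter for the cube, this gives \<open>c \<le> \<theta> + c * (1 - \<theta>)\<close>, hence \<open>c \<le> 1\<close>.
\<close>

theorem hausdorff_measure_on_span:
  assumes B: "orthonormal B"
  shows "density (hausdorff_measure (card B)) (indicator (span B)) = span_measure B"
    (is "?\<mu> = ?\<kappa>")
proof -
  let ?Q = "span_cube B" and ?k = "card B" and ?H = "hausdorff_measure (card B)"
  have em: "emeasure ?\<mu> A = emeasure ?H (span B \<inter> A)" if "A \<in> sets borel" for A
    using that by (simp add: emeasure_density indicator_inter_arith[symmetric])
  define R where "R = uminus -` ?Q"
  have R [measurable]: "R \<in> sets borel"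
    unfolding R_def using measurable_sets[of uminus borel borel ?Q] by simp
  have QQ: "uminus -` R = ?Q" by (auto simp: R_def)
  have prop_eq: "emeasure ?\<mu> A * emeasure ?\<kappa> R = emeasure ?\<kappa> A * emeasure ?\<mu> ?Q"
    if A: "A \<in> sets borel" for A
    unfolding QQ[symmetric]
  proof (rule translation_invariant_measures_proportional[where V = "span B"])
    show "AE x in ?\<mu>. x \<in> span B" by (subst AE_density) (auto simp: indicator_def)
    fix v assume v: "v \<in> span B"
    then show "- v \<in> span B" by (rule span_neg)
    show "distr ?\<kappa> borel ((+) v) = ?\<kappa>" by (rule span_measure_translate[OF B v])
    show "distr ?\<mu> borel ((+) v) = ?\<mu>"
    proof (rule measure_eqI)
      fix A assume "A \<in> sets (distr ?\<mu> borel ((+) v))"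
      then have A: "A \<in> sets borel" by simp
      then have vA: "(+) v -` A \<in> sets borel"
        using measurable_sets[of "(+) v" borel borel A] by simp
      have "v + x \<in> span B \<longleftrightarrow> x \<in> span B" for x
        using span_add[OF v] span_diff[OF _ v] by force
      then have eq: "span B \<inter> (+) v -` A = (+) v -` (span B \<inter> A)" by auto
      have "emeasure (distr ?\<mu> borel ((+) v)) A = emeasure ?\<mu> ((+) v -` A)"
        using A by (subst emeasure_distr) auto
      also have "\<dots> = emeasure (distr ?H borel ((+) v)) (span B \<inter> A)"
        using A vA by (simp add: em eq emeasure_distr)
      also have "\<dots> = emeasure ?\<mu> A"
        using A by (simp add: hausdorff_measure_translate em)
      finally show "emeasure (distr ?\<mu> borel ((+) v)) A = emeasure ?\<mu> A" .
    qed simp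
  qed (use A in \<open>auto simp: sigma_finite_hausdorff_span[OF B] sigma_finite_span_measure[OF B] AE_span_measure\<close>)
  define c where "c = hausdorff_outer ?k ?Q"
  have "span B \<inter> ?Q = ?Q" by (auto simp: span_cube_def)
  then have \<mu>Q: "emeasure ?\<mu> ?Q = c"
    by (simp add: em emeasure_hausdorff_measure c_def)
  have c_fin: "c < top" unfolding c_def by (rule hausdorff_outer_span_cube_finite[OF B])
  have c1: "1 \<le> c"
    using span_measure_le_hausdorff_outer[OF B span_cube_borel, of B] emeasure_span_cube[OF B]
    by (simp add: c_def)
  have "c * emeasure ?\<kappa> R = c"
    using prop_eq[OF span_cube_borel[of B]] emeasure_span_cube[OF B] by (simp add: \<mu>Q)
  then have "emeasure ?\<kappa> R = 1"
    using ennreal_mult_cancel_left[of c "emeasure ?\<kappa> R" 1] c_fin c1 by auto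
  then have scaled: "emeasure ?\<mu> A = c * emeasure ?\<kappa> A" if "A \<in> sets borel" for A
    using prop_eq[OF that] by (simp add: \<mu>Q mult.commute)
  define z where "z = lin_comb B (\<lambda>_. 1/2)"
  define U where "U = cball z (1/2) \<inter> span B"
  define t where "t = unit_ball_vol (real ?k) * (1/2) ^ ?k"
  have z: "z \<in> span B" unfolding z_def by (rule lin_comb_in_span)
  have U_borel [measurable]: "U \<in> sets borel" unfolding U_def by measurable
  have t: "0 < t" by (simp add: t_def)
  have \<kappa>U: "emeasure ?\<kappa> U = ennreal t"
  proof -
    have "emeasure ?\<kappa> U = emeasure ?\<kappa> (cball z (1/2))"
      using AE_span_measure[of B] by (intro emeasure_eq_AE) (auto simp: U_def)
    then show ?thesis using emeasure_span_ball[OF B z, of "1/2"] by (simp add: t_def)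
  qed
  have "U \<subseteq> ?Q"
  proof
    fix x assume x: "x \<in> U"
    have "0 \<le> x \<bullet> b \<and> x \<bullet> b \<le> 1" if b: "b \<in> B" for b
    proof -
      have "\<bar>(x - z) \<bullet> b\<bar> \<le> 1/2"
        using Cauchy_Schwarz_ineq2[of "x - z" b] x b B
        by (auto simp: U_def dist_norm norm_minus_commute orthonormal_def)
      moreover have "(x - z) \<bullet> b = x \<bullet> b - 1/2"
        by (simp add: inner_diff_left z_def lin_comb_inner[OF B b])
      ultimately show ?thesis by linarith
    qed
    then show "x \<in> ?Q"
      using x by (simp add: span_cube_def U_def)
  qed
  then have "hausdorff_pre ?k 1 ?Q \<le> hausdorff_pre ?k 1 (\<Union>i\<in>{True, False}. if i then U else ?Q - U)"
    by (intro hausdorff_pre_mono) auto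
  also have "\<dots> \<le> (\<Sum>i\<in>{True, False}. hausdorff_pre ?k 1 (if i then U else ?Q - U))"
    by (rule hausdorff_pre_UN_le) auto
  also have "\<dots> = hausdorff_pre ?k 1 U + hausdorff_pre ?k 1 (?Q - U)" by simp
  also have "\<dots> \<le> ennreal t + hausdorff_outer ?k (?Q - U)"
  proof (intro add_mono hausdorff_pre_le_outer)
    have bU: "bounded U" by (simp add: U_def bounded_Int)
    have "diameter U \<le> diameter (cball z (1/2))" by (rule diameter_subset) (auto simp: U_def)
    then have dU: "diameter U \<le> 1" by simp
    have "hausdorff_pre ?k 1 U \<le> hausdorff_content ?k U"
      using bU dU by (rule hausdorff_pre_le_content) simp
    also have "\<dots> \<le> ennreal t"
      using dU diameter_ge_0[OF bU]
      by (auto simp: hausdorff_content_def t_def intro!: ennreal_leI mult_left_mono power_mono)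
    finally show "hausdorff_pre ?k 1 U \<le> ennreal t" .
  qed simp
  also have "hausdorff_outer ?k (?Q - U) = emeasure ?\<mu> (?Q - U)"
  proof -
    have "span B \<inter> (?Q - U) = ?Q - U" by (auto simp: span_cube_def)
    then show ?thesis by (simp add: em emeasure_hausdorff_measure)
  qed
  also have "\<dots> = c * (emeasure ?\<kappa> ?Q - emeasure ?\<kappa> U)"
    using \<open>U \<subseteq> ?Q\<close> \<kappa>U by (simp add: scaled emeasure_Diff)
  finally have "c \<le> ennreal t + c * (1 - ennreal t)"
    using hausdorff_outer_span_cube_le[OF B, of 1] by (simp add: c_def emeasure_span_cube[OF B] \<kappa>U)
  moreover obtain r where r: "c = ennreal r" "0 \<le> r" using c_fin by (cases c) auto
  moreover have "t \<le> 1"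
    using emeasure_mono[OF \<open>U \<subseteq> ?Q\<close>, of ?\<kappa>] t by (simp add: \<kappa>U emeasure_span_cube[OF B])
  ultimately have "ennreal r \<le> ennreal (t + r * (1 - t))"
    using t by (simp add: ennreal_1[symmetric] ennreal_minus ennreal_mult'[symmetric] ennreal_plus[symmetric]
      del: ennreal_1 ennreal_plus)
  then have "r \<le> t + r * (1 - t)"
    using t r \<open>t \<le> 1\<close> by (subst (asm) ennreal_le_iff) auto
  then have "r \<le> 1" using t by (simp add: algebra_simps)
  then have "c = 1" using c1 r by (auto intro: antisym)
  then show ?thesis by (intro measure_eqI) (auto simp: scaled)
qed

section \<open>Integration over a subspace and its orthogonal complement\<close>

lemma orthonormal_union:
  fixes B C :: "'a::euclidean_space set"
  assumes "orthonormal B" "orthonormal C" "span C = (span B)\<^sup>\<bottom>"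
  shows "orthonormal (B \<union> C)" and "B \<inter> C = {}"
proof -
  have orth: "b \<bullet> c = 0" if "b \<in> B" "c \<in> C" for b c
  proof -
    have "c \<in> (span B)\<^sup>\<bottom>" using assms(3) span_base[OF that(2)] by simp
    then show ?thesis using span_base[OF that(1)] by (auto simp: orthogonal_comp_def orthogonal_def)
  qed
  moreover have "c \<bullet> b = 0" if "b \<in> B" "c \<in> C" for b c
    using orth[OF that] by (simp add: inner_commute)
  ultimately show "orthonormal (B \<union> C)"
    using assms(1,2) by (auto simp: orthonormal_def pairwise_def orthogonal_def)
  show "B \<inter> C = {}"
  proof (rule ccontr)
    assume "B \<inter> C \<noteq> {}"
    then obtain b where "b \<in> B" "b \<in> C" by blast
    then show False using orth[of b b] assms(1) by (auto simp: orthonormal_def)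
  qed
qed

lemma orthonormal_basis_exists:
  fixes L :: "'a::euclidean_space set"
  assumes "subspace L"
  obtains B where "orthonormal B" "span B = L" "card B = dim L"
proof -
  obtain B where B: "B \<subseteq> L" "pairwise orthogonal B" "\<And>x. x \<in> B \<Longrightarrow> norm x = 1" "independent B"
    "card B = dim L" "span B = L"
    using orthonormal_basis_subspace[OF assms] by metis
  then have "orthonormal B" by (simp add: orthonormal_def independent_imp_finite)
  then show thesis using B that by blast
qed

lemma card_orthonormal: "orthonormal B \<Longrightarrow> card B = dim (span B)"
proof -
  assume B: "orthonormal B"
  then have "independent B"
    by (intro pairwise_orthogonal_independent) (auto simp: orthonormal_def)
  then show "card B = dim (span B)" by (simp add: dim_eq_card_independent)
qed

lemma orthogonal_bases_exist:
  fixes L :: "'a::euclidean_space set"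
  assumes L: "subspace L"
  obtains B C where "orthonormal B" "span B = L" "card B = dim L"
    "orthonormal C" "span C = L\<^sup>\<bottom>" "card C = DIM('a) - dim L"
    "orthonormal (B \<union> C)" "B \<inter> C = {}" "card (B \<union> C) = DIM('a)" "span (B \<union> C) = UNIV"
proof -
  obtain B where B: "orthonormal B" "span B = L" "card B = dim L"
    using orthonormal_basis_exists[OF L] .
  obtain C where C: "orthonormal C" "span C = L\<^sup>\<bottom>" "card C = dim (L\<^sup>\<bottom>)"
    using orthonormal_basis_exists[OF subspace_orthogonal_comp] .
  have BC: "orthonormal (B \<union> C)" "B \<inter> C = {}"
    using orthonormal_union[OF B(1) C(1)] B(2) C(2) by auto
  have span: "span (B \<union> C) = UNIV"
    using subspace_sum_orthogonal_comp[OF L] unfolding span_Un B C set_plus_def by blast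
  then have card: "card (B \<union> C) = DIM('a)"
    using card_orthonormal[OF BC(1)] by simp
  moreover have "card (B \<union> C) = card B + card C"
    using BC(2) B(1) C(1) by (intro card_Un_disjoint) (auto dest: orthonormal_finite)
  ultimately have "card C = DIM('a) - dim L" using B(3) by simp
  with B C BC span card that show thesis by blast
qed

lemma hausdorff_measure_eq_lborel: "hausdorff_measure DIM('a) = (lborel :: 'a::euclidean_space measure)"
proof -
  have "density (hausdorff_measure DIM('a)) (indicator (span Basis)) = (lborel :: 'a measure)"
    using hausdorff_measure_on_span[OF orthonormal_Basis] by (simp add: span_measure_Basis)
  moreover have "indicator UNIV = (\<lambda>x::'a. 1::ennreal)" by (auto simp: indicator_def)
  ultimately show ?thesis by (simp add: density_1)
qed

text \<open>
  Both sides are Hausdorff measure, which does not refer to a basis. This is the rotation invariance of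
  Lebesgue measure.
\<close>

lemma span_measure_full:
  fixes D :: "'a::euclidean_space set"
  assumes "orthonormal D" "span D = UNIV" "card D = DIM('a)"
  shows "span_measure D = lborel"
proof -
  have "indicator UNIV = (\<lambda>x::'a. 1::ennreal)" by (auto simp: indicator_def)
  then show ?thesis
    using hausdorff_measure_on_span[OF assms(1)] assms(2,3)
    by (simp add: hausdorff_measure_eq_lborel density_1)
qed

lemma nn_integral_span_measure_Un:
  assumes "finite B" "finite C" "B \<inter> C = {}" and [measurable]: "f \<in> borel_measurable borel"
  shows "integral\<^sup>N (span_measure (B \<union> C)) f = (\<integral>\<^sup>+u. (\<integral>\<^sup>+t. f (u + t) \<partial>span_measure C) \<partial>span_measure B)"
proof -
  have merge: "lin_comb (B \<union> C) (merge B C (x, y)) = lin_comb B x + lin_comb C y" for x y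
  proof -
    have "lin_comb (B \<union> C) (merge B C (x, y))
        = (\<Sum>b\<in>B. merge B C (x, y) b *\<^sub>R b) + (\<Sum>b\<in>C. merge B C (x, y) b *\<^sub>R b)"
      unfolding lin_comb_def using assms by (intro sum.union_disjoint) auto
    also have "\<dots> = lin_comb B x + lin_comb C y"
      unfolding lin_comb_def using assms by (intro arg_cong2[of _ _ _ _ "(+)"] sum.cong) (auto simp: merge_def)
    finally show ?thesis .
  qed
  have "integral\<^sup>N (span_measure (B \<union> C)) f
      = (\<integral>\<^sup>+x. (\<integral>\<^sup>+y. f (lin_comb B x + lin_comb C y) \<partial>lborel_on C) \<partial>lborel_on B)"
    using assms by (simp add: nn_integral_span_measure lborel_PiM.product_nn_integral_fold merge)
  also have "\<dots> = (\<integral>\<^sup>+x. (\<integral>\<^sup>+t. f (lin_comb B x + t) \<partial>span_measure C) \<partial>lborel_on B)"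
    by (intro nn_integral_cong, subst nn_integral_span_measure) auto
  also have "\<dots> = (\<integral>\<^sup>+u. (\<integral>\<^sup>+t. f (u + t) \<partial>span_measure C) \<partial>span_measure B)"
  proof (rule nn_integral_span_measure[symmetric])
    interpret finite_product_sigma_finite "\<lambda>_. lborel :: real measure" C by standard fact
    have "(\<lambda>u. \<integral>\<^sup>+y. f (u + lin_comb C y) \<partial>lborel_on C) \<in> borel_measurable borel"
      by measurable
    then show "(\<lambda>u. \<integral>\<^sup>+t. f (u + t) \<partial>span_measure C) \<in> borel_measurable borel"
      by (simp add: nn_integral_span_measure)
  qed
  finally show ?thesis .
qed

subsection \<open>Orthogonal projections\<close>

lemma orth_proj_eqI:
  assumes "subspace L" "y \<in> L" "x - y \<in> L\<^sup>\<bottom>"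
  shows "orth_proj L x = y"
  unfolding orth_proj_def
proof (rule the_equality)
  fix z assume z: "z \<in> L \<and> x - z \<in> L\<^sup>\<bottom>"
  have "z - y \<in> L" using assms z by (simp add: subspace_diff)
  moreover have "z - y \<in> L\<^sup>\<bottom>"
    using subspace_diff[OF subspace_orthogonal_comp assms(3), of "x - z"] z by simp
  ultimately have "(z - y) \<bullet> (z - y) = 0" by (auto simp: orthogonal_comp_def orthogonal_def)
  then show "z = y" by simp
qed (use assms in simp)

lemma orth_proj_decomposition:
  assumes "subspace L"
  shows "orth_proj L x \<in> L" "x - orth_proj L x \<in> L\<^sup>\<bottom>"
proof -
  obtain y z where "y \<in> span L" "\<And>w. w \<in> span L \<Longrightarrow> orthogonal z w" "x = y + z"
    using orthogonal_subspace_decomp_exists by blast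
  then have "y \<in> L" "x - y \<in> L\<^sup>\<bottom>"
    using assms by (auto simp: orthogonal_comp_def orthogonal_commute span_eq_iff[THEN iffD2])
  then show "orth_proj L x \<in> L" "x - orth_proj L x \<in> L\<^sup>\<bottom>"
    using orth_proj_eqI[OF assms] by auto
qed

lemma orth_proj_add:
  assumes "subspace L" "u \<in> L" "t \<in> L\<^sup>\<bottom>"
  shows "orth_proj L (u + t) = u"
  using assms by (intro orth_proj_eqI) auto

lemma linear_orth_proj:
  assumes L: "subspace L"
  shows "linear (orth_proj L)"
proof (rule linearI)
  note P = orth_proj_decomposition[OF L]
  fix x y :: 'a and c :: real
  have "(x - orth_proj L x) + (y - orth_proj L y) \<in> L\<^sup>\<bottom>"
    using P by (intro subspace_add subspace_orthogonal_comp)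
  then show "orth_proj L (x + y) = orth_proj L x + orth_proj L y"
    using P L by (intro orth_proj_eqI) (auto intro: subspace_add simp: algebra_simps)
  have "c *\<^sub>R (x - orth_proj L x) \<in> L\<^sup>\<bottom>"
    using P by (intro subspace_scale subspace_orthogonal_comp)
  then show "orth_proj L (c *\<^sub>R x) = c *\<^sub>R orth_proj L x"
    using P L by (intro orth_proj_eqI) (auto intro: subspace_scale simp: algebra_simps)
qed

lemma orth_proj_orthogonal_comp:
  assumes "subspace L"
  shows "orth_proj (L\<^sup>\<bottom>) x = x - orth_proj L x"
  using orth_proj_decomposition[OF assms, of x] assms
  by (intro orth_proj_eqI subspace_orthogonal_comp) (auto simp: orthogonal_comp_self)

lemma norm_orth_proj_le:
  assumes "subspace L"
  shows "norm (orth_proj L x) \<le> norm x"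
proof -
  have "orthogonal (orth_proj L x) (x - orth_proj L x)"
    using orth_proj_decomposition[OF assms, of x] by (auto simp: orthogonal_comp_def)
  from norm_add_Pythagorean[OF this] have "(norm (orth_proj L x))\<^sup>2 \<le> (norm x)\<^sup>2" by simp
  then show ?thesis by (rule power2_le_imp_le) simp
qed

subsection \<open>Lebesgue measure on a subspace as an image of Lebesgue measure\<close>

text \<open>
  The density of a tube around the complement of L, divided by the volume of its cross-section, the
  unit ball of L. Projecting such tubes to their axes expresses the Lebesgue measures of all subspaces
  of one dimension through \<open>lborel\<close>, in a way that depends measurably on the subspace.
\<close>

definition tube :: "'a::euclidean_space set \<Rightarrow> 'a \<Rightarrow> real" where
  "tube L x = indicator {x. norm (orth_proj L x) \<le> 1} x / unit_ball_vol (real (dim L))"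

lemma tube_nonneg: "0 \<le> tube L x"
  by (simp add: tube_def)

lemma orth_proj_borel:
  fixes L :: "'a::euclidean_space set"
  assumes "subspace L"
  shows "orth_proj L \<in> borel_measurable borel"
  using linear_continuous_on[OF linear_conv_bounded_linear[THEN iffD1, OF linear_orth_proj[OF assms]], of UNIV]
  by (rule borel_measurable_continuous_onI)

lemma tube_borel:
  assumes "subspace L"
  shows "tube L \<in> borel_measurable borel"
proof -
  note [measurable] = orth_proj_borel[OF assms]
  show ?thesis unfolding tube_def by measurable
qed

lemma hausdorff_measure_orthogonal_comp:
  fixes L :: "'a::euclidean_space set"
  assumes L: "subspace L"
  shows "density (hausdorff_measure (DIM('a) - dim L)) (indicator (L\<^sup>\<bottom>))
    = distr (density lborel (\<lambda>x. ennreal (tube L x))) borel (\<lambda>x. x - orth_proj L x)"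
proof -
  note [measurable] = orth_proj_borel[OF L] tube_borel[OF L]
  obtain B C where B: "orthonormal B" "span B = L" "card B = dim L"
    and C: "orthonormal C" "span C = L\<^sup>\<bottom>" "card C = DIM('a) - dim L"
    and BC: "orthonormal (B \<union> C)" "B \<inter> C = {}" "card (B \<union> C) = DIM('a)" "span (B \<union> C) = UNIV"
    using orthogonal_bases_exist[OF L] .
  have "span_measure C = distr (density lborel (\<lambda>x. ennreal (tube L x))) borel (\<lambda>x. x - orth_proj L x)"
    (is "_ = ?D")
  proof (rule measure_eqI)
    fix A assume "A \<in> sets (span_measure C)"
    then have A [measurable]: "A \<in> sets borel" by simp
    have "emeasure ?D A = (\<integral>\<^sup>+x. indicator A x \<partial>?D)" by simp
    also have "\<dots> = (\<integral>\<^sup>+x. ennreal (tube L x) * indicator A (x - orth_proj L x) \<partial>lborel)"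
      by (subst nn_integral_distr; simp?; subst nn_integral_density) (auto simp: tube_nonneg)
    also have "\<dots> = (\<integral>\<^sup>+u. (\<integral>\<^sup>+t. ennreal (tube L (u + t)) * indicator A (u + t - orth_proj L (u + t)) \<partial>span_measure C) \<partial>span_measure B)"
      unfolding span_measure_full[OF BC(1,4,3), symmetric]
      using B(1) C(1) BC(2) by (intro nn_integral_span_measure_Un) (auto dest: orthonormal_finite)
    also have "\<dots> = (\<integral>\<^sup>+u. (\<integral>\<^sup>+t. ennreal (indicator (cball 0 1) u / unit_ball_vol (dim L)) * indicator A t \<partial>span_measure C) \<partial>span_measure B)"
    proof (rule nn_integral_cong_AE, use AE_span_measure[of B] in eventually_elim)
      fix u assume u: "u \<in> span B"
      show "(\<integral>\<^sup>+t. ennreal (tube L (u + t)) * indicator A (u + t - orth_proj L (u + t)) \<partial>span_measure C)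
          = (\<integral>\<^sup>+t. ennreal (indicator (cball 0 1) u / unit_ball_vol (dim L)) * indicator A t \<partial>span_measure C)"
      proof (rule nn_integral_cong_AE, use AE_span_measure[of C] in eventually_elim)
        fix t assume t: "t \<in> span C"
        have "orth_proj L (u + t) = u"
          using u t B(2) C(2) by (intro orth_proj_add[OF L]) auto
        then show "ennreal (tube L (u + t)) * indicator A (u + t - orth_proj L (u + t))
            = ennreal (indicator (cball 0 1) u / unit_ball_vol (dim L)) * indicator A t"
          by (auto simp: tube_def indicator_def)
      qed
    qed
    also have "\<dots> = (\<integral>\<^sup>+u. (ennreal (1 / unit_ball_vol (dim L)) * emeasure (span_measure C) A) * indicator (cball 0 1) u \<partial>span_measure B)"
      by (intro nn_integral_cong, subst nn_integral_cmult) (auto simp: split: split_indicator)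
    also have "\<dots> = (ennreal (1 / unit_ball_vol (dim L)) * emeasure (span_measure C) A) * emeasure (span_measure B) (cball 0 1)"
      by (rule nn_integral_cmult_indicator) simp
    also have "emeasure (span_measure B) (cball 0 1) = ennreal (unit_ball_vol (dim L))"
      using emeasure_span_ball[OF B(1), of 0 1] by (simp add: span_0 B(3))
    finally show "emeasure (span_measure C) A = emeasure ?D A"
      using less_imp_neq[OF unit_ball_vol_pos[of "real (dim L)"]]
      by (simp add: mult.assoc mult.commute[of "emeasure _ A"]) (simp add: mult.assoc[symmetric] ennreal_mult''[symmetric])
  qed simp
  then show ?thesis
    using hausdorff_measure_on_span[OF C(1)] by (simp add: C)
qed

lemma dim_orthogonal_comp:
  fixes L :: "'a::euclidean_space set"
  assumes "subspace L"
  shows "dim (L\<^sup>\<bottom>) = DIM('a) - dim L"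
  using orthogonal_bases_exist[OF assms] card_orthonormal by metis

lemma hausdorff_measure_subspace:
  fixes L :: "'a::euclidean_space set"
  assumes L: "subspace L"
  shows "density (hausdorff_measure (dim L)) (indicator L)
    = distr (density lborel (\<lambda>x. ennreal (tube (L\<^sup>\<bottom>) x))) borel (orth_proj L)"
proof -
  have "dim L \<le> DIM('a)" by (rule dim_subset_UNIV)
  then show ?thesis
    using hausdorff_measure_orthogonal_comp[OF subspace_orthogonal_comp[of L]]
    by (simp add: dim_orthogonal_comp[OF L] orthogonal_comp_self[OF L] orth_proj_orthogonal_comp[OF L])
qed

text \<open>
  Orthonormal bases of L and of its complement together form one of the whole space. It is here that
  the Hausdorff measures of dimension k, \<open>n - k\<close> and n must be normalized consistently.
\<close>

lemma lborel_eq_distr_sum: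
  fixes L :: "'a::euclidean_space set"
  assumes L: "subspace L"
  defines "M \<equiv> density (hausdorff_measure (dim L)) (indicator L)"
    and "N \<equiv> density (hausdorff_measure (DIM('a) - dim L)) (indicator (L\<^sup>\<bottom>))"
  shows "sigma_finite_measure M" "sigma_finite_measure N"
    and "lborel = distr (N \<Otimes>\<^sub>M M) borel (\<lambda>(t, u). u + t)"
proof -
  obtain B C where B: "orthonormal B" "span B = L" "card B = dim L"
    and C: "orthonormal C" "span C = L\<^sup>\<bottom>" "card C = DIM('a) - dim L"
    and BC: "orthonormal (B \<union> C)" "B \<inter> C = {}" "card (B \<union> C) = DIM('a)" "span (B \<union> C) = UNIV"
    using orthogonal_bases_exist[OF L] .
  have M: "M = span_measure B" and N: "N = span_measure C"
    using hausdorff_measure_on_span[OF B(1)] hausdorff_measure_on_span[OF C(1)]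
    by (simp_all add: M_def N_def B C)
  show sf: "sigma_finite_measure M" "sigma_finite_measure N"
    by (simp_all add: M N sigma_finite_span_measure B C)
  interpret M: sigma_finite_measure M by fact
  interpret N: sigma_finite_measure N by fact
  interpret pair_sigma_finite M N ..
  have [measurable_cong]: "sets M = sets borel" "sets N = sets borel" by (simp_all add: M N)
  show "lborel = distr (N \<Otimes>\<^sub>M M) borel (\<lambda>(t, u). u + t)"
  proof (rule measure_eqI)
    fix A assume "A \<in> sets (lborel :: 'a measure)"
    then have [measurable]: "A \<in> sets borel" by simp
    have "emeasure (distr (N \<Otimes>\<^sub>M M) borel (\<lambda>(t, u). u + t)) A
        = (\<integral>\<^sup>+x. indicator A x \<partial>distr (N \<Otimes>\<^sub>M M) borel (\<lambda>(t, u). u + t))" by simp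
    also have "\<dots> = (\<integral>\<^sup>+p. indicator A (snd p + fst p) \<partial>(N \<Otimes>\<^sub>M M))"
      by (subst nn_integral_distr) (auto simp: split_beta')
    also have "\<dots> = (\<integral>\<^sup>+t. (\<integral>\<^sup>+u. indicator A (u + t) \<partial>M) \<partial>N)"
      by (subst M.nn_integral_fst[symmetric]) auto
    also have "\<dots> = (\<integral>\<^sup>+u. (\<integral>\<^sup>+t. indicator A (u + t) \<partial>N) \<partial>M)"
      by (rule Fubini') measurable
    also have "\<dots> = emeasure lborel A"
      unfolding span_measure_full[OF BC(1,4,3), symmetric] M N
      using B(1) C(1) BC(2) by (subst nn_integral_span_measure_Un[symmetric]) (auto dest: orthonormal_finite)
    finally show "emeasure lborel A = emeasure (distr (N \<Otimes>\<^sub>M M) borel (\<lambda>(t, u). u + t)) A" by simp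
  qed simp
qed

section \<open>The space of flats\<close>

definition proj_matrix :: "(real^'n) set \<Rightarrow> real^'n^'n" where
  "proj_matrix L = matrix (orth_proj L)"

definition translate_flat :: "'a::ab_group_add set \<Rightarrow> 'a \<Rightarrow> 'a set" where
  "translate_flat L x = (\<lambda>y. y + x) ` L"

lemma proj_matrix_mult: "subspace L \<Longrightarrow> proj_matrix L *v x = orth_proj L x"
  unfolding proj_matrix_def using matrix_vector_mul(2)[OF linear_orth_proj] by metis

lemma borel_measurable_matrix_vector_mult [measurable (raw)]:
  fixes A :: "'b \<Rightarrow> real^'n^'m"
  assumes [measurable]: "A \<in> borel_measurable M" "x \<in> borel_measurable M"
  shows "(\<lambda>w. A w *v x w) \<in> borel_measurable M"
proof -
  have "continuous_on UNIV (\<lambda>p::(real^'n^'m) \<times> (real^'n). fst p *v snd p)"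
    unfolding matrix_vector_mult_def by (intro continuous_on_vec_lambda continuous_intros)
  then have "(\<lambda>p::(real^'n^'m) \<times> (real^'n). fst p *v snd p) \<in> borel_measurable borel"
    by (rule borel_measurable_continuous_onI)
  then have "(\<lambda>w. (\<lambda>p. fst p *v snd p) (A w, x w)) \<in> borel_measurable M"
    by (rule measurable_compose[rotated]) (intro borel_measurable_Pair; measurable)
  then show ?thesis by simp
qed

lemma direction_translate_flat:
  assumes "subspace L"
  shows "direction (translate_flat L x) = L"
proof -
  have "direction (translate_flat L x) = {u - v | u v. u \<in> L \<and> v \<in> L}"
  proof (intro set_eqI iffI)
    fix z assume "z \<in> direction (translate_flat L x)"
    then obtain u v where "u \<in> L" "v \<in> L" "z = (u + x) - (v + x)"
      by (auto simp: direction_def translate_flat_def)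
    then show "z \<in> {u - v | u v. u \<in> L \<and> v \<in> L}" by auto
  next
    fix z assume "z \<in> {u - v | u v. u \<in> L \<and> v \<in> L}"
    then obtain u v where "u \<in> L" "v \<in> L" "z = (u + x) - (v + x)" by auto
    then show "z \<in> direction (translate_flat L x)"
      unfolding direction_def translate_flat_def by blast
  qed
  also have "\<dots> = L"
    using assms subspace_diff[OF assms] subspace_0[OF assms] by force
  finally show ?thesis .
qed

lemma mem_translate_flat: "y \<in> translate_flat L x \<longleftrightarrow> y - x \<in> L"
  unfolding translate_flat_def by (auto simp: image_iff intro: bexI[of _ "y - x"])

lemma translate_flat_cong:
  assumes "subspace L" "x - y \<in> L"
  shows "translate_flat L x = translate_flat L y"
proof -
  have "z - x \<in> L \<longleftrightarrow> z - y \<in> L" for z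
    using subspace_add[OF assms(1) _ assms(2), of "z - x"] subspace_diff[OF assms(1) _ assms(2), of "z - y"]
    by auto
  then show ?thesis by (auto simp: mem_translate_flat)
qed

lemma translate_flat_in_affine_flats:
  assumes "L \<in> grassmannian k"
  shows "translate_flat L x \<in> affine_flats k"
proof -
  have L: "subspace L" "dim L = k" using assms by (auto simp: grassmannian_def)
  have eq: "translate_flat L x = (+) x ` L" by (auto simp: translate_flat_def add.commute)
  show ?thesis
    using L by (simp add: affine_flats_def eq affine_translation[symmetric] subspace_imp_affine
        aff_dim_translation_eq aff_dim_subspace)
qed

lemma closest_point_translate_flat:
  fixes L :: "(real^'n) set"
  assumes L: "subspace L"
  shows "closest_point (translate_flat L x) 0 = x - orth_proj L x"
proof (rule closest_point_unique[symmetric])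
  have eq: "translate_flat L x = (+) x ` L" by (auto simp: translate_flat_def add.commute)
  show "convex (translate_flat L x)" "closed (translate_flat L x)"
    unfolding eq
    using convex_translation[OF subspace_imp_convex[OF L]] closed_translation[OF closed_subspace[OF L]]
    by blast+
  have "- orth_proj L x \<in> L" using orth_proj_decomposition(1)[OF L] L by (rule subspace_neg[rotated])
  then show "x - orth_proj L x \<in> translate_flat L x" by (simp add: mem_translate_flat)
  show "\<forall>z\<in>translate_flat L x. dist 0 (x - orth_proj L x) \<le> dist 0 z"
  proof
    fix z assume "z \<in> translate_flat L x"
    then have zx: "z - x \<in> L" by (simp add: mem_translate_flat)
    have "orth_proj L z = orth_proj L ((z - x) + x)" by simp
    also have "\<dots> = z - x + orth_proj L x"
      using orth_proj_add[OF L zx, of 0] linear_add[OF linear_orth_proj[OF L], of "z - x" x]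
      by (simp add: subspace_0 subspace_orthogonal_comp)
    finally have "orth_proj (L\<^sup>\<bottom>) z = x - orth_proj L x"
      by (simp add: orth_proj_orthogonal_comp[OF L])
    then show "dist 0 (x - orth_proj L x) \<le> dist 0 z"
      using norm_orth_proj_le[OF subspace_orthogonal_comp, of L z] by simp
  qed
qed

lemma affine_flat_decomposition:
  fixes E :: "(real^'n) set"
  assumes E: "E \<in> affine_flats k"
  shows "direction E \<in> grassmannian k" "E = translate_flat (direction E) (closest_point E 0)"
proof -
  have aff: "affine E" "aff_dim E = int k" using E by (auto simp: affine_flats_def)
  then obtain a where a: "a \<in> E" by (force simp: aff_dim_empty)
  define L where "L = (+) (- a) ` E"
  have L: "subspace L" unfolding L_def using affine_diffs_subspace_subtract[OF aff(1) a] by simp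
  have E_eq: "E = translate_flat L a" by (auto simp: mem_translate_flat L_def)
  have dir: "direction E = L" unfolding E_eq by (rule direction_translate_flat[OF L])
  have "aff_dim L = int k" unfolding L_def using aff(2) by (simp only: aff_dim_translation_eq)
  then have dim: "dim L = k" using aff_dim_subspace[OF L] by simp
  show "direction E \<in> grassmannian k" using dir L dim by (simp add: grassmannian_def)
  have "closest_point E 0 = a - orth_proj L a"
    unfolding E_eq by (rule closest_point_translate_flat[OF L])
  then have "translate_flat L (closest_point E 0) = translate_flat L a"
    using orth_proj_decomposition(1)[OF L, of a] subspace_neg[OF L] by (intro translate_flat_cong[OF L]) auto
  then show "E = translate_flat (direction E) (closest_point E 0)" using dir E_eq by simp
qed

lemma space_flat_space [simp]: "space (flat_space k) = affine_flats k"
  by (simp add: flat_space_def)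

lemma measurable_flat_coordinates:
  "(\<lambda>E. proj_matrix (direction E)) \<in> borel_measurable (flat_space k)"
  "(\<lambda>E. closest_point E 0) \<in> borel_measurable (flat_space k)"
proof -
  have "(\<lambda>E. (proj_matrix (direction E), closest_point E 0)) \<in> flat_space k \<rightarrow>\<^sub>M borel"
    unfolding flat_space_def proj_matrix_def by (rule measurable_vimage_algebra1) simp
  then have *: "(\<lambda>E. (proj_matrix (direction E), closest_point E 0)) \<in> flat_space k \<rightarrow>\<^sub>M borel \<Otimes>\<^sub>M borel"
    by (simp add: borel_prod)
  show "(\<lambda>E. proj_matrix (direction E)) \<in> borel_measurable (flat_space k)"
    "(\<lambda>E. closest_point E 0) \<in> borel_measurable (flat_space k)"
    using measurable_compose[OF * measurable_fst] measurable_compose[OF * measurable_snd] by simp_all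
qed

definition flat_integral :: "nat \<Rightarrow> ('a::euclidean_space \<Rightarrow> real) \<Rightarrow> 'a set \<Rightarrow> real" where
  "flat_integral k g E = (\<integral>x. indicator E x * g x \<partial>hausdorff_measure k)"

lemma flat_integral_translate_flat:
  fixes L :: "'a::euclidean_space set"
  assumes L: "subspace L" "dim L = k" and [measurable]: "g \<in> borel_measurable borel"
  shows "flat_integral k g (translate_flat L t)
    = (\<integral>u. g (u + t) \<partial>density (hausdorff_measure k) (indicator L))"
proof -
  have [measurable]: "L \<in> sets borel" using L(1) by (intro borel_closed closed_subspace)
  have [measurable]: "translate_flat L t \<in> sets borel"
  proof -
    have "translate_flat L t = (\<lambda>y. y - t) -` L \<inter> space borel" by (auto simp: mem_translate_flat)
    then show ?thesis using measurable_sets[of "\<lambda>y. y - t" borel borel L] by simp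
  qed
  have "flat_integral k g (translate_flat L t)
      = (\<integral>x. indicator (translate_flat L t) x * g x \<partial>distr (hausdorff_measure k) borel ((+) t))"
    by (simp add: flat_integral_def hausdorff_measure_translate)
  also have "\<dots> = (\<integral>u. indicator (translate_flat L t) (t + u) * g (t + u) \<partial>hausdorff_measure k)"
    by (rule integral_distr) measurable
  also have "\<dots> = (\<integral>u. indicator L u *\<^sub>R g (u + t) \<partial>hausdorff_measure k)"
    by (intro Bochner_Integration.integral_cong) (auto simp: indicator_def mem_translate_flat add.commute)
  also have "\<dots> = (\<integral>u. g (u + t) \<partial>density (hausdorff_measure k) (\<lambda>x. ennreal (indicator L x)))"
    by (rule integral_density[symmetric]) auto
  finally show ?thesis by (simp add: ennreal_indicator)
qed

lemma flat_integral_eq_lborel: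
  fixes L :: "'a::euclidean_space set"
  assumes L: "subspace L" "dim L = k" and [measurable]: "g \<in> borel_measurable borel"
  shows "flat_integral k g (translate_flat L t)
    = (\<integral>z. tube (L\<^sup>\<bottom>) z * g (orth_proj L z + t) \<partial>lborel)"
proof -
  note [measurable] = orth_proj_borel[OF L(1)] tube_borel[OF subspace_orthogonal_comp[of L]]
  have "flat_integral k g (translate_flat L t)
      = (\<integral>u. g (u + t) \<partial>distr (density lborel (\<lambda>x. ennreal (tube (L\<^sup>\<bottom>) x))) borel (orth_proj L))"
    using hausdorff_measure_subspace[OF L(1)] by (simp add: flat_integral_translate_flat L)
  also have "\<dots> = (\<integral>z. g (orth_proj L z + t) \<partial>density lborel (\<lambda>x. ennreal (tube (L\<^sup>\<bottom>) x)))"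
    by (rule integral_distr) measurable
  also have "\<dots> = (\<integral>z. tube (L\<^sup>\<bottom>) z *\<^sub>R g (orth_proj L z + t) \<partial>lborel)"
    by (rule integral_density) (auto simp: tube_nonneg)
  finally show ?thesis by simp
qed

text \<open>
  Written as an integral over a tube, the integral over a flat depends on the flat only through its
  two coordinates, and jointly measurably on these and the variable of integration.
\<close>

lemma borel_measurable_flat_integral:
  fixes g :: "real^'n \<Rightarrow> real"
  assumes [measurable]: "g \<in> borel_measurable borel"
  shows "flat_integral k g \<in> borel_measurable (flat_space k)"
proof -
  note [measurable] = measurable_flat_coordinates
  define \<Phi> where "\<Phi> A c = (\<integral>z. indicator {p. norm (snd p - fst p *v snd p) \<le> 1} (A, z)
      / unit_ball_vol (real (CARD('n) - k)) * g (A *v z + c) \<partial>lborel)" for A :: "real^'n^'n" and c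
  have "(\<lambda>E. \<Phi> (proj_matrix (direction E)) (closest_point E 0)) \<in> borel_measurable (flat_space k)"
    unfolding \<Phi>_def by measurable
  moreover have "\<Phi> (proj_matrix (direction E)) (closest_point E 0) = flat_integral k g E"
    if "E \<in> space (flat_space k)" for E
  proof -
    have E: "direction E \<in> grassmannian k" "E = translate_flat (direction E) (closest_point E 0)"
      using affine_flat_decomposition[of E k] that by simp_all
    let ?L = "direction E"
    have L: "subspace ?L" "dim ?L = k" using E(1) by (auto simp: grassmannian_def)
    have "flat_integral k g E = flat_integral k g (translate_flat ?L (closest_point E 0))"
      using E(2) by simp
    also have "\<dots> = \<Phi> (proj_matrix ?L) (closest_point E 0)"
      unfolding \<Phi>_def flat_integral_eq_lborel[OF L assms]
      by (intro Bochner_Integration.integral_cong)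
         (auto simp: tube_def proj_matrix_mult[OF L(1)] orth_proj_orthogonal_comp[OF L(1)]
            dim_orthogonal_comp[OF L(1)] L(2) indicator_def)
    finally show ?thesis by simp
  qed
  ultimately show ?thesis by (rule measurable_cong[THEN iffD1, rotated])
qed

locale random_subspace =
  fixes k :: nat and \<nu> :: "(real^'n) set measure"
  assumes haar: "grassmann_haar k \<nu>"
begin

sublocale prob_space \<nu>
  using haar by (simp add: grassmann_haar_def)

lemma space_nu: "space \<nu> = grassmannian k"
  using haar by (simp add: grassmann_haar_def)

lemma subspace_nu: "L \<in> space \<nu> \<Longrightarrow> subspace L" "L \<in> space \<nu> \<Longrightarrow> dim L = k"
  by (auto simp: space_nu grassmannian_def)

lemma measurable_proj_matrix [measurable]: "proj_matrix \<in> borel_measurable \<nu>"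
proof -
  have "proj_matrix \<in> borel_measurable (grassmann_space k :: (real^'n) set measure)"
    unfolding grassmann_space_def proj_matrix_def by (rule measurable_vimage_algebra1) simp
  moreover have "sets \<nu> = sets (grassmann_space k)" using haar by (simp add: grassmann_haar_def)
  ultimately show ?thesis by (simp cong: measurable_cong_sets)
qed

lemma measurable_orth_proj [measurable]: "(\<lambda>p. orth_proj (fst p) (snd p)) \<in> borel_measurable (\<nu> \<Otimes>\<^sub>M lborel)"
proof -
  have "(\<lambda>p. proj_matrix (fst p) *v snd p) \<in> borel_measurable (\<nu> \<Otimes>\<^sub>M (lborel :: (real^'n) measure))"
    by measurable
  then show ?thesis
    by (rule measurable_cong[THEN iffD1, rotated]) (auto simp: space_pair_measure proj_matrix_mult subspace_nu)
qed

lemma measurable_tube [measurable]: "(\<lambda>p. tube (fst p) (snd p)) \<in> borel_measurable (\<nu> \<Otimes>\<^sub>M lborel)"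
proof -
  have "(\<lambda>p. (if norm (orth_proj (fst p) (snd p)) \<le> 1 then 1 else 0) / unit_ball_vol (real k))
      \<in> borel_measurable (\<nu> \<Otimes>\<^sub>M (lborel :: (real^'n) measure))"
    by measurable
  then show ?thesis
    by (rule measurable_cong[THEN iffD1, rotated])
       (auto simp: space_pair_measure tube_def subspace_nu indicator_def)
qed

lemma measurable_translate_flat [measurable]:
  "(\<lambda>p. translate_flat (fst p) (snd p)) \<in> \<nu> \<Otimes>\<^sub>M lborel \<rightarrow>\<^sub>M flat_space k"
  unfolding flat_space_def
proof (rule measurable_vimage_algebra2)
  show "(\<lambda>p. translate_flat (fst p) (snd p)) \<in> space (\<nu> \<Otimes>\<^sub>M lborel) \<rightarrow> affine_flats k"
    by (auto simp: space_pair_measure space_nu intro: translate_flat_in_affine_flats)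
  have "(\<lambda>p. (proj_matrix (fst p), snd p - orth_proj (fst p) (snd p)))
      \<in> \<nu> \<Otimes>\<^sub>M (lborel :: (real^'n) measure) \<rightarrow>\<^sub>M borel"
    unfolding borel_prod[symmetric] by measurable
  then show "(\<lambda>p. (matrix (orth_proj (direction (translate_flat (fst p) (snd p)))),
      closest_point (translate_flat (fst p) (snd p)) 0)) \<in> \<nu> \<Otimes>\<^sub>M lborel \<rightarrow>\<^sub>M borel"
    by (rule measurable_cong[THEN iffD1, rotated])
       (auto simp: space_pair_measure direction_translate_flat closest_point_translate_flat
          proj_matrix_def subspace_nu)
qed

definition complement_measure :: "(real^'n) set \<Rightarrow> (real^'n) measure" where
  "complement_measure L = density (hausdorff_measure (CARD('n) - k)) (indicator (L\<^sup>\<bottom>))"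

lemma complement_measure_eq:
  assumes "L \<in> space \<nu>"
  shows "complement_measure L = distr (density lborel (\<lambda>x. ennreal (tube L x))) borel (\<lambda>x. x - orth_proj L x)"
  using hausdorff_measure_orthogonal_comp[OF subspace_nu(1)[OF assms]] subspace_nu(2)[OF assms]
  by (simp add: complement_measure_def)

lemma translate_flat_complement:
  "L \<in> space \<nu> \<Longrightarrow> translate_flat L (x - orth_proj L x) = translate_flat L x"
  using orth_proj_decomposition(1)[OF subspace_nu(1), of L x] subspace_neg[OF subspace_nu(1), of L]
  by (intro translate_flat_cong) (auto simp: subspace_nu)

lemma measurable_translate_flat_fixed: "L \<in> space \<nu> \<Longrightarrow> translate_flat L \<in> borel \<rightarrow>\<^sub>M flat_space k"
  using measurable_compose[OF measurable_Pair1'[of L \<nu> lborel] measurable_translate_flat] by simp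

text \<open>
  Translating L by an arbitrary x gives the same flat as translating by the component of x in the
  complement of L. So a flat can be generated from L and a point of the tube around the complement,
  and the parameter space no longer varies with L.
\<close>

definition flat_image :: "(real^'n) set measure" where
  "flat_image = distr (density (\<nu> \<Otimes>\<^sub>M lborel) (\<lambda>p. ennreal (tube (fst p) (snd p))))
    (flat_space k) (\<lambda>p. translate_flat (fst p) (snd p))"

lemma sets_flat_image [simp, measurable_cong]: "sets flat_image = sets (flat_space k)"
  by (simp add: flat_image_def)

lemma space_flat_image [simp]: "space flat_image = affine_flats k"
  by (simp add: flat_image_def)

lemma nn_integral_flat_image:
  assumes [measurable]: "f \<in> borel_measurable (flat_space k)"
  shows "integral\<^sup>N flat_image f = (\<integral>\<^sup>+L. (\<integral>\<^sup>+t. f (translate_flat L t) \<partial>complement_measure L) \<partial>\<nu>)"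
proof -
  have "integral\<^sup>N flat_image f
      = (\<integral>\<^sup>+p. ennreal (tube (fst p) (snd p)) * f (translate_flat (fst p) (snd p)) \<partial>(\<nu> \<Otimes>\<^sub>M lborel))"
    unfolding flat_image_def
    by (subst nn_integral_distr; simp?; subst nn_integral_density) (auto simp: tube_nonneg)
  also have "\<dots> = (\<integral>\<^sup>+L. (\<integral>\<^sup>+x. ennreal (tube L x) * f (translate_flat L x) \<partial>lborel) \<partial>\<nu>)"
    by (subst lborel.nn_integral_fst[symmetric]) auto
  also have "\<dots> = (\<integral>\<^sup>+L. (\<integral>\<^sup>+t. f (translate_flat L t) \<partial>complement_measure L) \<partial>\<nu>)"
  proof (rule nn_integral_cong)
    fix L assume L: "L \<in> space \<nu>"
    note [measurable] = orth_proj_borel[OF subspace_nu(1)[OF L]] tube_borel[OF subspace_nu(1)[OF L]]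
      measurable_translate_flat_fixed[OF L]
    show "(\<integral>\<^sup>+x. ennreal (tube L x) * f (translate_flat L x) \<partial>lborel)
        = (\<integral>\<^sup>+t. f (translate_flat L t) \<partial>complement_measure L)"
      unfolding complement_measure_eq[OF L]
      by (subst nn_integral_distr; simp?; subst nn_integral_density)
         (auto simp: translate_flat_complement[OF L])
  qed
  finally show ?thesis .
qed

text \<open>
  The formula that defines the measure of flats gives the values of an image measure; so it is
  countably additive, and the values can be computed from it.
\<close>

lemma flat_measure_eq_flat_image: "flat_measure k \<nu> = flat_image"
proof -
  have "(\<integral>\<^sup>+L. (\<integral>\<^sup>+t\<in>L\<^sup>\<bottom>. indicator B ((\<lambda>x. x + t) ` L) \<partial>hausdorff_measure (CARD('n) - k)) \<partial>\<nu>)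
      = emeasure flat_image B" if [measurable]: "B \<in> sets (flat_space k)" for B
  proof -
    have "emeasure flat_image B = (\<integral>\<^sup>+L. (\<integral>\<^sup>+t. indicator B (translate_flat L t) \<partial>complement_measure L) \<partial>\<nu>)"
      using nn_integral_flat_image[of "indicator B"] by simp
    also have "\<dots> = (\<integral>\<^sup>+L. (\<integral>\<^sup>+t\<in>L\<^sup>\<bottom>. indicator B ((\<lambda>x. x + t) ` L) \<partial>hausdorff_measure (CARD('n) - k)) \<partial>\<nu>)"
    proof (rule nn_integral_cong)
      fix L assume L: "L \<in> space \<nu>"
      note [measurable] = measurable_translate_flat_fixed[OF L]
      have [measurable]: "L\<^sup>\<bottom> \<in> sets borel"
        by (intro borel_closed closed_subspace subspace_orthogonal_comp)
      show "(\<integral>\<^sup>+t. indicator B (translate_flat L t) \<partial>complement_measure L)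
          = (\<integral>\<^sup>+t\<in>L\<^sup>\<bottom>. indicator B ((\<lambda>x. x + t) ` L) \<partial>hausdorff_measure (CARD('n) - k))"
        unfolding complement_measure_def
        by (subst nn_integral_density) (auto simp: translate_flat_def[symmetric] mult.commute)
    qed
    finally show ?thesis by simp
  qed
  then have "flat_measure k \<nu> = measure_of (affine_flats k) (sets (flat_space k)) (emeasure flat_image)"
    unfolding flat_measure_def
    using sets.sigma_sets_eq[of "flat_space k :: (real^'n) set measure"]
      sets.space_closed[of "flat_space k :: (real^'n) set measure"]
    by (intro measure_of_eq) auto
  also have "\<dots> = flat_image"
    using measure_of_of_measure[of flat_image] by simp
  finally show ?thesis .
qed

lemmas nn_integral_flat_measure = nn_integral_flat_image[folded flat_measure_eq_flat_image]

lemma sets_flat_measure [measurable_cong]: "sets (flat_measure k \<nu>) = sets (flat_space k)"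
  by (simp add: flat_measure_eq_flat_image)

lemma integral_flat_measure:
  fixes f :: "(real^'n) set \<Rightarrow> real"
  assumes f: "integrable (flat_measure k \<nu>) f"
  shows "integral\<^sup>L (flat_measure k \<nu>) f
    = (\<integral>L. (\<integral>t. f (translate_flat L t) \<partial>complement_measure L) \<partial>\<nu>)"
proof -
  interpret pair_sigma_finite \<nu> "lborel :: (real^'n) measure" ..
  have [measurable]: "f \<in> borel_measurable (flat_space k)"
    using borel_measurable_integrable[OF f] by (simp cong: measurable_cong_sets add: sets_flat_measure)
  have int: "integrable (\<nu> \<Otimes>\<^sub>M lborel) (\<lambda>p. tube (fst p) (snd p) *\<^sub>R f (translate_flat (fst p) (snd p)))"
    using f unfolding flat_measure_eq_flat_image flat_image_def
    by (subst (asm) integrable_distr_eq; simp?; subst (asm) integrable_density) (auto simp: tube_nonneg)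
  have "integral\<^sup>L (flat_measure k \<nu>) f
      = (\<integral>p. tube (fst p) (snd p) *\<^sub>R f (translate_flat (fst p) (snd p)) \<partial>(\<nu> \<Otimes>\<^sub>M lborel))"
    unfolding flat_measure_eq_flat_image flat_image_def
    by (subst integral_distr; simp?; subst integral_density) (auto simp: tube_nonneg)
  also have "\<dots> = (\<integral>L. (\<integral>x. tube L x *\<^sub>R f (translate_flat L x) \<partial>lborel) \<partial>\<nu>)"
    using integral_fst'[OF int] by simp
  also have "\<dots> = (\<integral>L. (\<integral>t. f (translate_flat L t) \<partial>complement_measure L) \<partial>\<nu>)"
  proof (rule Bochner_Integration.integral_cong)
    fix L assume L: "L \<in> space \<nu>"
    note [measurable] = orth_proj_borel[OF subspace_nu(1)[OF L]] tube_borel[OF subspace_nu(1)[OF L]]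
      measurable_translate_flat_fixed[OF L]
    show "(\<integral>x. tube L x *\<^sub>R f (translate_flat L x) \<partial>lborel)
        = (\<integral>t. f (translate_flat L t) \<partial>complement_measure L)"
      unfolding complement_measure_eq[OF L]
      by (subst integral_distr; simp?; subst integral_density)
         (auto simp: translate_flat_complement[OF L] tube_nonneg)
  qed simp
  finally show ?thesis .
qed

text \<open>
  By Fubini's theorem in \<open>L + L\<^sup>\<bottom>\<close>, integrating g over all translates of a fixed subspace L gives the
  integral of g over the whole space, whatever L is; the weight a only sees L.
\<close>

lemma crofton_function:
  fixes g :: "real^'n \<Rightarrow> real" and a :: "real^'n^'n \<Rightarrow> real"
  assumes g: "integrable lborel g"
    and a [measurable]: "a \<in> borel_measurable borel"
    and bound: "\<And>L. L \<in> space \<nu> \<Longrightarrow> \<bar>a (proj_matrix L)\<bar> \<le> C"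
  defines "F \<equiv> \<lambda>E. a (proj_matrix (direction E)) * flat_integral k g E"
  shows "integrable (flat_measure k \<nu>) F"
    and "integral\<^sup>L (flat_measure k \<nu>) F = (\<integral>L. a (proj_matrix L) \<partial>\<nu>) * integral\<^sup>L lborel g"
proof -
  have g_borel [measurable]: "g \<in> borel_measurable borel"
    using borel_measurable_integrable[OF g] by simp
  note [measurable] = measurable_flat_coordinates(1) borel_measurable_flat_integral[OF g_borel]
  have F [measurable]: "F \<in> borel_measurable (flat_space k)"
    unfolding F_def by measurable
  define M where "M L = density (hausdorff_measure k) (indicator L)" for L :: "(real^'n) set"
  define N where "N = complement_measure"
  have sf: "sigma_finite_measure (M L)" "sigma_finite_measure (N L)"
    and lb: "lborel = distr (N L \<Otimes>\<^sub>M M L) borel (\<lambda>(t, u). u + t)" if L: "L \<in> space \<nu>" for L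
    using lborel_eq_distr_sum[OF subspace_nu(1)[OF L]] subspace_nu(2)[OF L]
    by (simp_all add: M_def N_def complement_measure_def)
  have [measurable_cong]: "sets (M L) = sets borel" "sets (N L) = sets borel" for L
    by (simp_all add: M_def N_def complement_measure_def)
  have F_eq: "F (translate_flat L t) = a (proj_matrix L) * (\<integral>u. g (u + t) \<partial>M L)" if L: "L \<in> space \<nu>" for L t
    using subspace_nu[OF L]
    by (simp add: F_def M_def direction_translate_flat flat_integral_translate_flat)
  have "(\<integral>\<^sup>+E. ennreal (norm (F E)) \<partial>flat_measure k \<nu>) \<le> (\<integral>\<^sup>+L. ennreal C * (\<integral>\<^sup>+x. norm (g x) \<partial>lborel) \<partial>\<nu>)"
  proof (subst nn_integral_flat_measure; (intro nn_integral_mono)?)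
    fix L assume L: "L \<in> space \<nu>"
    interpret M: sigma_finite_measure "M L" by (rule sf(1)[OF L])
    interpret N: sigma_finite_measure "N L" by (rule sf(2)[OF L])
    have "ennreal (norm (F (translate_flat L t))) \<le> ennreal C * (\<integral>\<^sup>+u. norm (g (u + t)) \<partial>M L)" for t
    proof -
      have "ennreal (norm (\<integral>u. g (u + t) \<partial>M L)) \<le> (\<integral>\<^sup>+u. norm (g (u + t)) \<partial>M L)"
      proof (cases "integrable (M L) (\<lambda>u. g (u + t))")
        case True
        then show ?thesis by (rule integral_norm_bound_ennreal)
      qed (simp add: not_integrable_integral_eq)
      then have "ennreal (norm (a (proj_matrix L))) * ennreal (norm (\<integral>u. g (u + t) \<partial>M L))
          \<le> ennreal C * (\<integral>\<^sup>+u. norm (g (u + t)) \<partial>M L)"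
        using bound[OF L] by (intro mult_mono ennreal_leI) auto
      then show ?thesis by (simp add: F_eq[OF L] abs_mult ennreal_mult)
    qed
    then have "(\<integral>\<^sup>+t. ennreal (norm (F (translate_flat L t))) \<partial>complement_measure L)
        \<le> (\<integral>\<^sup>+t. ennreal C * (\<integral>\<^sup>+u. norm (g (u + t)) \<partial>M L) \<partial>N L)"
      unfolding N_def by (intro nn_integral_mono)
    also have "\<dots> = ennreal C * (\<integral>\<^sup>+t. (\<integral>\<^sup>+u. norm (g (u + t)) \<partial>M L) \<partial>N L)"
      by (rule nn_integral_cmult) measurable
    also have "(\<integral>\<^sup>+t. (\<integral>\<^sup>+u. norm (g (u + t)) \<partial>M L) \<partial>N L)
        = (\<integral>\<^sup>+p. norm (g (snd p + fst p)) \<partial>(N L \<Otimes>\<^sub>M M L))"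
      by (subst M.nn_integral_fst[symmetric]) auto
    also have "\<dots> = (\<integral>\<^sup>+x. norm (g x) \<partial>lborel)"
      by (subst lb[OF L], subst nn_integral_distr) (auto simp: split_beta')
    finally show "(\<integral>\<^sup>+t. ennreal (norm (F (translate_flat L t))) \<partial>complement_measure L)
        \<le> ennreal C * (\<integral>\<^sup>+x. norm (g x) \<partial>lborel)" .
  qed simp
  also have "\<dots> = ennreal C * (\<integral>\<^sup>+x. norm (g x) \<partial>lborel)"
    by (simp add: emeasure_space_1)
  also have "\<dots> < \<infinity>"
    using g by (auto simp: integrable_iff_bounded ennreal_mult_less_top)
  finally have "(\<integral>\<^sup>+E. ennreal (norm (F E)) \<partial>flat_measure k \<nu>) < \<infinity>" .
  then show int: "integrable (flat_measure k \<nu>) F"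
    by (intro integrableI_bounded) simp_all
  have "(\<integral>t. F (translate_flat L t) \<partial>complement_measure L) = a (proj_matrix L) * integral\<^sup>L lborel g"
    if L: "L \<in> space \<nu>" for L
  proof -
    interpret M: sigma_finite_measure "M L" by (rule sf(1)[OF L])
    interpret N: sigma_finite_measure "N L" by (rule sf(2)[OF L])
    interpret pair_sigma_finite "N L" "M L" ..
    have "integrable (N L \<Otimes>\<^sub>M M L) (\<lambda>p. g (snd p + fst p))"
      using g by (subst (asm) lb[OF L], subst (asm) integrable_distr_eq) (auto simp: split_beta')
    then have "(\<integral>t. (\<integral>u. g (u + t) \<partial>M L) \<partial>N L) = (\<integral>p. g (snd p + fst p) \<partial>(N L \<Otimes>\<^sub>M M L))"
      using integral_fst'[of "\<lambda>p. g (snd p + fst p)"] by simp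
    also have "\<dots> = integral\<^sup>L lborel g"
      by (subst lb[OF L], subst integral_distr) (auto simp: split_beta')
    finally show ?thesis by (simp add: F_eq[OF L] N_def)
  qed
  then have "integral\<^sup>L (flat_measure k \<nu>) F = (\<integral>L. a (proj_matrix L) * integral\<^sup>L lborel g \<partial>\<nu>)"
    unfolding integral_flat_measure[OF int] by (intro Bochner_Integration.integral_cong) auto
  then show "integral\<^sup>L (flat_measure k \<nu>) F = (\<integral>L. a (proj_matrix L) \<partial>\<nu>) * integral\<^sup>L lborel g"
    by simp
qed

end

section \<open>Moments of the length of a random projection\<close>

definition gauss :: "'a::euclidean_space \<Rightarrow> real" where
  "gauss x = exp (- (norm x)\<^sup>2 / 2)"

lemma gauss_borel [measurable]: "gauss \<in> borel_measurable borel"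
  unfolding gauss_def by measurable

lemma pochhammer_half_nonneg [simp]: "0 \<le> pochhammer (real m / 2) i"
  by (cases "m = 0"; cases i) (auto simp: pochhammer_0_left intro: pochhammer_nonneg)

lemma pochhammer_one_half_nonneg [simp]: "0 \<le> pochhammer (1 / 2 :: real) i"
  using pochhammer_half_nonneg[of 1 i] by simp

lemma std_normal_even_moment:
  "(\<integral>\<^sup>+s. ennreal (s ^ (2 * l) * exp (- s\<^sup>2 / 2)) \<partial>lborel)
    = ennreal (sqrt (2 * pi) * (2 ^ l * pochhammer (1 / 2) l))"
proof -
  have "fact (2 * l) / (2 ^ l * fact l) = (2 ^ l * pochhammer (1 / 2) l :: real)"
    unfolding fact_double by (simp add: power_mult power2_eq_square power_mult_distrib[symmetric] field_simps)
  then have "has_bochner_integral lborel (\<lambda>s. std_normal_density s * s ^ (2 * l)) (2 ^ l * pochhammer (1 / 2) l)"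
    using std_normal_moment_even[of l] by simp
  then have "has_bochner_integral lborel (\<lambda>s. sqrt (2 * pi) * (std_normal_density s * s ^ (2 * l)))
      (sqrt (2 * pi) * (2 ^ l * pochhammer (1 / 2) l))"
    by (rule has_bochner_integral_mult_right)
  moreover have "sqrt (2 * pi) * (std_normal_density s * s ^ (2 * l)) = s ^ (2 * l) * exp (- s\<^sup>2 / 2)" for s
    by (simp add: std_normal_density_def)
  ultimately have "has_bochner_integral lborel (\<lambda>s. s ^ (2 * l) * exp (- s\<^sup>2 / 2))
      (sqrt (2 * pi) * (2 ^ l * pochhammer (1 / 2) l))" by simp
  then show ?thesis
    by (subst nn_integral_eq_integral)
       (auto simp: has_bochner_integral_iff power_mult intro!: mult_nonneg_nonneg)
qed

text \<open>
  Expanding \<open>(s\<^sup>2 + \<dots>) ^ i\<close> binomially turns the step from one dimension to the next into the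
  Vandermonde identity for the rising factorial.
\<close>

lemma gauss_moment_PiM:
  fixes B :: "'i set"
  assumes "finite B"
  shows "(\<integral>\<^sup>+f. ennreal ((\<Sum>b\<in>B. (f b)\<^sup>2) ^ i * exp (- (\<Sum>b\<in>B. (f b)\<^sup>2) / 2)) \<partial>lborel_on B)
    = ennreal (sqrt (2 * pi) ^ card B * (2 ^ i * pochhammer (real (card B) / 2) i))"
  using assms
proof (induction B arbitrary: i rule: finite_induct)
  case empty
  show ?case by (subst lborel_PiM.nn_integral_empty) (simp, cases i, simp_all add: pochhammer_0_left)
next
  case (insert j B)
  let ?S = "\<lambda>f :: 'i \<Rightarrow> real. \<Sum>b\<in>B. (f b)\<^sup>2" and ?c = "sqrt (2 * pi)"
  let ?E = "\<lambda>f. exp (- ?S f / 2)" and ?p = "\<lambda>l. sqrt (2 * pi) * (2 ^ l * pochhammer (1/2) l)"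
    and ?q = "\<lambda>l. sqrt (2 * pi) ^ card B * (2 ^ l * pochhammer (real (card B) / 2) l)"
  have "(\<integral>\<^sup>+f. ennreal ((\<Sum>b\<in>insert j B. (f b)\<^sup>2) ^ i * exp (- (\<Sum>b\<in>insert j B. (f b)\<^sup>2) / 2)) \<partial>lborel_on (insert j B))
      = (\<integral>\<^sup>+f. (\<integral>\<^sup>+s. ennreal ((s\<^sup>2 + ?S f) ^ i * exp (- (s\<^sup>2 + ?S f) / 2)) \<partial>lborel) \<partial>lborel_on B)"
  proof -
    have upd: "(\<Sum>b\<in>B. ((f(j := s)) b)\<^sup>2) = ?S f" for f s
      using insert.hyps by (intro sum.cong) auto
    show ?thesis
      using insert.hyps by (subst lborel_PiM.product_nn_integral_insert) (auto simp: upd simp del: fun_upd_apply simp: fun_upd_same)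
  qed
  also have "\<dots> = (\<integral>\<^sup>+f. (\<Sum>l\<le>i. ennreal (real (i choose l) * ?p l)
      * ennreal (?S f ^ (i - l) * ?E f)) \<partial>lborel_on B)"
  proof (rule nn_integral_cong)
    fix f
    have S: "0 \<le> ?S f" by (rule sum_nonneg) simp
    have "(\<integral>\<^sup>+s. ennreal ((s\<^sup>2 + ?S f) ^ i * exp (- (s\<^sup>2 + ?S f) / 2)) \<partial>lborel)
        = (\<integral>\<^sup>+s. (\<Sum>l\<le>i. ennreal (real (i choose l) * (?S f ^ (i - l) * ?E f))
            * ennreal (s ^ (2 * l) * exp (- s\<^sup>2 / 2))) \<partial>lborel)"
    proof (rule nn_integral_cong)
      fix s :: real
      have "(s\<^sup>2 + ?S f) ^ i * exp (- (s\<^sup>2 + ?S f) / 2)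
          = (\<Sum>l\<le>i. real (i choose l) * (s\<^sup>2) ^ l * ?S f ^ (i - l)) * (exp (- s\<^sup>2 / 2) * ?E f)"
        by (simp add: binomial_ring exp_add[symmetric] diff_divide_distrib)
      also have "\<dots> = (\<Sum>l\<le>i. (real (i choose l) * (?S f ^ (i - l) * ?E f)) * (s ^ (2 * l) * exp (- s\<^sup>2 / 2)))"
        unfolding sum_distrib_right by (intro sum.cong) (simp_all add: power_mult)
      finally show "ennreal ((s\<^sup>2 + ?S f) ^ i * exp (- (s\<^sup>2 + ?S f) / 2))
          = (\<Sum>l\<le>i. ennreal (real (i choose l) * (?S f ^ (i - l) * ?E f)) * ennreal (s ^ (2 * l) * exp (- s\<^sup>2 / 2)))"
        using S by (simp add: ennreal_mult[symmetric] sum_ennreal power_mult)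
    qed
    also have "\<dots> = (\<Sum>l\<le>i. ennreal (real (i choose l) * (?S f ^ (i - l) * ?E f))
        * ennreal (?p l))"
      using std_normal_even_moment by (subst nn_integral_sum) (auto simp: nn_integral_cmult)
    also have "\<dots> = (\<Sum>l\<le>i. ennreal (real (i choose l) * ?p l)
        * ennreal (?S f ^ (i - l) * ?E f))"
      using S by (intro sum.cong) (auto simp: ennreal_mult[symmetric] mult_ac)
    finally show "(\<integral>\<^sup>+s. ennreal ((s\<^sup>2 + ?S f) ^ i * exp (- (s\<^sup>2 + ?S f) / 2)) \<partial>lborel) = \<dots>" .
  qed
  also have "\<dots> = (\<Sum>l\<le>i. ennreal (real (i choose l) * ?p l)
      * ennreal (?q (i - l)))"
    using insert.IH by (subst nn_integral_sum) (auto simp: nn_integral_cmult)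
  also have "\<dots> = ennreal (\<Sum>l\<le>i. real (i choose l) * ?p l
      * ?q (i - l))"
    by (subst sum_ennreal[symmetric]) (auto simp: ennreal_mult[symmetric] intro!: mult_nonneg_nonneg)
  also have "(\<Sum>l\<le>i. real (i choose l) * ?p l
      * ?q (i - l))
      = (\<Sum>l\<le>i. ?c ^ Suc (card B) * 2 ^ i * (real (i choose l) * pochhammer (1/2) l * pochhammer (real (card B) / 2) (i - l)))"
  proof (intro sum.cong refl)
    fix l assume "l \<in> {..i}"
    then have "(2::real) ^ i = 2 ^ l * 2 ^ (i - l)" by (simp add: power_add[symmetric])
    then show "real (i choose l) * ?p l
        * ?q (i - l)
      = ?c ^ Suc (card B) * 2 ^ i * (real (i choose l) * pochhammer (1/2) l * pochhammer (real (card B) / 2) (i - l))"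
      by simp
  qed
  also have "\<dots> = ?c ^ Suc (card B) * 2 ^ i * pochhammer (1/2 + real (card B) / 2) i"
    by (simp only: pochhammer_binomial_sum sum_distrib_left)
  also have "1/2 + real (card B) / 2 = real (card (insert j B)) / 2"
    using insert.hyps by simp
  finally show ?case using insert.hyps by (simp add: mult.assoc)
qed

lemma gauss_moment:
  assumes B: "orthonormal B"
  shows "(\<integral>\<^sup>+x. ennreal (norm x ^ (2 * i) * gauss x) \<partial>span_measure B)
    = ennreal (sqrt (2 * pi) ^ card B * (2 ^ i * pochhammer (real (card B) / 2) i))"
proof -
  have "(norm (lin_comb B f))\<^sup>2 = (\<Sum>b\<in>B. (f b)\<^sup>2)" for f
    by (simp add: norm_lin_comb[OF B] sum_nonneg)
  then show ?thesis
    using gauss_moment_PiM[OF orthonormal_finite[OF B], of i]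
    by (simp add: nn_integral_span_measure gauss_def power_mult)
qed

text \<open>
  The Gaussian weight is a product with respect to every orthogonal decomposition.
\<close>

lemma gauss_moment_orth_proj:
  fixes L :: "'a::euclidean_space set"
  assumes L: "subspace L"
  shows "(\<integral>\<^sup>+v. ennreal (norm (orth_proj L v) ^ (2 * i) * gauss v) \<partial>lborel)
    = ennreal (sqrt (2 * pi) ^ DIM('a) * (2 ^ i * pochhammer (real (dim L) / 2) i))"
proof -
  note [measurable] = orth_proj_borel[OF L]
  obtain B C where B: "orthonormal B" "span B = L" "card B = dim L"
    and C: "orthonormal C" "span C = L\<^sup>\<bottom>" "card C = DIM('a) - dim L"
    and BC: "orthonormal (B \<union> C)" "B \<inter> C = {}" "card (B \<union> C) = DIM('a)" "span (B \<union> C) = UNIV"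
    using orthogonal_bases_exist[OF L] .
  have "(\<integral>\<^sup>+v. ennreal (norm (orth_proj L v) ^ (2 * i) * gauss v) \<partial>lborel)
      = (\<integral>\<^sup>+u. (\<integral>\<^sup>+t. ennreal (norm (orth_proj L (u + t)) ^ (2 * i) * gauss (u + t)) \<partial>span_measure C) \<partial>span_measure B)"
    unfolding span_measure_full[OF BC(1,4,3), symmetric]
    using B(1) C(1) BC(2) by (intro nn_integral_span_measure_Un) (auto dest: orthonormal_finite)
  also have "\<dots> = (\<integral>\<^sup>+u. (\<integral>\<^sup>+t. ennreal (norm u ^ (2 * i) * gauss u) * ennreal (norm t ^ (2 * 0) * gauss t) \<partial>span_measure C) \<partial>span_measure B)"
  proof (rule nn_integral_cong_AE, use AE_span_measure[of B] in eventually_elim)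
    fix u assume u: "u \<in> span B"
    show "(\<integral>\<^sup>+t. ennreal (norm (orth_proj L (u + t)) ^ (2 * i) * gauss (u + t)) \<partial>span_measure C)
        = (\<integral>\<^sup>+t. ennreal (norm u ^ (2 * i) * gauss u) * ennreal (norm t ^ (2 * 0) * gauss t) \<partial>span_measure C)"
    proof (rule nn_integral_cong_AE, use AE_span_measure[of C] in eventually_elim)
      fix t assume t: "t \<in> span C"
      have "orth_proj L (u + t) = u"
        using u t B(2) C(2) by (intro orth_proj_add[OF L]) auto
      moreover have "(norm (u + t))\<^sup>2 = (norm u)\<^sup>2 + (norm t)\<^sup>2"
        using u t B(2) C(2) by (intro norm_add_Pythagorean) (auto simp: orthogonal_comp_def)
      then have "gauss (u + t) = gauss u * gauss t"
        by (simp add: gauss_def exp_add[symmetric] diff_divide_distrib)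
      ultimately show "ennreal (norm (orth_proj L (u + t)) ^ (2 * i) * gauss (u + t))
          = ennreal (norm u ^ (2 * i) * gauss u) * ennreal (norm t ^ (2 * 0) * gauss t)"
        by (simp add: ennreal_mult[symmetric] gauss_def mult_ac)
    qed
  qed
  also have "\<dots> = (\<integral>\<^sup>+u. ennreal (norm u ^ (2 * i) * gauss u) \<partial>span_measure B)
      * (\<integral>\<^sup>+t. ennreal (norm t ^ (2 * 0) * gauss t) \<partial>span_measure C)"
    by (subst nn_integral_multc[symmetric]; simp?; subst nn_integral_cmult) auto
  also have "\<dots> = ennreal ((sqrt (2 * pi) ^ card B * (2 ^ i * pochhammer (real (card B) / 2) i)) * sqrt (2 * pi) ^ card C)"
    unfolding gauss_moment[OF B(1)] gauss_moment[OF C(1)] by (subst ennreal_mult[symmetric]) auto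
  also have "(sqrt (2 * pi) ^ card B * (2 ^ i * pochhammer (real (card B) / 2) i)) * sqrt (2 * pi) ^ card C
      = sqrt (2 * pi) ^ (card B + card C) * (2 ^ i * pochhammer (real (dim L) / 2) i)"
    by (simp add: power_add B(3))
  also have "card B + card C = DIM('a)"
    using BC(2,3) B(1) C(1) by (simp add: card_Un_disjoint orthonormal_finite)
  finally show ?thesis .
qed

text \<open>
  The rising factorial of 0 vanishes unless \<open>i = 0\<close>; this is the convention for the coefficient in
  the case \<open>k = 0\<close>.
\<close>

lemma crofton_coeff_pochhammer:
  assumes "0 < n"
  shows "crofton_coeff n k i = pochhammer (real k / 2) i / pochhammer (real n / 2) i"
proof -
  have G: "pochhammer (real m / 2) i = Gamma (real m / 2 + real i) / Gamma (real m / 2)" if "0 < m" for m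
    using that by (intro pochhammer_Gamma) (auto simp: nonpos_Ints_def)
  show ?thesis
  proof (cases "k = 0")
    case True
    then show ?thesis by (cases i) (auto simp: crofton_coeff_def pochhammer_0_left)
  next
    case False
    then show ?thesis using assms by (simp add: crofton_coeff_def G mult.commute)
  qed
qed

lemma orth_proj_image_orthogonal:
  fixes R :: "real^'n^'n"
  assumes R: "orthogonal_matrix R" and L: "subspace L"
  shows "subspace ((*v) R ` L)" "dim ((*v) R ` L) = dim L"
    "orth_proj ((*v) R ` L) (R *v x) = R *v orth_proj L x"
proof -
  have ot: "orthogonal_transformation ((*v) R)"
    using R by (simp add: orthogonal_transformation_matrix)
  have inner: "(R *v x) \<bullet> (R *v y) = x \<bullet> y" for x y
    using ot by (simp add: orthogonal_transformation_def)
  have inj: "inj ((*v) R)" by (rule orthogonal_transformation_inj[OF ot])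
  have lin: "linear ((*v) R)" by simp
  show sub: "subspace ((*v) R ` L)" using linear_subspace_image[OF lin L] .
  show "dim ((*v) R ` L) = dim L" using dim_image_eq[OF lin] inj by (metis inj_on_subset top_greatest)
  show "orth_proj ((*v) R ` L) (R *v x) = R *v orth_proj L x"
  proof (rule orth_proj_eqI[OF sub])
    show "R *v orth_proj L x \<in> (*v) R ` L" using orth_proj_decomposition(1)[OF L] by blast
    have "R *v x - R *v orth_proj L x = R *v (x - orth_proj L x)"
      by (simp add: matrix_vector_mult_diff_distrib)
    then show "R *v x - R *v orth_proj L x \<in> ((*v) R ` L)\<^sup>\<bottom>"
      using orth_proj_decomposition(2)[OF L, of x]
      by (auto simp: orthogonal_comp_def orthogonal_def inner)
  qed
qed

context random_subspace
begin

text \<open>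
  The invariance in the definition concerns images of sets of subspaces. A rotation permutes
  the Grassmannian, so every measurable set is the image of its preimage, and the image measure is
  invariant as well.
\<close>

lemma rotation_invariant:
  assumes R: "rotation_matrix R"
  shows "(\<lambda>L. (*v) R ` L) \<in> \<nu> \<rightarrow>\<^sub>M \<nu>" and "distr \<nu> \<nu> (\<lambda>L. (*v) R ` L) = \<nu>"
proof -
  let ?T = "\<lambda>L. (*v) R ` L"
  have oR: "orthogonal_matrix R" using R by (simp add: rotation_matrix_def)
  then have RR: "R ** transpose R = mat 1" "transpose R ** R = mat 1"
    by (auto simp: orthogonal_matrix_def orthogonal_matrix)
  have oRt: "orthogonal_matrix (transpose R)" using oR by (simp add: orthogonal_matrix_transpose)
  have sets: "sets \<nu> = sets (grassmann_space k)" using haar by (simp add: grassmann_haar_def)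
  have T_space: "?T L \<in> space \<nu>" if "L \<in> space \<nu>" for L
    using orth_proj_image_orthogonal[OF oR subspace_nu(1)[OF that]] subspace_nu(2)[OF that]
    by (simp add: space_nu grassmannian_def)
  have T_inv: "transpose R *v (R *v x) = x" "R *v (transpose R *v x) = x" for x
    by (simp_all only: matrix_vector_mul_assoc RR matrix_vector_mul_lid)
  have P_eq: "proj_matrix (?T L) = R ** proj_matrix L ** transpose R" if L: "L \<in> space \<nu>" for L
  proof -
    have "proj_matrix (?T L) *v x = (R ** proj_matrix L ** transpose R) *v x" for x
    proof -
      have "proj_matrix (?T L) *v x = orth_proj (?T L) (R *v (transpose R *v x))"
        by (simp only: T_inv proj_matrix_mult[OF subspace_nu(1)[OF T_space[OF L]]])
      also have "\<dots> = R *v (proj_matrix L *v (transpose R *v x))"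
        by (simp only: orth_proj_image_orthogonal[OF oR subspace_nu(1)[OF L]] proj_matrix_mult[OF subspace_nu(1)[OF L]])
      finally show ?thesis by (simp only: matrix_vector_mul_assoc matrix_mul_assoc)
    qed
    then show ?thesis by (simp add: matrix_eq)
  qed
  have cont: "continuous_on UNIV (\<lambda>P :: real^'n^'n. R ** P ** transpose R)"
    unfolding matrix_matrix_mult_def by (intro continuous_on_vec_lambda continuous_intros) 
  have "?T \<in> \<nu> \<rightarrow>\<^sub>M (grassmann_space k :: (real^'n) set measure)"
    unfolding grassmann_space_def
  proof (rule measurable_vimage_algebra2)
    show "?T \<in> space \<nu> \<rightarrow> grassmannian k" using T_space by (auto simp: space_nu)
    have "(\<lambda>L. R ** proj_matrix L ** transpose R) \<in> borel_measurable \<nu>"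
      using measurable_compose[OF measurable_proj_matrix borel_measurable_continuous_onI[OF cont]] .
    then show "(\<lambda>L. matrix (orth_proj (?T L))) \<in> borel_measurable \<nu>"
      unfolding proj_matrix_def[symmetric]
      by (rule measurable_cong[THEN iffD1, rotated]) (simp add: P_eq)
  qed
  then show T: "?T \<in> \<nu> \<rightarrow>\<^sub>M \<nu>" by (simp add: measurable_cong_sets[OF refl sets])
  show "distr \<nu> \<nu> ?T = \<nu>"
  proof (rule measure_eqI)
    fix A assume "A \<in> sets (distr \<nu> \<nu> ?T)"
    then have A: "A \<in> sets \<nu>" by simp
    let ?X = "?T -` A \<inter> space \<nu>"
    have "?T ` ?X = A"
    proof (intro set_eqI iffI)
      fix L assume LA: "L \<in> A"
      then have L: "L \<in> space \<nu>" using sets.sets_into_space[OF A] by blast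
      have TT: "?T ((*v) (transpose R) ` L) = L" by (simp only: image_image T_inv image_ident)
      have "(*v) (transpose R) ` L \<in> space \<nu>"
        using orth_proj_image_orthogonal[OF oRt subspace_nu(1)[OF L]] subspace_nu(2)[OF L]
        by (simp add: space_nu grassmannian_def)
      then show "L \<in> ?T ` ?X"
        using TT LA by (intro image_eqI[of _ _ "(*v) (transpose R) ` L"]) auto
    qed auto
    moreover have "emeasure \<nu> (?T ` ?X) = emeasure \<nu> ?X"
      using haar R measurable_sets[OF T A] by (auto simp: grassmann_haar_def)
    ultimately show "emeasure (distr \<nu> \<nu> ?T) A = emeasure \<nu> A"
      using T A by (simp add: emeasure_distr)
  qed simp
qed

lemma measurable_orth_proj_nu [measurable]: "(\<lambda>L. orth_proj L v) \<in> borel_measurable \<nu>"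
proof -
  have "(\<lambda>L. proj_matrix L *v v) \<in> borel_measurable \<nu>" by measurable
  then show ?thesis
    by (rule measurable_cong[THEN iffD1, rotated]) (simp add: proj_matrix_mult subspace_nu)
qed

text \<open>
  In dimension at least 2, rotations act transitively on spheres.
\<close>

lemma moment_depends_on_norm:
  fixes v w :: "real^'n"
  assumes vw: "norm v = norm w"
  shows "(\<integral>\<^sup>+L. ennreal (norm (orth_proj L v) ^ m) \<partial>\<nu>) = (\<integral>\<^sup>+L. ennreal (norm (orth_proj L w) ^ m) \<partial>\<nu>)"
proof (cases "2 \<le> CARD('n)")
  case True
  obtain f where f: "orthogonal_transformation f" "det (matrix f) = 1" "f v = w"
    using rotation_exists[OF True vw] .
  define R where "R = matrix f"
  have Rv: "R *v x = f x" for x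
    using f(1) matrix_vector_mul(2)[of f] unfolding R_def orthogonal_transformation_def by metis
  have oR: "orthogonal_matrix R"
    using f(1) by (simp add: R_def orthogonal_transformation_matrix)
  then have R: "rotation_matrix R" using f(2) by (simp add: rotation_matrix_def R_def)
  have "(\<integral>\<^sup>+L. ennreal (norm (orth_proj L w) ^ m) \<partial>\<nu>)
      = (\<integral>\<^sup>+L. ennreal (norm (orth_proj L w) ^ m) \<partial>distr \<nu> \<nu> (\<lambda>L. (*v) R ` L))"
    by (simp add: rotation_invariant(2)[OF R])
  also have "\<dots> = (\<integral>\<^sup>+L. ennreal (norm (orth_proj ((*v) R ` L) w) ^ m) \<partial>\<nu>)"
    using rotation_invariant(1)[OF R] by (rule nn_integral_distr) measurable
  also have "\<dots> = (\<integral>\<^sup>+L. ennreal (norm (orth_proj L v) ^ m) \<partial>\<nu>)"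
  proof (rule nn_integral_cong)
    fix L assume L: "L \<in> space \<nu>"
    have "w = R *v v" by (simp only: Rv f(3))
    then have "orth_proj ((*v) R ` L) w = R *v orth_proj L v"
      by (simp only: orth_proj_image_orthogonal[OF oR subspace_nu(1)[OF L]])
    then have "norm (orth_proj ((*v) R ` L) w) = norm (f (orth_proj L v))"
      by (simp only: Rv)
    also have "\<dots> = norm (orth_proj L v)" by (rule orthogonal_transformation_norm[OF f(1)])
    finally show "ennreal (norm (orth_proj ((*v) R ` L) w) ^ m) = ennreal (norm (orth_proj L v) ^ m)"
      by simp
  qed
  finally show ?thesis by simp
next
  case False
  \<comment> \<open>On the line the rotation group is trivial, but w can only be v or \<open>- v\<close>.\<close>
  then have "CARD('n) = 1" using one_le_card_finite[where 'a='n] by linarith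
  then obtain a :: 'n where UN: "UNIV = {a}" by (auto simp: card_1_singleton_iff)
  have "norm x = \<bar>x $ a\<bar>" for x :: "real^'n"
    unfolding norm_vec_def L2_set_def UN by simp
  then have "\<bar>v $ a\<bar> = \<bar>w $ a\<bar>" using vw by simp
  then have "v = w \<or> v = - w"
    using UN by (auto simp: vec_eq_iff abs_eq_iff)
  moreover have "norm (orth_proj L (- w)) = norm (orth_proj L w)" if "L \<in> space \<nu>" for L
    using linear_neg[OF linear_orth_proj[OF subspace_nu(1)[OF that]]] by simp
  ultimately show ?thesis by (auto intro!: nn_integral_cong)
qed

text \<open>
  The moment is a multiple of a power of the norm of v. To find the factor, integrate against the
  Gaussian weight: for a fixed subspace the Gaussian integral splits into one over the subspace and
  one over its complement.
\<close>

lemma projection_moment_nn: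
  fixes v :: "real^'n"
  shows "(\<integral>\<^sup>+L. ennreal (norm (orth_proj L v) ^ (2 * i)) \<partial>\<nu>)
    = ennreal (crofton_coeff CARD('n) k i * norm v ^ (2 * i))"
proof -
  interpret pair_sigma_finite \<nu> "lborel :: (real^'n) measure" ..
  define h where "h v = (\<integral>\<^sup>+L. ennreal (norm (orth_proj L v) ^ (2 * i)) \<partial>\<nu>)" for v
  obtain e :: "real^'n" where e: "norm e = 1" using vector_choose_size[of 1] by auto
  have h: "h v = h e * ennreal (norm v ^ (2 * i))" for v
  proof -
    have "h v = h (norm v *\<^sub>R e)" unfolding h_def by (rule moment_depends_on_norm) (simp add: e)
    also have "\<dots> = (\<integral>\<^sup>+L. ennreal (norm (orth_proj L e) ^ (2 * i)) * ennreal (norm v ^ (2 * i)) \<partial>\<nu>)"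
      unfolding h_def
    proof (rule nn_integral_cong)
      fix L assume "L \<in> space \<nu>"
      then have "orth_proj L (norm v *\<^sub>R e) = norm v *\<^sub>R orth_proj L e"
        by (intro linear_scale linear_orth_proj subspace_nu)
      then show "ennreal (norm (orth_proj L (norm v *\<^sub>R e)) ^ (2 * i))
          = ennreal (norm (orth_proj L e) ^ (2 * i)) * ennreal (norm v ^ (2 * i))"
        by (simp add: power_mult_distrib ennreal_mult mult.commute)
    qed
    also have "\<dots> = h e * ennreal (norm v ^ (2 * i))" unfolding h_def by (rule nn_integral_multc) measurable
    finally show ?thesis .
  qed
  let ?c = "sqrt (2 * pi) ^ CARD('n) * 2 ^ i"
  have "h e * ennreal (?c * pochhammer (real CARD('n) / 2) i) = (\<integral>\<^sup>+v. h v * ennreal (gauss v) \<partial>lborel)"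
  proof -
    have "(\<integral>\<^sup>+v. h v * ennreal (gauss v) \<partial>lborel)
        = (\<integral>\<^sup>+v. h e * ennreal (norm v ^ (2 * i) * gauss v) \<partial>(lborel :: (real^'n) measure))"
      by (subst h) (simp add: ennreal_mult mult.assoc gauss_def)
    also have "\<dots> = h e * (\<integral>\<^sup>+v. ennreal (norm v ^ (2 * i) * gauss v) \<partial>(lborel :: (real^'n) measure))"
      by (rule nn_integral_cmult) measurable
    also have "(\<integral>\<^sup>+v. ennreal (norm v ^ (2 * i) * gauss v) \<partial>(lborel :: (real^'n) measure))
        = ennreal (?c * pochhammer (real CARD('n) / 2) i)"
      using gauss_moment[OF orthonormal_Basis, where 'a = "real^'n", of i] by (simp add: span_measure_Basis mult.assoc)
    finally show ?thesis by simp
  qed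
  also have "\<dots> = (\<integral>\<^sup>+v. (\<integral>\<^sup>+L. ennreal (norm (orth_proj L v) ^ (2 * i) * gauss v) \<partial>\<nu>) \<partial>lborel)"
    unfolding h_def by (intro nn_integral_cong, subst nn_integral_multc[symmetric]) (auto simp: ennreal_mult gauss_def)
  also have "\<dots> = (\<integral>\<^sup>+L. (\<integral>\<^sup>+v. ennreal (norm (orth_proj L v) ^ (2 * i) * gauss v) \<partial>lborel) \<partial>\<nu>)"
    by (rule Fubini') (simp add: split_beta')
  also have "\<dots> = (\<integral>\<^sup>+L. ennreal (?c * pochhammer (real k / 2) i) \<partial>\<nu>)"
    by (intro nn_integral_cong) (simp add: gauss_moment_orth_proj subspace_nu mult.assoc)
  also have "\<dots> = ennreal (?c * pochhammer (real k / 2) i)" by (simp add: emeasure_space_1)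
  finally have eq: "h e * ennreal (?c * pochhammer (real CARD('n) / 2) i) = ennreal (?c * pochhammer (real k / 2) i)" .
  have poch: "0 < pochhammer (real CARD('n) / 2) i" by (rule pochhammer_pos) simp
  have pos: "0 < ?c * pochhammer (real CARD('n) / 2) i" by (simp add: pochhammer_pos)
  have "h e = ennreal (crofton_coeff CARD('n) k i)"
  proof (cases "h e")
    case (real q)
    then have "q * (?c * pochhammer (real CARD('n) / 2) i) = ?c * pochhammer (real k / 2) i"
      using eq pos by (simp add: ennreal_mult[symmetric] pochhammer_nonneg del: mult_eq_0_iff)
    then show ?thesis using real poch by (simp add: crofton_coeff_pochhammer field_simps)
  next
    case top
    then show ?thesis using eq pos poch by (simp add: ennreal_top_mult)
  qed
  then show ?thesis
    using h[of v] by (simp add: h_def ennreal_mult[symmetric] crofton_coeff_pochhammer)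
qed

lemma projection_moment:
  fixes v :: "real^'n"
  shows "(\<integral>L. norm (orth_proj L v) ^ (2 * i) \<partial>\<nu>) = crofton_coeff CARD('n) k i * norm v ^ (2 * i)"
proof -
  have "0 \<le> crofton_coeff CARD('n) k i * norm v ^ (2 * i)"
    by (simp add: crofton_coeff_pochhammer)
  then show ?thesis
    by (subst integral_eq_nn_integral) (auto simp: projection_moment_nn)
qed

end

section \<open>Symmetric multilinear forms\<close>

definition multilinear_form :: "nat \<Rightarrow> 'n::finite tensor \<Rightarrow> bool" where
  "multilinear_form p T \<longleftrightarrow> (\<forall>y z. (\<forall>j<p. y j = z j) \<longrightarrow> T y = T z) \<and>
    (\<forall>l<p. \<forall>y. linear (\<lambda>v. T (y(l := v))))"

definition symmetric_form :: "nat \<Rightarrow> 'n::finite tensor \<Rightarrow> bool" where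
  "symmetric_form p T \<longleftrightarrow> (\<forall>\<sigma> y. \<sigma> permutes {..<p} \<longrightarrow> T (\<lambda>j. y (\<sigma> j)) = T y)"

lemma multilinear_formD:
  assumes "multilinear_form p T"
  shows "(\<And>j. j < p \<Longrightarrow> y j = z j) \<Longrightarrow> T y = T z"
    and "l < p \<Longrightarrow> linear (\<lambda>v. T (y(l := v)))"
  using assms by (auto simp: multilinear_form_def)

text \<open>
  The product rule for moving the argument of the first m slots from v in the direction w, by
  splitting off the last of these slots linearly.
\<close>

lemma has_derivative_multilinear_form:
  assumes T: "multilinear_form p T" and "m \<le> p"
  shows "((\<lambda>s. T (\<lambda>j. if j < m then v + s *\<^sub>R w else z j)) has_real_derivative
    (\<Sum>l<m. T ((\<lambda>j. if j < m then v else z j)(l := w)))) (at 0)"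
  using assms(2)
proof (induction m arbitrary: z)
  case 0
  then show ?case by simp
next
  case (Suc m)
  then have m: "m < p" "m \<le> p" by auto
  let ?g = "\<lambda>x s. T (\<lambda>j. if j < m then v + s *\<^sub>R w else (z(m := x)) j)"
  have upd: "(\<lambda>j. if j < Suc m then a else z j) = (\<lambda>j. if j < m then a else z j)(m := a)" for a
    by (auto simp: fun_eq_iff less_Suc_eq)
  have upd': "(\<lambda>j. if j < m then a else z j)(m := x) = (\<lambda>j. if j < m then a else (z(m := x)) j)" for a x
    by (auto simp: fun_eq_iff)
  have split: "T (\<lambda>j. if j < Suc m then v + s *\<^sub>R w else z j) = ?g v s + s * ?g w s" for s
  proof -
    note lin = multilinear_formD(2)[OF T m(1), of "\<lambda>j. if j < m then v + s *\<^sub>R w else z j"]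
    show ?thesis
      unfolding upd using linear_add[OF lin, of v "s *\<^sub>R w"] linear_scale[OF lin, of s w]
      by (simp add: upd')
  qed
  have "((\<lambda>s. ?g v s + s * ?g w s) has_real_derivative
      (\<Sum>l<m. T ((\<lambda>j. if j < m then v else (z(m := v)) j)(l := w)))
      + (0 * (\<Sum>l<m. T ((\<lambda>j. if j < m then v else (z(m := w)) j)(l := w))) + 1 * ?g w 0)) (at 0)"
    by (intro DERIV_add DERIV_mult' Suc.IH m DERIV_ident)
  also have "(\<Sum>l<m. T ((\<lambda>j. if j < m then v else (z(m := v)) j)(l := w)))
      + (0 * (\<Sum>l<m. T ((\<lambda>j. if j < m then v else (z(m := w)) j)(l := w))) + 1 * ?g w 0)
      = (\<Sum>l<Suc m. T ((\<lambda>j. if j < Suc m then v else z j)(l := w)))"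
  proof -
    have V: "(\<lambda>j. if j < m then v else (z(m := v)) j) = (\<lambda>j. if j < Suc m then v else z j)"
      by (auto simp: fun_eq_iff less_Suc_eq)
    have "?g w 0 = T ((\<lambda>j. if j < Suc m then v else z j)(m := w))"
      by (intro arg_cong[of _ _ T]) (auto simp: fun_eq_iff less_Suc_eq)
    then show ?thesis
      unfolding V sum.lessThan_Suc by (simp only: mult_zero_left mult_1 add_0)
  qed
  finally show ?case unfolding split .
qed

text \<open>
  Polarization: if T vanishes whenever its first \<open>m + 1\<close> arguments agree, then so does the derivative
  along \<open>v + s *\<^sub>R w\<close>, which by symmetry is \<open>m + 1\<close> times the value with w in slot m. In this way
  one argument after the other becomes free.
\<close>

lemma symmetric_form_eq_0:
  assumes T: "multilinear_form p T" and sym: "symmetric_form p T"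
    and diag: "\<And>v. T (\<lambda>_. v) = 0"
  shows "T y = 0"
proof -
  have "\<forall>v z. T (\<lambda>j. if j < p - d then v else z j) = 0" if "d \<le> p" for d
    using that
  proof (induction d)
    case 0
    have "T (\<lambda>j. if j < p then v else z j) = T (\<lambda>_. v)" for v z
      by (rule multilinear_formD(1)[OF T]) simp
    then show ?case using diag by simp
  next
    case (Suc d)
    define m where "m = p - Suc d"
    have m: "p - d = Suc m" "Suc m \<le> p" using Suc.prems by (auto simp: m_def)
    have "T (\<lambda>j. if j < m then v else z j) = 0" for v z
    proof -
      let ?V = "\<lambda>j. if j < Suc m then v else z j"
      have "((\<lambda>s. T (\<lambda>j. if j < Suc m then v + s *\<^sub>R z m else z j)) has_real_derivative
          (\<Sum>l<Suc m. T (?V(l := z m)))) (at 0)"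
        by (rule has_derivative_multilinear_form[OF T m(2)])
      moreover have "(\<lambda>s::real. T (\<lambda>j. if j < Suc m then v + s *\<^sub>R z m else z j)) = (\<lambda>s. 0)"
        using Suc m(1) by simp
      ultimately have zero: "(\<Sum>l<Suc m. T (?V(l := z m))) = 0"
        using DERIV_unique DERIV_const by metis
      have swap: "T (?V(l := z m)) = T (?V(m := z m))" if l: "l < Suc m" for l
      proof -
        have "Transposition.transpose l m permutes {..<p}"
          using l m(2) by (intro permutes_swap_id) auto
        then have "T (\<lambda>j. (?V(l := z m)) (Transposition.transpose l m j)) = T (?V(l := z m))"
          using sym by (simp only: symmetric_form_def)
        moreover have "(\<lambda>j. (?V(l := z m)) (Transposition.transpose l m j)) = ?V(m := z m)"
          using l by (auto simp: fun_eq_iff Transposition.transpose_def)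
        ultimately show ?thesis by simp
      qed
      have "(\<Sum>l<Suc m. T (?V(l := z m))) = (\<Sum>l<Suc m. T (?V(m := z m)))"
        by (rule sum.cong[OF refl], rule swap) simp
      then have "real (Suc m) * T (?V(m := z m)) = 0"
        unfolding zero by (simp only: sum_constant card_lessThan)
      then have "T (?V(m := z m)) = 0" by (metis mult_eq_0_iff nat.distinct(2) of_nat_eq_0_iff)
      moreover have "?V(m := z m) = (\<lambda>j. if j < m then v else z j)"
      proof
        fix j show "(?V(m := z m)) j = (if j < m then v else z j)"
          by (cases "j = m") simp_all
      qed
      ultimately show ?thesis by (simp only:)
    qed
    then show ?case by (simp add: m_def)
  qed
  from this[of p] show ?thesis by simp
qed

lemma symmetric_form_symm_prod:
  fixes a b :: "'n::finite tensor"
  shows "symmetric_form (p + q) (symm_prod p q a b)"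
  unfolding symmetric_form_def
proof (intro allI impI)
  fix \<tau> :: "nat \<Rightarrow> nat" and y :: "nat \<Rightarrow> real^'n" assume \<tau>: "\<tau> permutes {..<p + q}"
  have "(\<Sum>\<sigma> | \<sigma> permutes {..<p + q}. a (\<lambda>j. y (\<sigma> j)) * b (\<lambda>j. y (\<sigma> (p + j))))
      = (\<Sum>\<sigma> | \<sigma> permutes {..<p + q}. a (\<lambda>j. y ((\<tau> \<circ> \<sigma>) j)) * b (\<lambda>j. y ((\<tau> \<circ> \<sigma>) (p + j))))"
    by (rule setum_permutations_compose_left[OF \<tau>])
  then show "symm_prod p q a b (\<lambda>j. y (\<tau> j)) = symm_prod p q a b y"
    by (simp add: symm_prod_def)
qed

lemma linear_times_const:
  fixes f :: "'a::real_vector \<Rightarrow> real"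
  assumes "linear f"
  shows "linear (\<lambda>x. f x * c)" "linear (\<lambda>x. c * f x)"
  using linear_add[OF assms] linear_scale[OF assms]
  by (auto intro!: linearI simp: algebra_simps)

lemma linear_sum_divide:
  fixes f :: "'i \<Rightarrow> 'a::real_vector \<Rightarrow> real"
  assumes "\<And>i. i \<in> I \<Longrightarrow> linear (f i)"
  shows "linear (\<lambda>x. (\<Sum>i\<in>I. f i x) / c)"
proof (rule linearI)
  fix x y and r :: real
  show "(\<Sum>i\<in>I. f i (x + y)) / c = (\<Sum>i\<in>I. f i x) / c + (\<Sum>i\<in>I. f i y) / c"
    using assms by (simp add: linear_add sum.distrib add_divide_distrib)
  show "(\<Sum>i\<in>I. f i (r *\<^sub>R x)) / c = r *\<^sub>R ((\<Sum>i\<in>I. f i x) / c)"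
    using assms by (simp add: linear_scale sum_distrib_left)
qed

lemma multilinear_form_symm_prod:
  fixes a b :: "'n::finite tensor"
  assumes a: "multilinear_form p a" and b: "multilinear_form q b"
  shows "multilinear_form (p + q) (symm_prod p q a b)"
  unfolding multilinear_form_def
proof (intro conjI allI impI)
  fix y z :: "nat \<Rightarrow> real^'n" assume yz: "\<forall>j<p + q. y j = z j"
  have "a (\<lambda>j. y (\<sigma> j)) = a (\<lambda>j. z (\<sigma> j)) \<and> b (\<lambda>j. y (\<sigma> (p + j))) = b (\<lambda>j. z (\<sigma> (p + j)))"
    if \<sigma>: "\<sigma> permutes {..<p + q}" for \<sigma>
  proof -
    have "\<sigma> j < p + q" if "j < p + q" for j using permutes_in_image[OF \<sigma>, of j] that by simp
    then show ?thesis
      using yz by (intro conjI multilinear_formD(1)[OF a] multilinear_formD(1)[OF b]) auto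
  qed
  then show "symm_prod p q a b y = symm_prod p q a b z"
    unfolding symm_prod_def by (intro arg_cong2[of _ _ _ _ "(/)"] sum.cong) auto
next
  fix l and y :: "nat \<Rightarrow> real^'n" assume l: "l < p + q"
  have "linear (\<lambda>v. a (\<lambda>j. (y(l := v)) (\<sigma> j)) * b (\<lambda>j. (y(l := v)) (\<sigma> (p + j))))"
    if \<sigma>: "\<sigma> permutes {..<p + q}" for \<sigma>
  proof -
    define l' where "l' = inv \<sigma> l"
    have l': "l' < p + q" "\<sigma> j = l \<longleftrightarrow> j = l'" for j
      using permutes_in_image[OF permutes_inv[OF \<sigma>], of l] l permutes_inverses[OF \<sigma>]
      by (auto simp: l'_def)
    show ?thesis
    proof (cases "l' < p")
      case True
      have "(\<lambda>j. (y(l := v)) (\<sigma> j)) = (\<lambda>j. y (\<sigma> j))(l' := v)"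
        "(\<lambda>j. (y(l := v)) (\<sigma> (p + j))) = (\<lambda>j. y (\<sigma> (p + j)))" for v
        using True by (auto simp: fun_eq_iff l')
      then show ?thesis
        using linear_times_const(1)[OF multilinear_formD(2)[OF a True]] by simp
    next
      case False
      then have "l' - p < q" using l'(1) by simp
      have "b (\<lambda>j. (y(l := v)) (\<sigma> (p + j))) = b ((\<lambda>j. y (\<sigma> (p + j)))(l' - p := v))" for v
        using False by (intro arg_cong[of _ _ b]) (auto simp: fun_eq_iff l')
      moreover have "a (\<lambda>j. (y(l := v)) (\<sigma> j)) = a (\<lambda>j. y (\<sigma> j))" for v
        using False by (intro multilinear_formD(1)[OF a]) (auto simp: l')
      ultimately show ?thesis
        using linear_times_const(2)[OF multilinear_formD(2)[OF b \<open>l' - p < q\<close>]] by simp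
    qed
  qed
  then show "linear (\<lambda>v. symm_prod p q a b (y(l := v)))"
    unfolding symm_prod_def by (intro linear_sum_divide) simp
qed

lemma symm_prod_diag: "symm_prod p q a b (\<lambda>_. v) = a (\<lambda>_. v) * b (\<lambda>_. v)"
proof -
  have "card {\<sigma>. \<sigma> permutes {..<p + q}} = fact (p + q)"
    by (rule card_permutations) auto
  then show ?thesis by (simp add: symm_prod_def)
qed

lemma symmetric_form_symm_pow: "symmetric_form (p * i) (symm_pow p a i)"
proof (cases i)
  case (Suc l)
  then show ?thesis using symmetric_form_symm_prod[of p "p * l" a "symm_pow p a l"] by simp
qed (simp add: symmetric_form_def)

lemma multilinear_form_symm_pow:
  assumes "multilinear_form p a"
  shows "multilinear_form (p * i) (symm_pow p a i)"
proof (induction i)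
  case 0
  then show ?case by (simp add: multilinear_form_def)
next
  case (Suc i)
  then show ?case using multilinear_form_symm_prod[OF assms] by simp
qed

lemma symm_pow_diag: "symm_pow p a i (\<lambda>_. v) = a (\<lambda>_. v) ^ i"
  by (induction i) (simp_all add: symm_prod_diag)

lemma multilinear_form_bilinear:
  assumes "bilinear f"
  shows "multilinear_form 2 (\<lambda>y. f (y 0) (y 1))"
  unfolding multilinear_form_def
proof (intro conjI allI impI)
  fix l :: nat and y assume "l < 2"
  then consider "l = 0" | "l = 1" by linarith
  then show "linear (\<lambda>v. f ((y(l := v)) 0) ((y(l := v)) 1))"
    using assms by cases (auto simp: bilinear_def)
qed auto

lemma bilinear_inner: "bilinear (\<lambda>x y :: real^'n. x \<bullet> y)"
  by (simp add: bilinear_def linearI inner_add_left inner_add_right)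

lemma multilinear_metric_tensor: "multilinear_form 2 metric_tensor"
  unfolding metric_tensor_def by (rule multilinear_form_bilinear[OF bilinear_inner])

text \<open>
  The metric tensor of a flat as a function of its projection matrix, the coordinate by which the
  measurable structure of the Grassmannian is defined.
\<close>

definition matrix_tensor :: "real^'n^'n \<Rightarrow> 'n tensor" where
  "matrix_tensor A = (\<lambda>y. (A *v y 0) \<bullet> (A *v y 1))"

lemma multilinear_matrix_tensor: "multilinear_form 2 (matrix_tensor A)"
  unfolding matrix_tensor_def
  by (intro multilinear_form_bilinear)
     (simp add: bilinear_def linearI inner_add_left inner_add_right matrix_vector_right_distrib
        matrix_vector_mult_scaleR)

lemma borel_measurable_matrix_tensor [measurable]: "(\<lambda>A. matrix_tensor A y) \<in> borel_measurable borel"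
  unfolding matrix_tensor_def by measurable

lemma borel_measurable_symm_pow_matrix_tensor [measurable]:
  "(\<lambda>A. symm_pow 2 (matrix_tensor A) i y) \<in> borel_measurable borel"
proof (induction i arbitrary: y)
  case (Suc i)
  note [measurable] = Suc.IH
  show ?case unfolding symm_pow.simps symm_prod_def by measurable
qed simp

context random_subspace
begin

lemma flat_metric_tensor_eq:
  "direction E \<in> grassmannian k \<Longrightarrow> flat_metric_tensor E = matrix_tensor (proj_matrix (direction E))"
  by (auto simp: flat_metric_tensor_def matrix_tensor_def proj_matrix_mult grassmannian_def)

lemma symm_pow_matrix_tensor_bounded:
  "\<exists>C. \<forall>y. \<forall>L\<in>space \<nu>. \<bar>symm_pow 2 (matrix_tensor (proj_matrix L)) i y\<bar> \<le> C y"
proof (induction i)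
  case 0
  show ?case by (rule exI[of _ "\<lambda>_. 1"]) simp
next
  case (Suc i)
  then obtain C where C: "\<And>y L. L \<in> space \<nu> \<Longrightarrow> \<bar>symm_pow 2 (matrix_tensor (proj_matrix L)) i y\<bar> \<le> C y"
    by blast
  let ?N = "{\<sigma>. \<sigma> permutes {..<2 + 2 * i}}" and ?Q = "\<lambda>L. matrix_tensor (proj_matrix L)"
  let ?C = "\<lambda>y. (\<Sum>\<sigma>\<in>?N. (norm (y (\<sigma> 0)) * norm (y (\<sigma> 1))) * C (\<lambda>j. y (\<sigma> (2 + j)))) / fact (2 + 2 * i)"
  have "\<bar>symm_pow 2 (matrix_tensor (proj_matrix L)) (Suc i) y\<bar> \<le> ?C y" if L: "L \<in> space \<nu>" for y L
  proof -
    have M: "\<bar>?Q L z\<bar> \<le> norm (z 0) * norm (z 1)" for z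
    proof -
      have "\<bar>?Q L z\<bar> \<le> norm (orth_proj L (z 0)) * norm (orth_proj L (z 1))"
        using Cauchy_Schwarz_ineq2 by (simp add: matrix_tensor_def proj_matrix_mult subspace_nu[OF L])
      also have "\<dots> \<le> norm (z 0) * norm (z 1)"
        by (intro mult_mono norm_orth_proj_le subspace_nu[OF L]) auto
      finally show ?thesis .
    qed
    have "\<bar>\<Sum>\<sigma>\<in>?N. ?Q L (\<lambda>j. y (\<sigma> j)) * symm_pow 2 (?Q L) i (\<lambda>j. y (\<sigma> (2 + j)))\<bar>
        \<le> (\<Sum>\<sigma>\<in>?N. \<bar>?Q L (\<lambda>j. y (\<sigma> j)) * symm_pow 2 (?Q L) i (\<lambda>j. y (\<sigma> (2 + j)))\<bar>)"
      by (rule sum_abs)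
    also have "\<dots> \<le> (\<Sum>\<sigma>\<in>?N. (norm (y (\<sigma> 0)) * norm (y (\<sigma> 1))) * C (\<lambda>j. y (\<sigma> (2 + j))))"
      unfolding abs_mult by (intro sum_mono mult_mono M C L) auto
    finally show ?thesis
      by (simp add: symm_prod_def divide_right_mono del: fact_Suc)
  qed
  then show ?case by (intro exI[of _ ?C]) blast
qed

lemma integrable_symm_pow_matrix_tensor:
  "integrable \<nu> (\<lambda>L. symm_pow 2 (matrix_tensor (proj_matrix L)) i y)"
proof -
  obtain C where "\<And>y L. L \<in> space \<nu> \<Longrightarrow> \<bar>symm_pow 2 (matrix_tensor (proj_matrix L)) i y\<bar> \<le> C y"
    using symm_pow_matrix_tensor_bounded by blast
  then show ?thesis by (intro integrable_const_bound[of _ "C y"]) auto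
qed

text \<open>
  Both sides are symmetric multilinear forms, so it suffices to compare diagonal values, which are
  the moments of the length of a projection.
\<close>

lemma integral_symm_pow_matrix_tensor:
  "(\<integral>L. symm_pow 2 (matrix_tensor (proj_matrix L)) i y \<partial>\<nu>)
    = crofton_coeff CARD('n) k i * symm_pow 2 metric_tensor i y"
proof -
  let ?c = "crofton_coeff CARD('n) k i"
  let ?A = "\<lambda>L. symm_pow 2 (matrix_tensor (proj_matrix L)) i"
  let ?T = "\<lambda>y. (\<integral>L. ?A L y \<partial>\<nu>) - ?c * symm_pow 2 metric_tensor i y"
  note A = multilinear_form_symm_pow[OF multilinear_matrix_tensor, of i]
  note Q = multilinear_form_symm_pow[OF multilinear_metric_tensor, of i]
  have "?T y = 0"
  proof (rule symmetric_form_eq_0)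
    show "multilinear_form (2 * i) ?T"
      unfolding multilinear_form_def
    proof (intro conjI allI impI)
      fix y z :: "nat \<Rightarrow> real^'n" assume yz: "\<forall>j<2 * i. y j = z j"
      have "?A L y = ?A L z" for L using yz by (intro multilinear_formD(1)[OF A]) simp
      moreover have "symm_pow 2 metric_tensor i y = symm_pow 2 metric_tensor i z"
        using yz by (intro multilinear_formD(1)[OF Q]) simp
      ultimately show "?T y = ?T z" by simp
    next
      fix l and y :: "nat \<Rightarrow> real^'n" assume l: "l < 2 * i"
      note linA = multilinear_formD(2)[OF A l, of _ y] and linQ = multilinear_formD(2)[OF Q l, of y]
      show "linear (\<lambda>v. ?T (y(l := v)))"
      proof (rule linearI)
        fix v w :: "real^'n" and r :: real
        show "?T (y(l := v + w)) = ?T (y(l := v)) + ?T (y(l := w))"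
          using linear_add[OF linA] linear_add[OF linQ]
          by (simp add: integrable_symm_pow_matrix_tensor algebra_simps)
        show "?T (y(l := r *\<^sub>R v)) = r *\<^sub>R ?T (y(l := v))"
          using linear_scale[OF linA] linear_scale[OF linQ] by (simp add: algebra_simps)
      qed
    qed
    show "symmetric_form (2 * i) ?T"
      unfolding symmetric_form_def
    proof (intro allI impI)
      fix \<sigma> :: "nat \<Rightarrow> nat" and y :: "nat \<Rightarrow> real^'n" assume \<sigma>: "\<sigma> permutes {..<2 * i}"
      have "symm_pow 2 a i (\<lambda>j. y (\<sigma> j)) = symm_pow 2 a i y" for a
        using symmetric_form_symm_pow[of 2 i a] \<sigma> by (simp only: symmetric_form_def)
      then show "?T (\<lambda>j. y (\<sigma> j)) = ?T y" by simp
    qed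
    fix v :: "real^'n"
    have "(\<integral>L. ?A L (\<lambda>_. v) \<partial>\<nu>) = (\<integral>L. norm (orth_proj L v) ^ (2 * i) \<partial>\<nu>)"
      by (intro Bochner_Integration.integral_cong)
         (auto simp: symm_pow_diag matrix_tensor_def proj_matrix_mult subspace_nu power_mult power2_norm_eq_inner)
    also have "\<dots> = ?c * norm v ^ (2 * i)" by (rule projection_moment)
    finally show "?T (\<lambda>_. v) = 0"
      by (simp add: symm_pow_diag metric_tensor_def power_mult power2_norm_eq_inner)
  qed
  then show ?thesis by simp
qed

end

section \<open>The Crofton formula\<close>

text \<open>
  Each summand of the symmetrization is the product of an entry of the power of the metric tensor of
  E, which only sees the direction of E, and of the integral over E of a monomial restricted to
  \<open>K \<inter> \<beta>\<close>.
\<close>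

theorem theorem1:
  fixes K \<beta> :: "(real^'n) set"
    and \<nu> :: "(real^'n) set measure"
    and i k r s :: nat
  assumes "K \<noteq> {}" "compact K" "convex K"
    and "\<beta> \<in> sets borel"
    and "k < CARD('n)"
    and "grassmann_haar k \<nu>"
  shows "let F = (\<lambda>E. symm_prod (2 * i) (r + s)
                        (symm_pow 2 (flat_metric_tensor E) i)
                        (phi_flat k E r s (K \<inter> E) (\<beta> \<inter> E)))
         in tensor_integrable (flat_measure k \<nu>) F \<and>
            (s = 0 \<longrightarrow>
               tensor_integral (flat_measure k \<nu>) F =
               (\<lambda>y. crofton_coeff CARD('n) k i *
                    symm_prod (2 * i) r (symm_pow 2 metric_tensor i) (phi_full r K \<beta>) y)) \<and>
            (s \<noteq> 0 \<longrightarrow> tensor_integral (flat_measure k \<nu>) F = (\<lambda>y. 0))"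
proof -
  interpret random_subspace k \<nu> by unfold_locales fact
  define F where "F E = symm_prod (2 * i) (r + s) (symm_pow 2 (flat_metric_tensor E) i)
      (phi_flat k E r s (K \<inter> E) (\<beta> \<inter> E))" for E
  let ?c = "crofton_coeff CARD('n) k i" and ?M = "flat_measure k \<nu>"
  have main: "integrable ?M (\<lambda>E. F E y) \<and>
      integral\<^sup>L ?M (\<lambda>E. F E y) = ?c * symm_prod (2 * i) r (symm_pow 2 metric_tensor i) (phi_full r K \<beta>) y"
    if s: "s = 0" for y
  proof -
    define g where "g z x = indicator (K \<inter> \<beta>) x * (\<Prod>j<r. x \<bullet> z j)" for z :: "nat \<Rightarrow> real^'n" and x
    have g_int: "integrable lborel (g z)" for z
    proof -
      have "integrable lborel (\<lambda>x. indicator K x *\<^sub>R (\<Prod>j<r. x \<bullet> z j))"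
        using assms(2) by (rule borel_integrable_compact) (intro continuous_intros)
      then have "integrable lborel (\<lambda>x. indicator \<beta> x *\<^sub>R (indicator K x *\<^sub>R (\<Prod>j<r. x \<bullet> z j)))"
        by (rule integrable_mult_indicator[rotated]) (simp add: assms(4))
      moreover have "indicator \<beta> x *\<^sub>R (indicator K x *\<^sub>R (\<Prod>j<r. x \<bullet> z j)) = g z x" for x
        by (auto simp: g_def indicator_def)
      ultimately show ?thesis by simp
    qed
    have phi_flat: "phi_flat k E r s (K \<inter> E) (\<beta> \<inter> E) z = flat_integral k (g z) E" for E z
      unfolding phi_flat_def tensor_set_integral_def set_lebesgue_integral_def flat_integral_def g_def
      using s by (auto simp: symm_pow_vec_tensor indicator_def simp del: One_nat_def intro!: Bochner_Integration.integral_cong)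
    have phi_full: "phi_full r K \<beta> z = integral\<^sup>L lborel (g z)" for z
      using hausdorff_measure_eq_lborel[where 'a = "real^'n"]
      by (simp add: phi_full_def tensor_set_integral_def set_lebesgue_integral_def symm_pow_vec_tensor g_def[abs_def] del: One_nat_def)
    let ?N = "{\<sigma>. \<sigma> permutes {..<2 * i + r}}"
    define G where "G \<sigma> E = symm_pow 2 (matrix_tensor (proj_matrix (direction E))) i (\<lambda>j. y (\<sigma> j))
        * flat_integral k (g (\<lambda>j. y (\<sigma> (2 * i + j)))) E" for \<sigma> E
    obtain C where C: "\<And>y L. L \<in> space \<nu> \<Longrightarrow> \<bar>symm_pow 2 (matrix_tensor (proj_matrix L)) i y\<bar> \<le> C y"
      using symm_pow_matrix_tensor_bounded by blast
    have G: "integrable ?M (G \<sigma>)"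
      "integral\<^sup>L ?M (G \<sigma>) = ?c * (symm_pow 2 metric_tensor i (\<lambda>j. y (\<sigma> j)) * phi_full r K \<beta> (\<lambda>j. y (\<sigma> (2 * i + j))))" for \<sigma>
      using crofton_function[OF g_int borel_measurable_symm_pow_matrix_tensor C]
      unfolding G_def[abs_def] phi_full by (simp_all add: integral_symm_pow_matrix_tensor)
    have F_eq: "F E y = (\<Sum>\<sigma>\<in>?N. G \<sigma> E) / fact (2 * i + r)" if "E \<in> space ?M" for E
    proof -
      have "E \<in> affine_flats k" using that by (simp add: flat_measure_eq_flat_image)
      then have "flat_metric_tensor E = matrix_tensor (proj_matrix (direction E))"
        by (intro flat_metric_tensor_eq affine_flat_decomposition)
      then show ?thesis using s by (simp add: F_def symm_prod_def G_def phi_flat[unfolded s])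
    qed
    have "integrable ?M (\<lambda>E. (\<Sum>\<sigma>\<in>?N. G \<sigma> E) / fact (2 * i + r))"
      using G(1) by auto
    then have int: "integrable ?M (\<lambda>E. F E y)"
      by (rule Bochner_Integration.integrable_cong[THEN iffD1, rotated 2]) (simp_all add: F_eq)
    have "integral\<^sup>L ?M (\<lambda>E. F E y) = integral\<^sup>L ?M (\<lambda>E. (\<Sum>\<sigma>\<in>?N. G \<sigma> E) / fact (2 * i + r))"
      by (rule Bochner_Integration.integral_cong) (simp_all add: F_eq)
    also have "\<dots> = (\<Sum>\<sigma>\<in>?N. integral\<^sup>L ?M (G \<sigma>)) / fact (2 * i + r)"
      using G(1) by (simp add: Bochner_Integration.integral_sum)
    also have "\<dots> = ?c * symm_prod (2 * i) r (symm_pow 2 metric_tensor i) (phi_full r K \<beta>) y"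
      by (simp add: G(2) symm_prod_def sum_distrib_left)
    finally show ?thesis using int by simp
  qed
  have zero: "F E y = 0" if "s \<noteq> 0" for E y
    using that by (simp add: F_def symm_prod_def phi_flat_def)
  have "tensor_integrable ?M F"
    unfolding tensor_integrable_def using main zero by (cases "s = 0") auto
  moreover have "tensor_integral ?M F
      = (\<lambda>y. ?c * symm_prod (2 * i) r (symm_pow 2 metric_tensor i) (phi_full r K \<beta>) y)" if "s = 0"
    using main[OF that] by (auto simp: tensor_integral_def)
  moreover have "tensor_integral ?M F = (\<lambda>y. 0)" if "s \<noteq> 0"
    using zero[OF that] by (auto simp: tensor_integral_def)
  ultimately show ?thesis unfolding F_def[abs_def] Let_def by blast
qed

end
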